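(* Let $\Omega\subseteq\mathbb{R}^d$ be an open set with uniformly Lipschitz boundary and let $T>0$. Assume that $b\in L^\infty(]0,T[\times\Omega;\mathbb{R}^d)$ is a vector field such that $\mathrm{div}\,b$ is a locally finite Radon measure on $]0,T[\times\Omega$. Then there is a unique function, denoted $\mathrm{Tr}\,b$, that belongs to $L^\infty(]0,T[\times\partial\Omega)$ and satisfies, for all $\varphi\in C^\infty_c([0,T[\times\mathbb{R}^d)$, $$\int_0^T\!\!\int_{\partial\Omega}\mathrm{Tr}\,b\;\varphi\,d\mathcal{H}^{d-1}dt-\int_\Omega\varphi(0,x)\,dx=\int_0^T\!\!\int_\Omega(\partial_t\varphi+b\cdot\nabla\varphi)\,dxdt+\int_0^T\!\!\int_\Omega\varphi\,d(\mathrm{div}\,b).$$ Also, if $w\in L^\infty(]0,T[\times\Omega)$ and $f\in L^\infty(]0,T[\times\Omega)$ satisfy $$\int_0^T\!\!\int_\Omega w(\partial_t\eta+b\cdot\nabla\eta)\,dxdt+\int_0^T\!\!\int_\Omega f\eta\,dxdt=0\qquad\forall\,\eta\in C^\infty_c(]0,T[\times\Omega),$$ then there are two uniquely determined functions, denoted $\mathrm{Tr}(bw)\in L^\infty(]0,T[\times\partial\Omega)$ and $w_0\in L^\infty(\Omega)$, that satisfy, for all $\varphi\in C^\infty_c([0,T[\times\mathbb{R}^d)$, $$\int_0^T\!\!\int_{\partial\Omega}\mathrm{Tr}(bw)\,\varphi\,d\mathcal{H}^{d-1}dt-\int_\Omega\varphi(0,\cdot)w_0\,dx=\int_0^T\!\!\int_\Omega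 w(\partial_t\varphi+b\cdot\nabla\varphi)\,dxdt+\int_0^T\!\!\int_\Omega f\varphi\,dxdt.$$
   Context: Here $\mathrm{div}$ and $\nabla$ denote the (distributional) divergence and the gradient with respect to the space variable $x\in\Omega$ only. $\mathcal{H}^{d-1}$ is $(d-1)$-dimensional Hausdorff measure, and $L^\infty(]0,T[\times\partial\Omega)$ is taken with respect to $\mathcal{L}^1\otimes\mathcal{H}^{d-1}$, where $\mathcal{L}^1$ is one-dimensional Lebesgue measure. Uniformly Lipschitz boundary (Leoni, A First Course in Sobolev Spaces, Definition 12.10): there are $\varepsilon,L>0$, $M\in\mathbb{N}$ and a locally finite countable open cover $\{U_n\}$ of $\partial\Omega$ such that (i) for every $x\in\partial\Omega$ the ball of radius $\varepsilon$ centered at $x$ is contained in some $U_n$; (ii) no point of $\mathbb{R}^d$ belongs to more than $M$ of the $U_n$; (iii) for each $n$ there are local (rigid) coordinates $y=(y',y_d)$ and a Lipschitz function $f_n:\mathbb{R}^{d-1}\to\mathbb{R}$ with Lipschitz constant at most $L$ such that $U_n\cap\Omega=U_n\cap\{y_d>f_n(y')\}$.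
   Formalization: Local finiteness of div b is required up to the boundary, on compact subsets of [0,T[×R^d intersected with ]0,T[×Ω, since otherwise the integral of φ against div b need not exist (e.g. Ω=]0,∞[, b=sin(1/x)). *)

theory Defs
  imports "HOL-Analysis.Analysis"
begin

section \<open>Hausdorff measure\<close>

text \<open>
  Only bounded covering sets are admitted, because \<^const>\<open>diameter\<close> is \<open>0\<close> on unbounded sets.
  Empty sets contribute nothing, also for \<open>k = 0\<close>, where \<open>0 ^ 0 = 1\<close>.  With the factor
  \<^term>\<open>unit_ball_vol k\<close> the measure agrees with Lebesgue measure in dimension \<open>k\<close>.
\<close>

definition hausdorff_weight :: "nat \<Rightarrow> 'a::metric_space set \<Rightarrow> ennreal" where
  "hausdorff_weight k C =
     (if C = {} then 0 else ennreal (unit_ball_vol (real k) * (diameter C / 2) ^ k))"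

definition hausdorff_content :: "nat \<Rightarrow> real \<Rightarrow> 'a::metric_space set \<Rightarrow> ennreal" where
  "hausdorff_content k \<delta> A =
     (INF C \<in> {C :: nat \<Rightarrow> 'a set. A \<subseteq> (\<Union>i. C i) \<and> (\<forall>i. bounded (C i) \<and> diameter (C i) \<le> \<delta>)}.
        \<Sum>i. hausdorff_weight k (C i))"

definition hausdorff_outer :: "nat \<Rightarrow> 'a::metric_space set \<Rightarrow> ennreal" where
  "hausdorff_outer k A = (SUP \<delta>\<in>{0<..}. hausdorff_content k \<delta> A)"

definition hausdorff_measure :: "nat \<Rightarrow> 'a::metric_space measure" where
  "hausdorff_measure k = measure_of UNIV (sets borel) (hausdorff_outer k)"

subsection \<open>\<^const>\<open>hausdorff_measure\<close> is a measure on the Borel sets\<close>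

lemma hausdorff_weight_mono:
  assumes "A \<subseteq> B" "bounded B"
  shows "hausdorff_weight k A \<le> hausdorff_weight k B"
proof -
  have "0 \<le> diameter A" "diameter A \<le> diameter B"
    using assms by (auto intro: diameter_ge_0 diameter_subset bounded_subset)
  then show ?thesis
    using assms by (auto simp: hausdorff_weight_def intro!: ennreal_leI mult_left_mono power_mono)
qed

definition hausdorff_ext_weight :: "nat \<Rightarrow> real \<Rightarrow> 'a::metric_space set \<Rightarrow> ennreal" where
  "hausdorff_ext_weight k \<delta> C = (if bounded C \<and> diameter C \<le> \<delta> then hausdorff_weight k C else \<infinity>)"

lemma hausdorff_ext_weight_mono:
  assumes "A \<subseteq> B"
  shows "hausdorff_ext_weight k \<delta> A \<le> hausdorff_ext_weight k \<delta> B"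
proof (cases "bounded B \<and> diameter B \<le> \<delta>")
  case True
  then have "bounded A" "diameter A \<le> \<delta>"
    using assms diameter_subset[of A B] bounded_subset by (auto intro: order_trans)
  then show ?thesis
    using True hausdorff_weight_mono[OF assms] by (simp add: hausdorff_ext_weight_def)
qed (auto simp: hausdorff_ext_weight_def)

lemma hausdorff_ext_weight_pos_inc:
  assumes "\<delta> > 0"
  shows "positive (Pow UNIV) (hausdorff_ext_weight k \<delta> :: 'a::metric_space set \<Rightarrow> ennreal)"
    and "increasing (Pow UNIV) (hausdorff_ext_weight k \<delta> :: 'a set \<Rightarrow> ennreal)"
  using assms hausdorff_ext_weight_mono
  by (auto simp: positive_def increasing_def) (simp add: hausdorff_ext_weight_def hausdorff_weight_def)

lemma hausdorff_content_eq_outer_measure: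
  fixes A :: "'a::metric_space set"
  assumes "\<delta> > 0"
  shows "hausdorff_content k \<delta> A = outer_measure (Pow UNIV) (hausdorff_ext_weight k \<delta>) A"
proof (rule antisym)
  show "hausdorff_content k \<delta> A \<le> outer_measure (Pow UNIV) (hausdorff_ext_weight k \<delta>) A"
    unfolding outer_measure_def
  proof (rule INF_greatest)
    fix C :: "nat \<Rightarrow> 'a set"
    assume C: "C \<in> {C. range C \<subseteq> Pow UNIV \<and> disjoint_family C \<and> A \<subseteq> (\<Union>i. C i)}"
    show "hausdorff_content k \<delta> A \<le> (\<Sum>i. hausdorff_ext_weight k \<delta> (C i))"
    proof (cases "\<forall>i. bounded (C i) \<and> diameter (C i) \<le> \<delta>")
      case True
      then have "(\<Sum>i. hausdorff_ext_weight k \<delta> (C i)) = (\<Sum>i. hausdorff_weight k (C i))"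
        by (simp add: hausdorff_ext_weight_def)
      then show ?thesis
        using C True unfolding hausdorff_content_def by (auto intro!: INF_lower2[of C])
    next
      case False
      then obtain i where "\<not> (bounded (C i) \<and> diameter (C i) \<le> \<delta>)" by blast
      then have "hausdorff_ext_weight k \<delta> (C i) = \<infinity>"
        by (simp only: hausdorff_ext_weight_def if_False)
      moreover have "hausdorff_ext_weight k \<delta> (C i) \<le> (\<Sum>i. hausdorff_ext_weight k \<delta> (C i))"
        using sum_le_suminf[of "\<lambda>i. hausdorff_ext_weight k \<delta> (C i)" "{i}"] by simp
      ultimately have "(\<Sum>i. hausdorff_ext_weight k \<delta> (C i)) = \<infinity>"
        by (simp add: top_unique)
      then show ?thesis by simp
    qed
  qed
next
  show "outer_measure (Pow UNIV) (hausdorff_ext_weight k \<delta>) A \<le> hausdorff_content k \<delta> A"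
    unfolding hausdorff_content_def
  proof (rule INF_greatest)
    fix C :: "nat \<Rightarrow> 'a set"
    assume C: "C \<in> {C. A \<subseteq> (\<Union>i. C i) \<and> (\<forall>i. bounded (C i) \<and> diameter (C i) \<le> \<delta>)}"
    interpret ring_of_sets UNIV "Pow (UNIV :: 'a set)"
      by (rule ring_of_sets_Pow)
    have "outer_measure (Pow UNIV) (hausdorff_ext_weight k \<delta>) A
        \<le> (\<Sum>i. hausdorff_ext_weight k \<delta> (C i))"
      by (rule outer_measure_le)
        (use C hausdorff_ext_weight_pos_inc[OF assms] in auto)
    also have "\<dots> = (\<Sum>i. hausdorff_weight k (C i))"
      using C by (simp add: hausdorff_ext_weight_def)
    finally show "outer_measure (Pow UNIV) (hausdorff_ext_weight k \<delta>) A
        \<le> (\<Sum>i. hausdorff_weight k (C i))" .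
  qed
qed

lemma outer_measure_space_hausdorff_content:
  assumes "\<delta> > 0"
  shows "outer_measure_space (Pow UNIV) (hausdorff_content k \<delta> :: 'a::metric_space set \<Rightarrow> ennreal)"
proof -
  interpret ring_of_sets UNIV "Pow (UNIV :: 'a set)"
    by (rule ring_of_sets_Pow)
  have "hausdorff_content k \<delta> = outer_measure (Pow UNIV) (hausdorff_ext_weight k \<delta> :: 'a set \<Rightarrow> _)"
    using hausdorff_content_eq_outer_measure[OF assms] by blast
  then show ?thesis
    using outer_measure_space_outer_measure[OF hausdorff_ext_weight_pos_inc[OF assms]] by simp
qed

lemma outer_measure_space_hausdorff_outer:
  "outer_measure_space (Pow UNIV) (hausdorff_outer k :: 'a::metric_space set \<Rightarrow> ennreal)"
proof -
  note * = outer_measure_space_hausdorff_content[where 'a='a and k=k, unfolded outer_measure_space_def]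
  have "hausdorff_outer k ({}::'a set) = 0"
  proof -
    have "(SUP \<delta>\<in>{0<..}. hausdorff_content k \<delta> ({}::'a set)) = (SUP \<delta>\<in>{0::real<..}. 0)"
      using * by (intro SUP_cong) (auto simp: positive_def)
    then show ?thesis by (simp add: hausdorff_outer_def)
  qed
  moreover have "hausdorff_outer k A \<le> hausdorff_outer k B" if "A \<subseteq> B" for A B :: "'a set"
    unfolding hausdorff_outer_def using * that
    by (intro SUP_mono) (auto simp: increasing_def)
  moreover have "hausdorff_outer k (\<Union>i. A i) \<le> (\<Sum>i. hausdorff_outer k (A i))"
    if "disjoint_family A" for A :: "nat \<Rightarrow> 'a set"
    unfolding hausdorff_outer_def[of _ "\<Union>i. A i"]
  proof (rule SUP_least)
    fix \<delta> :: real assume \<delta>: "\<delta> \<in> {0<..}"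
    then have "hausdorff_content k \<delta> (\<Union>i. A i) \<le> (\<Sum>i. hausdorff_content k \<delta> (A i))"
      using * that by (auto simp: countably_subadditive_def)
    also have "\<dots> \<le> (\<Sum>i. hausdorff_outer k (A i))"
      unfolding hausdorff_outer_def by (intro suminf_le SUP_upper \<delta>) auto
    finally show "hausdorff_content k \<delta> (\<Union>i. A i) \<le> (\<Sum>i. hausdorff_outer k (A i))" .
  qed
  ultimately show ?thesis
    by (auto simp: outer_measure_space_def positive_def increasing_def countably_subadditive_def)
qed

lemma hausdorff_outer_empty: "hausdorff_outer k {} = 0"
  and hausdorff_outer_mono: "A \<subseteq> B \<Longrightarrow> hausdorff_outer k A \<le> hausdorff_outer k B"
  using outer_measure_space_hausdorff_outer[of k]
  by (auto simp: outer_measure_space_def positive_def increasing_def)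

lemma hausdorff_outer_UN:
  fixes A :: "nat \<Rightarrow> 'a::metric_space set"
  shows "hausdorff_outer k (\<Union>i. A i) \<le> (\<Sum>i. hausdorff_outer k (A i))"
proof -
  have "hausdorff_outer k (\<Union>i. A i) = hausdorff_outer k (\<Union>i. disjointed A i)"
    by (simp add: UN_disjointed_eq)
  also have "\<dots> \<le> (\<Sum>i. hausdorff_outer k (disjointed A i))"
    using outer_measure_space_hausdorff_outer[where 'a='a and k=k]
    by (auto simp: outer_measure_space_def countably_subadditive_def disjoint_family_disjointed)
  also have "\<dots> \<le> (\<Sum>i. hausdorff_outer k (A i))"
    by (intro suminf_le hausdorff_outer_mono disjointed_subset) auto
  finally show ?thesis .
qed

lemma hausdorff_outer_Un: "hausdorff_outer k (A \<union> B) \<le> hausdorff_outer k A + hausdorff_outer k B"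
proof -
  have "(\<Union>i::nat. if i = 0 then A else if i = 1 then B else {}) = A \<union> B"
    by (auto split: if_splits)
  moreover have "(\<Sum>i::nat. hausdorff_outer k (if i = 0 then A else if i = 1 then B else {}))
      = (\<Sum>i\<in>{0,1::nat}. hausdorff_outer k (if i = 0 then A else if i = 1 then B else {}))"
    by (intro suminf_finite) (auto simp: hausdorff_outer_empty)
  ultimately show ?thesis
    using hausdorff_outer_UN[of k "\<lambda>i. if i = 0 then A else if i = 1 then B else {}"] by simp
qed

lemma hausdorff_content_antimono:
  "\<delta> \<le> \<delta>' \<Longrightarrow> hausdorff_content k \<delta>' A \<le> hausdorff_content k \<delta> A"
  unfolding hausdorff_content_def by (intro INF_superset_mono) (auto intro: order_trans)

lemma hausdorff_outer_separated:
  fixes A B :: "'a::metric_space set"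
  assumes r: "r > 0" and sep: "\<And>x y. x \<in> A \<Longrightarrow> y \<in> B \<Longrightarrow> r \<le> dist x y"
  shows "hausdorff_outer k A + hausdorff_outer k B = hausdorff_outer k (A \<union> B)"
proof (rule antisym[OF _ hausdorff_outer_Un])
  have split: "hausdorff_content k \<delta> A + hausdorff_content k \<delta> B \<le> hausdorff_content k \<delta> (A \<union> B)"
    if \<delta>: "\<delta> < r" for \<delta>
    unfolding hausdorff_content_def[of _ _ "A \<union> B"]
  proof (rule INF_greatest)
    fix C :: "nat \<Rightarrow> 'a set"
    assume C: "C \<in> {C. A \<union> B \<subseteq> (\<Union>i. C i) \<and> (\<forall>i. bounded (C i) \<and> diameter (C i) \<le> \<delta>)}"
    define D where "D X i = (if C i \<inter> X = {} then {} else C i)" for X :: "'a set" and i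
    have D: "hausdorff_content k \<delta> X \<le> (\<Sum>i. hausdorff_weight k (D X i))" if XAB: "X \<subseteq> A \<union> B" for X
      unfolding hausdorff_content_def
    proof (rule INF_lower, safe)
      fix x assume "x \<in> X"
      moreover have "A \<union> B \<subseteq> (\<Union>i. C i)" using C by blast
      ultimately have "x \<in> (\<Union>i. C i)" using XAB by blast
      then obtain i where "x \<in> C i" by blast
      then show "x \<in> (\<Union>i. D X i)" using \<open>x \<in> X\<close> unfolding D_def by (auto intro!: exI[of _ i])
    next
      fix i
      have "0 \<le> \<delta>" using C diameter_ge_0[of "C i"] by (auto intro: order_trans)
      then show "diameter (D X i) \<le> \<delta>" "bounded (D X i)" using C by (auto simp: D_def)
    qed
    have "hausdorff_weight k (D A i) + hausdorff_weight k (D B i) \<le> hausdorff_weight k (C i)" for i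
    proof -
      have "C i \<inter> A = {} \<or> C i \<inter> B = {}"
      proof (rule ccontr)
        assume "\<not> ?thesis"
        then obtain x y where xy: "x \<in> C i" "x \<in> A" "y \<in> C i" "y \<in> B" by blast
        then have "dist x y \<le> diameter (C i)"
          using C by (intro diameter_bounded_bound) auto
        then show False using sep[OF xy(2,4)] \<delta> C by (smt (verit) mem_Collect_eq)
      qed
      then show ?thesis by (auto simp: D_def hausdorff_weight_def)
    qed
    then have "(\<Sum>i. hausdorff_weight k (D A i) + hausdorff_weight k (D B i))
        \<le> (\<Sum>i. hausdorff_weight k (C i))"
      by (intro suminf_le) auto
    moreover have "(\<Sum>i. hausdorff_weight k (D A i) + hausdorff_weight k (D B i))
       = (\<Sum>i. hausdorff_weight k (D A i)) + (\<Sum>i. hausdorff_weight k (D B i))"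
      by (intro suminf_add[symmetric]) auto
    ultimately show "hausdorff_content k \<delta> A + hausdorff_content k \<delta> B
        \<le> (\<Sum>i. hausdorff_weight k (C i))"
      using D[of A] D[of B] by (auto intro: order_trans[OF add_mono])
  qed
  have "hausdorff_content k \<delta> A + hausdorff_content k \<delta>' B \<le> hausdorff_outer k (A \<union> B)"
    if "\<delta> > 0" "\<delta>' > 0" for \<delta> \<delta>'
  proof -
    define d where "d = min (r/2) (min \<delta> \<delta>')"
    have d: "d > 0" "d < r" "d \<le> \<delta>" "d \<le> \<delta>'" using r that by (auto simp: d_def)
    have "hausdorff_content k \<delta> A + hausdorff_content k \<delta>' B
        \<le> hausdorff_content k d A + hausdorff_content k d B"
      using d by (intro add_mono hausdorff_content_antimono) auto
    also have "\<dots> \<le> hausdorff_content k d (A \<union> B)" using d split by blast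
    also have "\<dots> \<le> hausdorff_outer k (A \<union> B)"
      unfolding hausdorff_outer_def using d by (intro SUP_upper) auto
    finally show ?thesis .
  qed
  then have "hausdorff_content k \<delta> A + hausdorff_outer k B \<le> hausdorff_outer k (A \<union> B)"
    if "\<delta> > 0" for \<delta>
    using that unfolding hausdorff_outer_def[of _ B]
    by (subst ennreal_SUP_add_right) (auto intro!: SUP_least)
  then show "hausdorff_outer k A + hausdorff_outer k B \<le> hausdorff_outer k (A \<union> B)"
    unfolding hausdorff_outer_def[of _ A]
    by (subst ennreal_SUP_add_left[symmetric]) (auto intro!: SUP_least)
qed

lemma hausdorff_outer_sum_separated:
  fixes R :: "nat \<Rightarrow> 'a::metric_space set"
  assumes "\<And>n. R n \<subseteq> S"
    and "\<And>n. \<exists>r>0. \<forall>m<n. \<forall>x\<in>R m. \<forall>y\<in>R n. r \<le> dist x y"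
  shows "(\<Sum>n. hausdorff_outer k (R n)) \<le> hausdorff_outer k S"
proof -
  have "(\<Sum>n<N. hausdorff_outer k (R n)) = hausdorff_outer k (\<Union>n<N. R n)" for N
  proof (induction N)
    case (Suc N)
    obtain r where "r > 0" "\<forall>m<N. \<forall>x\<in>R m. \<forall>y\<in>R N. r \<le> dist x y"
      using assms(2)[of N] by blast
    then have "hausdorff_outer k (\<Union>n<N. R n) + hausdorff_outer k (R N)
        = hausdorff_outer k ((\<Union>n<N. R n) \<union> R N)"
      by (intro hausdorff_outer_separated[of r]) auto
    then show ?case using Suc by (simp add: lessThan_Suc Un_commute add.commute)
  qed (simp add: hausdorff_outer_empty)
  also have "hausdorff_outer k (\<Union>n<N. R n) \<le> hausdorff_outer k S" for N
    using assms(1) by (intro hausdorff_outer_mono) auto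
  finally show ?thesis
    by (intro suminf_le_const) auto
qed

text \<open>Caratheodory's criterion for closed sets.\<close>

lemma hausdorff_outer_closed:
  fixes F S :: "'a::metric_space set"
  assumes F: "closed F"
  shows "hausdorff_outer k (S \<inter> F) + hausdorff_outer k (S - F) = hausdorff_outer k S"
proof (cases "hausdorff_outer k S = \<infinity> \<or> F = {}")
  case True
  have "hausdorff_outer k S \<le> hausdorff_outer k (S \<inter> F) + hausdorff_outer k (S - F)"
    using hausdorff_outer_Un[of k "S \<inter> F" "S - F"] by (simp add: Un_Diff_Int Int_Diff_Un)
  then show ?thesis using True by (auto simp: hausdorff_outer_empty top_unique)
next
  case False
  then have fin: "hausdorff_outer k S < \<infinity>" and ne: "F \<noteq> {}" by (auto simp: top.not_eq_extremum)
  let ?H = "hausdorff_outer k :: 'a set \<Rightarrow> ennreal"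
  define a where "a n = inverse (real (Suc n))" for n
  have a_anti: "a n < a m" if "m < n" for m n using that by (simp add: a_def)
  define Sn where "Sn n = {x\<in>S. a n \<le> infdist x F}" for n
  define R where "R n = {x\<in>S. a (Suc n) \<le> infdist x F \<and> infdist x F < a n}" for n
  have R_sep: "\<exists>r>0. \<forall>m<n. \<forall>x\<in>R (2*m+c). \<forall>y\<in>R (2*n+c). r \<le> dist x y" for n c
  proof (cases "n = 0")
    case True
    then show ?thesis by (auto intro: exI[of _ 1])
  next
    case False
    show ?thesis
    proof (intro exI[of _ "a (2*n+c-1) - a (2*n+c)"] conjI allI impI ballI)
      fix m x y assume *: "m < n" "x \<in> R (2*m+c)" "y \<in> R (2*n+c)"
      have "infdist x F \<le> infdist y F + dist x y" by (rule infdist_triangle)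
      moreover have "a (2*n+c-1) \<le> a (Suc (2*m+c))"
        using * by (simp add: a_def le_imp_inverse_le)
      ultimately show "a (2*n+c-1) - a (2*n+c) \<le> dist x y" using * by (auto simp: R_def)
    next
      show "0 < a (2 * n + c - 1) - a (2 * n + c)"
        using False a_anti[of "2*n+c-1" "2*n+c"] by simp
    qed
  qed
  have par: "(\<Sum>n. ?H (R (2*n+c))) \<le> ?H S" for c
    using R_sep by (intro hausdorff_outer_sum_separated) (auto simp: R_def)
  have "(\<Sum>n<N. ?H (R n)) \<le> ?H S + ?H S" for N
  proof -
    have "(\<Sum>n<N. ?H (R n)) \<le> (\<Sum>n<2*N. ?H (R n))"
      by (intro sum_mono2) auto
    also have "\<dots> = (\<Sum>n<N. ?H (R (2*n+0))) + (\<Sum>n<N. ?H (R (2*n+1)))"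
      by (induction N) (simp_all add: algebra_simps)
    also have "\<dots> \<le> (\<Sum>n. ?H (R (2*n+0))) + (\<Sum>n. ?H (R (2*n+1)))"
      by (intro add_mono sum_le_suminf) auto
    also have "\<dots> \<le> ?H S + ?H S" by (intro add_mono par)
    finally show ?thesis .
  qed
  then have "(\<Sum>n. ?H (R n)) \<le> ?H S + ?H S"
    by (intro suminf_le_const) auto
  then have sfin: "(\<Sum>n. ?H (R n)) < \<infinity>"
    using fin by (auto intro: le_less_trans)
  have cover: "S - F \<subseteq> Sn N \<union> (\<Union>i. R (i + N))" for N
  proof
    fix x assume x: "x \<in> S - F"
    then have pos: "0 < infdist x F"
      using in_closed_iff_infdist_zero[OF F ne] infdist_nonneg[of x F] by force
    have ex: "\<exists>n. a n \<le> infdist x F"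
      using reals_Archimedean[OF pos] by (auto simp: a_def intro: less_imp_le)
    show "x \<in> Sn N \<union> (\<Union>i. R (i + N))"
    proof (cases "a N \<le> infdist x F")
      case False
      define n where "n = (LEAST n. a n \<le> infdist x F)"
      have n: "a n \<le> infdist x F" unfolding n_def using ex by (rule LeastI_ex)
      have "N < n" using n False a_anti by (smt (verit) linorder_neqE_nat)
      then obtain m where m: "n = Suc m" "N \<le> m" by (cases n) auto
      have "\<not> a m \<le> infdist x F" using not_less_Least[of m "\<lambda>n. a n \<le> infdist x F"] m n_def by auto
      then have "x \<in> R ((m - N) + N)" using m n x by (auto simp: R_def)
      then show ?thesis by blast
    qed (use x in \<open>auto simp: Sn_def\<close>)
  qed
  have "(?H (S \<inter> F) + ?H (S - F)) + (\<Sum>n<N. ?H (R n)) \<le> ?H S + (\<Sum>n. ?H (R n))" for N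
  proof -
    have "?H (S - F) \<le> ?H (Sn N) + (\<Sum>i. ?H (R (i + N)))"
      by (rule order_trans[OF hausdorff_outer_mono[OF cover[of N]]
            order_trans[OF hausdorff_outer_Un add_left_mono[OF hausdorff_outer_UN]]])
    moreover have "?H (S \<inter> F) + ?H (Sn N) = ?H ((S \<inter> F) \<union> Sn N)"
    proof (rule hausdorff_outer_separated[of "a N"])
      fix x y assume "x \<in> S \<inter> F" "y \<in> Sn N"
      then show "a N \<le> dist x y"
        using infdist_le[of x F y] by (auto simp: Sn_def dist_commute)
    qed (simp add: a_def)
    moreover have "?H ((S \<inter> F) \<union> Sn N) \<le> ?H S"
      by (intro hausdorff_outer_mono) (auto simp: Sn_def)
    ultimately have "?H (S \<inter> F) + ?H (S - F) \<le> ?H S + (\<Sum>i. ?H (R (i + N)))"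
      using add_left_mono[of "?H (S - F)" "?H (Sn N) + (\<Sum>i. ?H (R (i + N)))" "?H (S \<inter> F)"]
        add_right_mono[of "?H (S \<inter> F \<union> Sn N)" "?H S" "\<Sum>i. ?H (R (i + N))"]
      by (auto simp only: add.assoc[symmetric] intro: order_trans)
    then have "(?H (S \<inter> F) + ?H (S - F)) + (\<Sum>n<N. ?H (R n))
        \<le> ?H S + ((\<Sum>i. ?H (R (i + N))) + (\<Sum>n<N. ?H (R n)))"
      by (metis add.assoc add_right_mono)
    also have "(\<Sum>i. ?H (R (i + N))) + (\<Sum>n<N. ?H (R n)) = (\<Sum>n. ?H (R n))"
      by (rule suminf_offset[symmetric]) simp
    finally show ?thesis .
  qed
  moreover have "(\<lambda>N. (?H (S \<inter> F) + ?H (S - F)) + (\<Sum>n<N. ?H (R n)))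
      \<longlonglongrightarrow> (?H (S \<inter> F) + ?H (S - F)) + (\<Sum>n. ?H (R n))"
    by (intro tendsto_add tendsto_const summable_LIMSEQ) simp
  ultimately have "(?H (S \<inter> F) + ?H (S - F)) + (\<Sum>n. ?H (R n)) \<le> ?H S + (\<Sum>n. ?H (R n))"
    by (intro LIMSEQ_le_const2) blast+
  then have "(\<Sum>n. ?H (R n)) + (?H (S \<inter> F) + ?H (S - F)) \<le> (\<Sum>n. ?H (R n)) + ?H S"
    by (simp only: add.commute)
  then have "?H (S \<inter> F) + ?H (S - F) \<le> ?H S"
    using sfin unfolding ennreal_add_left_cancel_le by auto
  moreover have "?H S \<le> ?H (S \<inter> F) + ?H (S - F)"
    using hausdorff_outer_Un[of k "S \<inter> F" "S - F"] by (simp add: Un_Diff_Int Int_Diff_Un)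
  ultimately show ?thesis by (rule antisym)
qed

lemma measure_space_hausdorff:
  "measure_space UNIV (sets borel) (hausdorff_outer k :: 'a::metric_space set \<Rightarrow> ennreal)"
proof -
  interpret P: sigma_algebra UNIV "Pow (UNIV :: 'a set)"
    by (rule sigma_algebra_Pow)
  let ?L = "lambda_system UNIV (Pow UNIV) (hausdorff_outer k :: 'a set \<Rightarrow> ennreal)"
  have L: "measure_space UNIV ?L (hausdorff_outer k)"
    by (rule P.caratheodory_lemma[OF outer_measure_space_hausdorff_outer])
  then interpret L: sigma_algebra UNIV ?L by (simp add: measure_space_def)
  have "Collect closed \<subseteq> ?L"
    using hausdorff_outer_closed[of _ k] unfolding P.lambda_system_eq by auto
  then have "sets (borel :: 'a measure) \<subseteq> ?L"
    using L.sigma_sets_subset[of "Collect closed"]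
    unfolding borel_eq_closed by (subst sets_measure_of) auto
  then show ?thesis
    using L sets.sigma_algebra_axioms[of "borel :: 'a measure"]
    by (auto simp: measure_space_def positive_def countably_additive_def)
qed

lemma sets_hausdorff_measure [simp, measurable_cong]: "sets (hausdorff_measure k) = sets borel"
  and space_hausdorff_measure [simp]: "space (hausdorff_measure k) = UNIV"
  using sets.sigma_sets_eq[of borel]
  by (auto simp: hausdorff_measure_def sets_measure_of_conv space_measure_of_conv)

lemma emeasure_hausdorff_measure:
  fixes A :: "'a::metric_space set"
  assumes "A \<in> sets borel"
  shows "emeasure (hausdorff_measure k) A = hausdorff_outer k A"
  using assms measure_space_hausdorff[of k]
  by (intro emeasure_measure_of[OF hausdorff_measure_def])
    (auto simp: measure_space_def)


section \<open>Uniformly Lipschitz boundary\<close>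

text \<open>
  The map \<open>x \<mapsto> A x + c\<close> gives the rigid coordinates \<open>y\<close> of \<open>x\<close>.  The distinguished (``last'')
  coordinate is the one of a basis vector \<open>e\<close>: \<open>y\<^sub>d\<close> is \<open>y \<bullet> e\<close>, the remaining coordinates \<open>y'\<close> are
  encoded as \<open>y - (y \<bullet> e) e\<close>, and the space \<open>\<real>\<^sup>d\<^sup>-\<^sup>1\<close> they range over is the hyperplane
  \<open>{z. z \<bullet> e = 0}\<close>.
\<close>

definition lipschitz_epigraph_in ::
    "real \<Rightarrow> 'a::euclidean_space set \<Rightarrow> 'a set \<Rightarrow> bool" where
  "lipschitz_epigraph_in L U \<Omega> \<longleftrightarrow>
     (\<exists>(A :: 'a \<Rightarrow> 'a) (c :: 'a) (e :: 'a) (f :: 'a \<Rightarrow> real).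
        orthogonal_transformation A \<and> e \<in> Basis \<and> lipschitz_on L {z. z \<bullet> e = 0} f \<and>
        U \<inter> \<Omega> = U \<inter> {x. let y = A x + c in y \<bullet> e > f (y - (y \<bullet> e) *\<^sub>R e)})"

definition uniformly_lipschitz_boundary :: "'a::euclidean_space set \<Rightarrow> bool" where
  "uniformly_lipschitz_boundary \<Omega> \<longleftrightarrow>
     (\<exists>(\<epsilon>::real) (L::real) (M::nat) (\<U> :: 'a set set).
        \<epsilon> > 0 \<and> L > 0 \<and>
        countable \<U> \<and> (\<forall>U\<in>\<U>. open U) \<and> frontier \<Omega> \<subseteq> \<Union>\<U> \<and> locally_finite_in euclidean \<U> \<and>
        (\<forall>x\<in>frontier \<Omega>. \<exists>U\<in>\<U>. ball x \<epsilon> \<subseteq> U) \<and>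
        (\<forall>x. finite {U\<in>\<U>. x \<in> U} \<and> card {U\<in>\<U>. x \<in> U} \<le> M) \<and>
        (\<forall>U\<in>\<U>. lipschitz_epigraph_in L U \<Omega>))"


section \<open>Bounded functions and test functions\<close>

text \<open>
  \<open>Linf M\<close> consists of functions, not of equivalence classes; equality in \<open>L\<^sup>\<infinity>\<close> is equality
  almost everywhere.
\<close>

definition Linf :: "'a measure \<Rightarrow> ('a \<Rightarrow> 'b::euclidean_space) set" where
  "Linf M = {g \<in> borel_measurable M. \<exists>C::real. AE x in M. norm (g x) \<le> C}"

primrec C_k :: "nat \<Rightarrow> ('a::euclidean_space \<Rightarrow> real) \<Rightarrow> bool" where
  "C_k 0 \<phi> \<longleftrightarrow> continuous_on UNIV \<phi>"
| "C_k (Suc k) \<phi> \<longleftrightarrow> (\<forall>x. \<phi> differentiable (at x)) \<and>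
     (\<forall>i\<in>Basis. C_k k (\<lambda>x. frechet_derivative \<phi> (at x) i))"

text \<open>
  \<open>C_c_inf S\<close> represents the smooth functions on \<open>S\<close> with compact support in \<open>S\<close>.  Smoothness up to
  that part of the boundary that belongs to \<open>S\<close> is understood as existence of a smooth extension
  to the whole space, and an element of \<open>C_c_inf S\<close> is such an extension: only its restriction to
  \<open>S\<close> vanishes outside a compact subset of \<open>S\<close>, its values off \<open>S\<close> are irrelevant.
\<close>

definition C_c_inf :: "'a::euclidean_space set \<Rightarrow> ('a \<Rightarrow> real) set" where
  "C_c_inf S = {\<phi>. (\<forall>k. C_k k \<phi>) \<and> (\<exists>K. compact K \<and> K \<subseteq> S \<and> (\<forall>p\<in>S - K. \<phi> p = 0))}"

definition time_deriv :: "(real \<times> 'a::euclidean_space \<Rightarrow> real) \<Rightarrow> real \<times> 'a \<Rightarrow> real" where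
  "time_deriv \<phi> p = frechet_derivative \<phi> (at p) (1, 0)"

definition space_grad :: "(real \<times> 'a::euclidean_space \<Rightarrow> real) \<Rightarrow> real \<times> 'a \<Rightarrow> 'a" where
  "space_grad \<phi> p = (\<Sum>i\<in>Basis. frechet_derivative \<phi> (at p) (0, i) *\<^sub>R i)"


section \<open>Measure divergence\<close>

text \<open>
  A signed Radon measure on \<open>S = ]0,T[ \<times> \<Omega>\<close>, which need not be defined on all Borel sets, is given
  by a pair \<open>\<mu>\<close> of positive Borel measures on \<open>S\<close> and stands for \<open>fst \<mu> - snd \<mu>\<close>.

  Local finiteness is required up to the lateral boundary and up to \<open>t = 0\<close>, that is, on compact
  subsets of \<open>[0,T[ \<times> \<real>\<^sup>d\<close>, as needed for the integral of a test function in
  \<open>C\<^sub>c\<^sup>\<infinity>([0,T[ \<times> \<real>\<^sup>d)\<close> to exist.  Finiteness on compact subsets of \<open>]0,T[ \<times> \<Omega>\<close> alone does not suffice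
  for a trace: take \<open>\<Omega> = ]0,\<infinity>[\<close> and \<open>b(t,x) = sin(1/x)\<close>.
\<close>

definition locally_finite_signed_measure ::
    "real \<Rightarrow> 'a::euclidean_space set \<Rightarrow> (real \<times> 'a) measure \<times> (real \<times> 'a) measure \<Rightarrow> bool" where
  "locally_finite_signed_measure T \<Omega> \<mu> \<longleftrightarrow>
     (\<forall>\<nu>\<in>{fst \<mu>, snd \<mu>}.
        sets \<nu> = sets (restrict_space borel ({0<..<T} \<times> \<Omega>)) \<and>
        (\<forall>K. compact K \<and> K \<subseteq> {0..<T} \<times> UNIV \<longrightarrow> emeasure \<nu> (K \<inter> ({0<..<T} \<times> \<Omega>)) < \<infinity>))"

definition signed_integral :: "'a measure \<times> 'a measure \<Rightarrow> ('a \<Rightarrow> real) \<Rightarrow> real" where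
  "signed_integral \<mu> \<phi> = (\<integral>p. \<phi> p \<partial>fst \<mu>) - (\<integral>p. \<phi> p \<partial>snd \<mu>)"

definition has_measure_divergence ::
    "real \<Rightarrow> 'a::euclidean_space set \<Rightarrow> (real \<times> 'a \<Rightarrow> 'a) \<Rightarrow>
     (real \<times> 'a) measure \<times> (real \<times> 'a) measure \<Rightarrow> bool" where
  "has_measure_divergence T \<Omega> b \<mu> \<longleftrightarrow>
     (\<forall>\<eta>\<in>C_c_inf ({0<..<T} \<times> \<Omega>).
        (\<integral>p. b p \<bullet> space_grad \<eta> p \<partial>lebesgue_on ({0<..<T} \<times> \<Omega>)) = - signed_integral \<mu> \<eta>)"


section \<open>Traces\<close>

text \<open>
  The product measure is not completed: an element of \<open>L\<^sup>\<infinity>(]0,T[ \<times> \<partial>\<Omega>)\<close> is represented by a Borel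
  function.
\<close>

definition lateral_measure :: "real \<Rightarrow> 'a::euclidean_space set \<Rightarrow> (real \<times> 'a) measure" where
  "lateral_measure T \<Omega> =
     restrict_space lborel {0<..<T} \<Otimes>\<^sub>M
     restrict_space (hausdorff_measure (DIM('a) - 1)) (frontier \<Omega>)"

definition is_trace ::
    "real \<Rightarrow> 'a::euclidean_space set \<Rightarrow> (real \<times> 'a \<Rightarrow> 'a) \<Rightarrow>
     (real \<times> 'a) measure \<times> (real \<times> 'a) measure \<Rightarrow> (real \<times> 'a \<Rightarrow> real) \<Rightarrow> bool" where
  "is_trace T \<Omega> b \<mu> \<tau> \<longleftrightarrow>
     (\<forall>\<phi>\<in>C_c_inf ({0..<T} \<times> UNIV).
        (\<integral>p. \<tau> p * \<phi> p \<partial>lateral_measure T \<Omega>) - (\<integral>x. \<phi> (0, x) \<partial>lebesgue_on \<Omega>) =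
        (\<integral>p. time_deriv \<phi> p + b p \<bullet> space_grad \<phi> p \<partial>lebesgue_on ({0<..<T} \<times> \<Omega>)) +
        signed_integral \<mu> \<phi>)"

definition weak_solution ::
    "real \<Rightarrow> 'a::euclidean_space set \<Rightarrow> (real \<times> 'a \<Rightarrow> 'a) \<Rightarrow>
     (real \<times> 'a \<Rightarrow> real) \<Rightarrow> (real \<times> 'a \<Rightarrow> real) \<Rightarrow> bool" where
  "weak_solution T \<Omega> b w f \<longleftrightarrow>
     (\<forall>\<eta>\<in>C_c_inf ({0<..<T} \<times> \<Omega>).
        (\<integral>p. w p * (time_deriv \<eta> p + b p \<bullet> space_grad \<eta> p) \<partial>lebesgue_on ({0<..<T} \<times> \<Omega>)) +
        (\<integral>p. f p * \<eta> p \<partial>lebesgue_on ({0<..<T} \<times> \<Omega>)) = 0)"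

definition is_transport_trace ::
    "real \<Rightarrow> 'a::euclidean_space set \<Rightarrow> (real \<times> 'a \<Rightarrow> 'a) \<Rightarrow>
     (real \<times> 'a \<Rightarrow> real) \<Rightarrow> (real \<times> 'a \<Rightarrow> real) \<Rightarrow> (real \<times> 'a \<Rightarrow> real) \<Rightarrow> ('a \<Rightarrow> real) \<Rightarrow> bool" where
  "is_transport_trace T \<Omega> b w f \<tau> w\<^sub>0 \<longleftrightarrow>
     (\<forall>\<phi>\<in>C_c_inf ({0..<T} \<times> UNIV).
        (\<integral>p. \<tau> p * \<phi> p \<partial>lateral_measure T \<Omega>) - (\<integral>x. \<phi> (0, x) * w\<^sub>0 x \<partial>lebesgue_on \<Omega>) =
        (\<integral>p. w p * (time_deriv \<phi> p + b p \<bullet> space_grad \<phi> p) \<partial>lebesgue_on ({0<..<T} \<times> \<Omega>)) +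
        (\<integral>p. f p * \<phi> p \<partial>lebesgue_on ({0<..<T} \<times> \<Omega>)))"

end

theory Submission
  imports Defs
begin

text \<open>
  Let \<open>B = (w, v)\<close> be a bounded field on \<open>]0,T[ \<times> \<Omega>\<close> whose space-time divergence is controlled; the two
  claims are the cases \<open>B = (0, b)\<close> and \<open>B = (w, w b)\<close>.  Testing the equation with \<open>\<phi> \<alpha>\<^sub>n(t) \<beta>\<^sub>n(x)\<close>, where
  the cutoff \<open>\<alpha>\<^sub>n \<beta>\<^sub>n\<close> vanishes near \<open>t = 0\<close> and near \<open>\<partial>\<Omega>\<close> and has gradient \<open>O(n)\<close> supported in layers of
  width \<open>O(1/n)\<close>, leaves only the layer terms in the limit.  A Lipschitz boundary has
  \<open>\<H>\<^sup>d\<^sup>-\<^sup>1(\<partial>\<Omega> \<inter> ball x r) \<ge> \<kappa> r\<^sup>d\<^sup>-\<^sup>1\<close> uniformly in \<open>x \<in> \<partial>\<Omega>\<close>, so by Tonelli the integral over the layer of width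
  \<open>1/n\<close> is at most \<open>O(1/n)\<close> times a surface integral.  Hence the boundary functional is bounded by
  \<open>C (\<integral> |\<phi>| d\<H>\<^sup>d\<^sup>-\<^sup>1 dt + \<integral> |\<phi>(0,x)| dx)\<close>.  As test functions are dense in \<open>L\<^sup>1\<close> of this measure, the
  functional extends to \<open>L\<^sup>1\<close> and the Radon-Nikodym theorem represents it by a unique bounded function,
  whose restrictions to \<open>t > 0\<close> and \<open>t = 0\<close> are the trace and (up to sign) the initial value.
\<close>

section \<open>Smooth functions\<close>

text \<open>The layer at the boundary is never parametrised. Pairs consisting of a point of the
  layer and a nearby boundary point are counted in both orders, so the charts serve only to estimate
  the surface measure of small balls from below and of bounded pieces from above. Two obstacles
  shape the estimates. The function \<open>\<phi>\<close> varies across a layer; its values there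
  are compared with boundary values up to an error \<open>\<kappa>\<close> on a bounded set, and
  \<open>\<kappa>\<close> goes to \<open>0\<close> only after \<open>n\<close> has gone to infinity.
  Moreover the time layer meets only the component \<open>w\<close> and the lateral layer only
  \<open>v\<close>. Keeping their bounds \<open>Cw\<close> and \<open>Cv\<close> apart makes the
  initial part of the functional vanish for \<open>(0, b)\<close>; the prescribed term with
  \<open>\<phi> (0, x)\<close> in the first claim is then just the integral of the time derivative.
  Smoothness is defined by iterated derivatives along basis vectors. Cutoffs are therefore explicit
  finite sums of products of one-variable profiles, which avoids differentiating a mollification
  under the integral.\<close>

lemma C_k_Suc_iff:
  assumes "\<And>x. (\<phi> has_derivative \<phi>' x) (at x)"
  shows "C_k (Suc k) \<phi> \<longleftrightarrow> (\<forall>i\<in>Basis. C_k k (\<lambda>x. \<phi>' x i))"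
proof -
  have "frechet_derivative \<phi> (at x) = \<phi>' x" for x
    using frechet_derivative_at[OF assms] by metis
  then show ?thesis
    using assms by (auto simp: differentiable_def)
qed

lemma C_k_has_derivative:
  assumes "C_k (Suc k) \<phi>"
  shows "(\<phi> has_derivative frechet_derivative \<phi> (at x)) (at x)"
  using assms by (simp add: frechet_derivative_works[symmetric])

lemma C_k_SucD: "C_k (Suc k) \<phi> \<Longrightarrow> C_k k \<phi>"
proof (induction k arbitrary: \<phi>)
  case 0
  then show ?case
    by (auto intro!: continuous_at_imp_continuous_on differentiable_imp_continuous_within)
next
  case (Suc k)
  have "\<phi> differentiable (at x)" for x
    using Suc.prems by simp
  moreover have "C_k k (\<lambda>x. frechet_derivative \<phi> (at x) i)" if "i \<in> Basis" for i
    using Suc.prems that by (intro Suc.IH) (simp only: C_k.simps(2)[of "Suc k"])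
  ultimately show ?case by simp
qed

lemma C_k_continuous: "C_k k \<phi> \<Longrightarrow> continuous_on UNIV \<phi>"
  by (induction k) (use C_k_SucD in auto)

lemma C_k_const: "C_k k (\<lambda>x. c)"
proof (induction k arbitrary: c)
  case (Suc k)
  then show ?case by (subst C_k_Suc_iff[OF has_derivative_const]) auto
qed simp

lemma C_k_add: "C_k k \<phi> \<Longrightarrow> C_k k \<psi> \<Longrightarrow> C_k k (\<lambda>x. \<phi> x + \<psi> x)"
proof (induction k arbitrary: \<phi> \<psi>)
  case (Suc k)
  then show ?case
    by (subst C_k_Suc_iff[OF has_derivative_add[OF C_k_has_derivative C_k_has_derivative]]) auto
qed (auto intro: continuous_intros)

lemma C_k_mult: "C_k k \<phi> \<Longrightarrow> C_k k \<psi> \<Longrightarrow> C_k k (\<lambda>x. \<phi> x * \<psi> x)"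
proof (induction k arbitrary: \<phi> \<psi>)
  case (Suc k)
  show ?case
    by (subst C_k_Suc_iff[OF has_derivative_mult[OF C_k_has_derivative C_k_has_derivative], OF Suc.prems])
      (use Suc C_k_SucD[OF Suc.prems(1)] C_k_SucD[OF Suc.prems(2)] in \<open>auto intro!: C_k_add Suc.IH\<close>)
qed (auto intro: continuous_intros)

lemma C_k_sum: "(\<And>i. i \<in> I \<Longrightarrow> C_k k (\<phi> i)) \<Longrightarrow> C_k k (\<lambda>x. \<Sum>i\<in>I. \<phi> i x)"
  by (induction I rule: infinite_finite_induct) (auto intro: C_k_const C_k_add)

lemma C_k_prod: "(\<And>i. i \<in> I \<Longrightarrow> C_k k (\<phi> i)) \<Longrightarrow> C_k k (\<lambda>x. \<Prod>i\<in>I. \<phi> i x)"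
  by (induction I rule: infinite_finite_induct) (auto intro: C_k_const C_k_mult)

lemma C_k_inverse:
  "C_k k \<phi> \<Longrightarrow> (\<And>x. \<phi> x \<noteq> 0) \<Longrightarrow> C_k k (\<lambda>x. inverse (\<phi> x))"
proof (induction k arbitrary: \<phi>)
  case (Suc k)
  have inv: "C_k k (\<lambda>x. inverse (\<phi> x))"
    using Suc C_k_SucD by blast
  \<comment> \<open>The square of \<open>inverse (\<phi> x)\<close> is written as two factors, to
    each of which the smoothness \<open>inv\<close> of the lower order applies.\<close>
  have *: "((\<lambda>x. inverse (\<phi> x)) has_derivative
      (\<lambda>h. ((-1) * frechet_derivative \<phi> (at x) h) * (inverse (\<phi> x) * inverse (\<phi> x)))) (at x)" for x
    using Deriv.has_derivative_inverse[OF Suc.prems(2) C_k_has_derivative[OF Suc.prems(1)], of x]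
    by (simp add: mult_ac)
  show ?case
    unfolding C_k_Suc_iff[OF *] using Suc.prems(1)
    by (intro ballI C_k_mult C_k_const inv) simp
qed (auto intro: continuous_intros)

lemma has_derivative_inner_affine:
  fixes f :: "real \<Rightarrow> real"
  assumes "f differentiable (at (a \<bullet> x + s))"
  shows "((\<lambda>x. f (a \<bullet> x + s)) has_derivative
           (\<lambda>h. (a \<bullet> h) * frechet_derivative f (at (a \<bullet> x + s)) 1)) (at x)"
proof -
  let ?D = "frechet_derivative f (at (a \<bullet> x + s))"
  have f: "(f has_derivative ?D) (at (a \<bullet> x + s))"
    using assms by (simp add: frechet_derivative_works[symmetric])
  have g: "((\<lambda>x. a \<bullet> x + s) has_derivative (\<lambda>h. a \<bullet> h)) (at x)"
    by (auto intro!: derivative_eq_intros)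
  have D: "?D r = r * ?D 1" for r
    using linear_cmul[OF has_derivative_linear[OF f], of r 1] by simp
  have "(\<lambda>h. ?D (a \<bullet> h)) = (\<lambda>h. (a \<bullet> h) * ?D 1)"
    by (rule ext, rule D)
  then show ?thesis
    using has_derivative_compose[OF g f] by metis
qed

text \<open>The form of the chain rule that the cutoffs call for: they are products of one-variable
  profiles evaluated at affine forms.\<close>

lemma C_k_inner_affine:
  fixes f :: "real \<Rightarrow> real" and a :: "'a::euclidean_space"
  shows "C_k k f \<Longrightarrow> C_k k (\<lambda>x. f (a \<bullet> x + s))"
proof (induction k arbitrary: f)
  case (Suc k)
  show ?case
    by (subst C_k_Suc_iff[OF has_derivative_inner_affine[of f a _ s]])
      (use Suc in \<open>auto intro!: C_k_mult C_k_const\<close>)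
next
  case 0
  have "continuous_on UNIV (f \<circ> (\<lambda>x. a \<bullet> x + s))"
    using 0 by (intro continuous_on_compose continuous_intros) (auto intro: continuous_on_subset)
  then show ?case by (simp add: o_def)
qed

text \<open>The span of these functions is closed under differentiation, so all of them are smooth at \<open>0\<close>.\<close>

definition flat :: "nat \<Rightarrow> real \<Rightarrow> real" where
  "flat n t = (if t \<le> 0 then 0 else exp (- inverse t) * inverse t ^ n)"

lemma flat_nonneg: "0 \<le> flat n t"
  by (simp add: flat_def)

text \<open>With \<open>u = inverse t\<close>, the exponential series dominates its single term of
  degree \<open>n + 2\<close>. The two spare powers of \<open>t\<close> make the difference quotient
  at \<open>0\<close> tend to \<open>0\<close>.\<close>

lemma flat_le_square: "flat n t \<le> fact (n + 2) * t\<^sup>2"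
proof (cases "t \<le> 0")
  case False
  let ?u = "inverse t"
  have u: "?u > 0" using False by simp
  have "?u ^ (n+2) / fact (n+2) \<le> (\<Sum>k\<le>n+2. ?u ^ k / fact k)"
    using u by (intro member_le_sum[of _ _ "\<lambda>k. ?u ^ k / fact k"]) auto
  also have "\<dots> \<le> exp ?u"
    using u sum_le_suminf[OF summable_exp_generic[of ?u], of "{..n+2}"]
    by (simp add: exp_def field_simps)
  finally have "?u ^ (n+2) \<le> fact (n+2) * exp ?u"
    by (simp only: pos_divide_le_eq[OF fact_gt_zero] mult.commute)
  then have "?u ^ n * ?u\<^sup>2 \<le> fact (n+2) * exp ?u"
    by (simp only: power_add)
  then have "(?u ^ n * ?u\<^sup>2) * (t\<^sup>2 * exp (- ?u)) \<le> (fact (n+2) * exp ?u) * (t\<^sup>2 * exp (- ?u))"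
    by (intro mult_right_mono) auto
  also have "(?u ^ n * ?u\<^sup>2) * (t\<^sup>2 * exp (- ?u)) = flat n t"
    using False by (simp add: flat_def field_simps)
  also have "(fact (n+2) * exp ?u) * (t\<^sup>2 * exp (- ?u)) = fact (n+2) * t\<^sup>2"
    by (simp add: exp_minus)
  finally show ?thesis .
qed (simp add: flat_def)

lemma flat_has_real_derivative:
  "(flat n has_real_derivative flat (n+2) t - real n * flat (n+1) t) (at t)"
proof -
  consider "t < 0" | "t > 0" | "t = 0" by linarith
  then show ?thesis
  proof cases
    case 1
    have "((\<lambda>_. 0) has_real_derivative 0) (at t)" by simp
    then have "(flat n has_real_derivative 0) (at t)"
      by (rule has_field_derivative_transform_within_open[where S="{..<0}"])
        (use 1 in \<open>auto simp: flat_def\<close>)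
    then show ?thesis using 1 by (simp add: flat_def)
  next
    case 2
    have "((\<lambda>t. exp (- inverse t) * inverse t ^ n) has_real_derivative
        flat (n+2) t - real n * flat (n+1) t) (at t)"
    proof -
      have "((\<lambda>t. inverse t ^ n) has_real_derivative - (real n * inverse t ^ (n + 1))) (at t)"
      proof -
        have "((\<lambda>t. inverse t ^ n) has_real_derivative
            real n * inverse t ^ (n - Suc 0) * (- (inverse t * inverse t))) (at t)"
          using 2 by (auto intro!: derivative_eq_intros simp: mult_ac)
        then show ?thesis by (cases n) (simp_all add: mult_ac)
      qed
      moreover have "((\<lambda>t. exp (- inverse t)) has_real_derivative exp (- inverse t) * inverse t ^ 2) (at t)"
        using 2 by (auto intro!: derivative_eq_intros simp: power2_eq_square)
      ultimately have "((\<lambda>t. exp (- inverse t) * inverse t ^ n) has_real_derivative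
          exp (- inverse t) * inverse t ^ 2 * inverse t ^ n
          + (- (real n * inverse t ^ (n + 1))) * exp (- inverse t)) (at t)"
        by (intro DERIV_mult)
      then show ?thesis
        using 2 by (simp add: flat_def power2_eq_square mult_ac)
    qed
    then show ?thesis
      by (rule has_field_derivative_transform_within_open[where S="{0<..}"])
        (use 2 in \<open>auto simp: flat_def\<close>)
  next
    case 3
    have "((\<lambda>h. (flat n (0 + h) - flat n 0) / h) \<longlongrightarrow> 0) (at 0)"
    proof (rule tendsto_0_le[where K=1])
      show "((\<lambda>h. fact (n+2) * h) \<longlongrightarrow> (0::real)) (at 0)"
        by (auto intro!: tendsto_eq_intros)
      show "\<forall>\<^sub>F h in at 0. norm ((flat n (0 + h) - flat n 0) / h) \<le> norm (fact (n+2) * h) * 1"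
      proof (intro eventually_at_filter[THEN iffD2] always_eventually allI impI)
        fix h :: real assume "h \<noteq> 0"
        have "\<bar>flat n h\<bar> \<le> (fact (n+2) * \<bar>h\<bar>) * \<bar>h\<bar>"
          using flat_le_square[of n h] flat_nonneg[of n h] by (simp add: power2_eq_square)
        then show "norm ((flat n (0 + h) - flat n 0) / h) \<le> norm (fact (n+2) * h) * 1"
          using \<open>h \<noteq> 0\<close> by (simp add: flat_def[of n 0] abs_mult pos_divide_le_eq)
      qed
    qed
    then show ?thesis
      using 3 by (simp add: DERIV_def flat_def[of _ 0])
  qed
qed

lemma C_k_flat: "C_k k (flat n)"
proof (induction k arbitrary: n)
  case 0
  show ?case
    using flat_has_real_derivative by (auto intro!: continuous_at_imp_continuous_on DERIV_isCont)
next
  case (Suc k)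
  have *: "(flat n has_derivative (\<lambda>h. (flat (n+2) t + (- real n) * flat (n+1) t) * h)) (at t)" for t
    using flat_has_real_derivative[of n t] by (simp add: has_field_derivative_def)
  show ?case
    by (subst C_k_Suc_iff[OF *]) (simp only: Basis_real_def, use Suc.IH in \<open>intro ballI C_k_mult C_k_const C_k_add\<close>)
qed

text \<open>The usual smooth transition from \<open>0\<close> to \<open>1\<close>. The denominator
  never vanishes because \<open>t\<close> and \<open>1 - t\<close> are not both nonpositive.\<close>

definition step :: "real \<Rightarrow> real" where
  "step t = flat 0 t * inverse (flat 0 t + flat 0 (1 - t))"

lemma flat_pos: "t > 0 \<Longrightarrow> flat n t > 0"
  by (simp add: flat_def)

lemma step_denom_pos: "flat 0 t + flat 0 (1 - t) > 0"
proof (cases "t > 0")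
  case True
  then show ?thesis using flat_pos[of t 0] flat_nonneg[of 0 "1-t"] by linarith
next
  case False
  then show ?thesis using flat_pos[of "1-t" 0] flat_nonneg[of 0 t] by linarith
qed

lemma step_eq_0: "t \<le> 0 \<Longrightarrow> step t = 0"
  by (simp add: step_def flat_def)

lemma step_eq_1: "t \<ge> 1 \<Longrightarrow> step t = 1"
  using step_denom_pos[of t] by (simp add: step_def flat_def)

lemma step_bounds: "0 \<le> step t" "step t \<le> 1"
  using step_denom_pos[of t] flat_nonneg[of 0 t] flat_nonneg[of 0 "1-t"]
  by (auto simp: step_def field_simps)

lemma C_k_step: "C_k k step"
proof -
  have "C_k k (\<lambda>t::real. flat 0 ((-1) \<bullet> t + 1))"
    by (rule C_k_inner_affine[OF C_k_flat])
  moreover have "(\<lambda>t::real. flat 0 ((-1) \<bullet> t + 1)) = (\<lambda>t. flat 0 (1 - t))" by (simp add: inner_real_def)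
  ultimately have "C_k k (\<lambda>t. flat 0 (1 - t))" by simp
  then have "C_k k (\<lambda>t. flat 0 t * inverse (flat 0 t + flat 0 (1 - t)))"
    using step_denom_pos by (intro C_k_mult C_k_inverse C_k_add C_k_flat) (auto simp: less_le)
  then show ?thesis by (simp add: step_def[abs_def])
qed

definition step' :: "real \<Rightarrow> real" where
  "step' t = frechet_derivative step (at t) 1"

lemma C_k_step': "C_k k step'"
  using C_k_step[of "Suc k"] by (simp add: step'_def[abs_def])

lemma step_has_real_derivative: "(step has_real_derivative step' t) (at t)"
  using has_derivative_inner_affine[of step 1 t 0] C_k_step[of "Suc 0"]
  by (simp add: step'_def has_field_derivative_def mult.commute[of _ "frechet_derivative step (at t) 1"])

lemma step'_eq_0:
  assumes "t < 0 \<or> t > 1"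
  shows "step' t = 0"
proof -
  have "(step has_real_derivative 0) (at t)"
  proof (cases "t < 0")
    case True
    have "((\<lambda>_. 0) has_real_derivative 0) (at t)" by simp
    then show ?thesis
      by (rule has_field_derivative_transform_within_open[where S="{..<0}"])
        (use True in \<open>auto simp: step_eq_0\<close>)
  next
    case False
    have "((\<lambda>_. 1) has_real_derivative 0) (at t)" by simp
    then show ?thesis
      by (rule has_field_derivative_transform_within_open[where S="{1<..}"])
        (use False assms in \<open>auto simp: step_eq_1\<close>)
  qed
  then show ?thesis using DERIV_unique step_has_real_derivative by blast
qed

lemma step'_bounded: obtains D where "D \<ge> 0" "\<And>t. \<bar>step' t\<bar> \<le> D"
proof -
  have "compact (step' ` {0..1})"
    using C_k_continuous[OF C_k_step'[of 0]]
    by (intro compact_continuous_image) (auto intro: continuous_on_subset)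
  then obtain D where "D > 0" "\<forall>x\<in>step' ` {0..1}. norm x \<le> D"
    using compact_imp_bounded bounded_pos by metis
  then have "\<bar>step' t\<bar> \<le> D" for t
    using step'_eq_0[of t] by (cases "t \<in> {0..1}") auto
  then show ?thesis using that[of D] \<open>D > 0\<close> by simp
qed

section \<open>Density of test functions\<close>

lemma C_c_inf_C_k: "\<phi> \<in> C_c_inf S \<Longrightarrow> C_k k \<phi>"
  by (simp add: C_c_inf_def)

lemma C_c_inf_continuous: "\<phi> \<in> C_c_inf S \<Longrightarrow> continuous_on A \<phi>"
  using C_k_continuous[OF C_c_inf_C_k] continuous_on_subset by blast

lemma C_c_inf_measurable: "\<phi> \<in> C_c_inf S \<Longrightarrow> \<phi> \<in> borel_measurable borel"
  by (intro borel_measurable_continuous_onI C_c_inf_continuous)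

lemma C_c_inf_subset_borel_measurable: "sets M = sets borel \<Longrightarrow> C_c_inf S \<subseteq> borel_measurable M"
  using C_c_inf_measurable by (auto cong: measurable_cong_sets)

lemma C_c_inf_zero: "(\<lambda>_. 0) \<in> C_c_inf S"
  by (auto simp: C_c_inf_def C_k_const intro!: exI[of _ "{}"])

lemma C_c_inf_add:
  assumes "\<phi> \<in> C_c_inf S" "\<psi> \<in> C_c_inf S"
  shows "(\<lambda>x. \<phi> x + \<psi> x) \<in> C_c_inf S"
proof -
  obtain K L where "compact K" "K \<subseteq> S" "\<forall>p\<in>S - K. \<phi> p = 0" "compact L" "L \<subseteq> S" "\<forall>p\<in>S - L. \<psi> p = 0"
    using assms by (auto simp: C_c_inf_def)
  then have "compact (K \<union> L) \<and> K \<union> L \<subseteq> S \<and> (\<forall>p\<in>S - (K \<union> L). \<phi> p + \<psi> p = 0)"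
    by (auto intro: compact_Un)
  then show ?thesis using assms unfolding C_c_inf_def by (auto intro: C_k_add)
qed

lemma C_c_inf_scale:
  assumes "\<phi> \<in> C_c_inf S"
  shows "(\<lambda>x. c * \<phi> x) \<in> C_c_inf S"
proof -
  obtain K where "compact K \<and> K \<subseteq> S \<and> (\<forall>p\<in>S - K. c * \<phi> p = 0)"
    using assms by (auto simp: C_c_inf_def)
  then show ?thesis using assms unfolding C_c_inf_def by (auto intro: C_k_mult C_k_const)
qed

text \<open>Each factor climbs from \<open>0\<close> to \<open>1\<close> within distance
  \<open>1 / n\<close> inside a face, so the bumps approximate the indicator of the open box from
  below and vanish off it.\<close>

definition box_bump :: "nat \<Rightarrow> 'a::euclidean_space \<Rightarrow> 'a \<Rightarrow> 'a \<Rightarrow> real" where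
  "box_bump n a b x =
     (\<Prod>i\<in>Basis. step (real n * (x \<bullet> i - a \<bullet> i)) * step (real n * (b \<bullet> i - x \<bullet> i)))"

lemma C_k_box_bump: "C_k k (box_bump n a b)"
proof -
  have "C_k k (\<lambda>x. step ((real n *\<^sub>R i) \<bullet> x + (- real n * (a \<bullet> i))) *
      step ((- real n *\<^sub>R i) \<bullet> x + real n * (b \<bullet> i)))" for i :: 'a
    by (intro C_k_mult C_k_inner_affine C_k_step)
  moreover have "(\<lambda>x. step ((real n *\<^sub>R i) \<bullet> x + (- real n * (a \<bullet> i))) *
        step ((- real n *\<^sub>R i) \<bullet> x + real n * (b \<bullet> i)))
      = (\<lambda>x. step (real n * (x \<bullet> i - a \<bullet> i)) * step (real n * (b \<bullet> i - x \<bullet> i)))" for i :: 'a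
    by (simp add: algebra_simps inner_commute)
  ultimately show ?thesis
    unfolding box_bump_def[abs_def] by (intro C_k_prod) metis
qed

lemma box_bump_bounds: "0 \<le> box_bump n a b x" "box_bump n a b x \<le> 1"
  unfolding box_bump_def
  by (auto intro!: prod_nonneg prod_le_1 mult_le_one simp: step_bounds)

lemma box_bump_eq_0: "x \<notin> box a b \<Longrightarrow> box_bump n a b x = 0"
  unfolding box_bump_def
  by (rule prod_zero) (auto simp: mem_box not_less intro!: step_eq_0 mult_nonneg_nonpos)

lemma box_bump_le_indicator: "box_bump n a b x \<le> indicator (box a b) x"
  using box_bump_bounds(2)[of n a b x] box_bump_eq_0[of x a b n] by (auto simp: indicator_def)

lemma box_bump_LIMSEQ: "(\<lambda>n. box_bump n a b x) \<longlonglongrightarrow> indicator (box a b) x"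
proof (cases "x \<in> box a b")
  case True
  have ev: "\<forall>\<^sub>F n in sequentially. step (real n * r) = 1" if "r > 0" for r
  proof -
    have "\<forall>\<^sub>F n in sequentially. inverse r \<le> real n"
      using filterlim_real_sequentially by (simp add: filterlim_at_top)
    then show ?thesis
      by eventually_elim (use that in \<open>auto intro!: step_eq_1 simp: field_simps\<close>)
  qed
  have "\<forall>\<^sub>F n in sequentially. \<forall>i\<in>Basis. step (real n * (x \<bullet> i - a \<bullet> i)) = 1 \<and>
      step (real n * (b \<bullet> i - x \<bullet> i)) = 1"
    using True by (intro eventually_ball_finite ballI eventually_conj ev) (auto simp: mem_box)
  then have "\<forall>\<^sub>F n in sequentially. box_bump n a b x = 1"
    by eventually_elim (simp add: box_bump_def)
  then show ?thesis
    using True by (auto intro: tendsto_eventually)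
qed (simp add: box_bump_eq_0)

text \<open>The box may stick out below \<open>t = 0\<close>, since the support is compared with
  \<open>{0..<T} \<times> UNIV\<close> only and values at negative times are irrelevant. At the
  upper end there is no such freedom: the closed box must stay strictly below
  \<open>T\<close>.\<close>

lemma box_bump_C_c_inf:
  fixes a b :: "real \<times> 'a::euclidean_space"
  assumes "fst b < T"
  shows "box_bump n a b \<in> C_c_inf ({0..<T} \<times> UNIV)"
proof -
  let ?K = "cbox a b \<inter> ({0..} \<times> UNIV)"
  have "compact ?K"
    by (intro compact_Int_closed compact_cbox closed_Times closed_atLeast closed_UNIV)
  moreover have "?K \<subseteq> {0..<T} \<times> UNIV"
    using assms by (cases a; cases b) (auto simp: cbox_Pair_eq)
  moreover have "box_bump n a b p = 0" if "p \<in> {0..<T} \<times> UNIV - ?K" for p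
    using that box_subset_cbox[of a b] by (intro box_bump_eq_0) auto
  ultimately show ?thesis
    using C_k_box_bump unfolding C_c_inf_def by blast
qed

text \<open>The nonnegative integral makes the notion meaningful before integrability of the
  difference is known.\<close>

definition L1_approx :: "'a measure \<Rightarrow> ('a \<Rightarrow> real) set \<Rightarrow> ('a \<Rightarrow> real) \<Rightarrow> bool" where
  "L1_approx M V f \<longleftrightarrow> (\<forall>e>0. \<exists>\<phi>\<in>V. (\<integral>\<^sup>+x. ennreal \<bar>f x - \<phi> x\<bar> \<partial>M) < ennreal e)"

lemma L1_approx_self: "f \<in> V \<Longrightarrow> L1_approx M V f"
  by (auto simp: L1_approx_def intro!: bexI[of _ f])

lemma nn_integral_abs_diff_triangle:
  fixes f g h :: "'a \<Rightarrow> real"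
  assumes [measurable]: "f \<in> borel_measurable M" "g \<in> borel_measurable M" "h \<in> borel_measurable M"
  shows "(\<integral>\<^sup>+x. ennreal \<bar>f x - h x\<bar> \<partial>M)
    \<le> (\<integral>\<^sup>+x. ennreal \<bar>f x - g x\<bar> \<partial>M) + (\<integral>\<^sup>+x. ennreal \<bar>g x - h x\<bar> \<partial>M)"
proof -
  have "(\<integral>\<^sup>+x. ennreal \<bar>f x - h x\<bar> \<partial>M) \<le> (\<integral>\<^sup>+x. ennreal \<bar>f x - g x\<bar> + ennreal \<bar>g x - h x\<bar> \<partial>M)"
    by (intro nn_integral_mono) (auto simp: ennreal_plus[symmetric] simp del: ennreal_plus intro!: ennreal_leI)
  also have "\<dots> = (\<integral>\<^sup>+x. ennreal \<bar>f x - g x\<bar> \<partial>M) + (\<integral>\<^sup>+x. ennreal \<bar>g x - h x\<bar> \<partial>M)"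
    by (intro nn_integral_add) auto
  finally show ?thesis .
qed

lemma ennreal_half_add: "a < ennreal (e/2) \<Longrightarrow> b < ennreal (e/2) \<Longrightarrow> 0 < e \<Longrightarrow> a + b < ennreal e"
proof -
  assume "a < ennreal (e/2)" "b < ennreal (e/2)" "0 < e"
  then have "a + b < ennreal (e/2) + ennreal (e/2)"
    by (intro add_strict_mono)
  also have "\<dots> = ennreal e"
    using \<open>0 < e\<close> by (subst ennreal_plus[symmetric]) auto
  finally show ?thesis .
qed

lemma L1_approx_trans:
  assumes f: "f \<in> borel_measurable M" and g: "\<And>n. g n \<in> borel_measurable M"
    and V: "V \<subseteq> borel_measurable M"
    and lim: "(\<lambda>n. \<integral>\<^sup>+x. ennreal \<bar>g n x - f x\<bar> \<partial>M) \<longlonglongrightarrow> 0"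
    and appr: "\<And>n. L1_approx M V (g n)"
  shows "L1_approx M V f"
  unfolding L1_approx_def
proof (intro allI impI)
  fix e :: real assume e: "e > 0"
  then have "\<forall>\<^sub>F n in sequentially. (\<integral>\<^sup>+x. ennreal \<bar>g n x - f x\<bar> \<partial>M) < ennreal (e/2)"
    using order_tendstoD(2)[OF lim, of "ennreal (e/2)"] by simp
  then obtain n where n: "(\<integral>\<^sup>+x. ennreal \<bar>g n x - f x\<bar> \<partial>M) < ennreal (e/2)"
    using eventually_happens'[OF sequentially_bot] by blast
  obtain \<phi> where \<phi>: "\<phi> \<in> V" "(\<integral>\<^sup>+x. ennreal \<bar>g n x - \<phi> x\<bar> \<partial>M) < ennreal (e/2)"
    using appr[of n] e unfolding L1_approx_def by (meson half_gt_zero)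
  have "(\<integral>\<^sup>+x. ennreal \<bar>f x - \<phi> x\<bar> \<partial>M)
      \<le> (\<integral>\<^sup>+x. ennreal \<bar>f x - g n x\<bar> \<partial>M) + (\<integral>\<^sup>+x. ennreal \<bar>g n x - \<phi> x\<bar> \<partial>M)"
    using f g V \<phi>(1) by (intro nn_integral_abs_diff_triangle) auto
  also have "\<dots> < ennreal e"
    using n \<phi>(2) e by (intro ennreal_half_add) (simp_all add: abs_minus_commute)
  finally show "\<exists>\<phi>\<in>V. (\<integral>\<^sup>+x. ennreal \<bar>f x - \<phi> x\<bar> \<partial>M) < ennreal e"
    using \<phi>(1) by blast
qed

lemma L1_approx_dominated:
  fixes f :: "'a \<Rightarrow> real"
  assumes f[measurable]: "f \<in> borel_measurable M" and g[measurable]: "\<And>n. g n \<in> borel_measurable M"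
    and V: "V \<subseteq> borel_measurable M"
    and h: "integrable M h"
    and dom: "\<And>n. AE x in M. \<bar>g n x\<bar> \<le> h x"
    and lim: "AE x in M. (\<lambda>n. g n x) \<longlonglongrightarrow> f x"
    and appr: "\<And>n. L1_approx M V (g n)"
  shows "L1_approx M V f"
proof (rule L1_approx_trans[OF f g V _ appr])
  have [measurable]: "h \<in> borel_measurable M" using h by auto
  have dom': "AE x in M. \<forall>n. \<bar>g n x\<bar> \<le> h x"
    using dom by (subst AE_all_countable) auto
  have "(\<lambda>n. \<integral>\<^sup>+x. ennreal \<bar>g n x - f x\<bar> \<partial>M) \<longlonglongrightarrow> (\<integral>\<^sup>+x. 0 \<partial>M)"
  proof (rule nn_integral_dominated_convergence[where w="\<lambda>x. ennreal (2 * h x)"])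
    show "AE x in M. ennreal \<bar>g n x - f x\<bar> \<le> ennreal (2 * h x)" for n
      using dom' lim
    proof eventually_elim
      case (elim x)
      have "\<bar>f x\<bar> \<le> h x"
        by (rule LIMSEQ_le_const2[OF tendsto_rabs[OF elim(2)]]) (use elim(1) in auto)
      moreover have "\<bar>g n x\<bar> \<le> h x" using elim by blast
      ultimately show ?case by (intro ennreal_leI) linarith
    qed
    show "(\<integral>\<^sup>+ x. ennreal (2 * h x) \<partial>M) < \<infinity>"
    proof -
      have "integrable M (\<lambda>x. 2 * h x)" using h by simp
      then have "(\<integral>\<^sup>+ x. ennreal (norm (2 * h x)) \<partial>M) < \<infinity>"
        by (simp only: integrable_iff_bounded)
      moreover have "(\<integral>\<^sup>+ x. ennreal (2 * h x) \<partial>M) \<le> (\<integral>\<^sup>+ x. ennreal (norm (2 * h x)) \<partial>M)"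
        by (intro nn_integral_mono ennreal_leI) auto
      ultimately show ?thesis by (rule le_less_trans[rotated])
    qed
    show "AE x in M. (\<lambda>n. ennreal \<bar>g n x - f x\<bar>) \<longlonglongrightarrow> 0"
      using lim
    proof eventually_elim
      case (elim x)
      have "(\<lambda>n. \<bar>g n x - f x\<bar>) \<longlonglongrightarrow> 0"
        using elim by (subst (asm) LIM_zero_iff[symmetric]) (simp add: tendsto_rabs_zero_iff)
      then show ?case using tendsto_ennrealI by fastforce
    qed
  qed auto
  then show "(\<lambda>n. \<integral>\<^sup>+x. ennreal \<bar>g n x - f x\<bar> \<partial>M) \<longlonglongrightarrow> 0" by simp
qed

lemma L1_approx_add:
  fixes f g :: "'a \<Rightarrow> real"
  assumes f[measurable]: "f \<in> borel_measurable M" and g[measurable]: "g \<in> borel_measurable M"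
    and V: "V \<subseteq> borel_measurable M" and add: "\<And>\<phi> \<psi>. \<phi> \<in> V \<Longrightarrow> \<psi> \<in> V \<Longrightarrow> (\<lambda>x. \<phi> x + \<psi> x) \<in> V"
    and appr: "L1_approx M V f" "L1_approx M V g"
  shows "L1_approx M V (\<lambda>x. f x + g x)"
  unfolding L1_approx_def
proof (intro allI impI)
  fix e :: real assume e: "e > 0"
  then obtain \<phi> \<psi> where \<phi>: "\<phi> \<in> V" "(\<integral>\<^sup>+x. ennreal \<bar>f x - \<phi> x\<bar> \<partial>M) < ennreal (e/2)"
    and \<psi>: "\<psi> \<in> V" "(\<integral>\<^sup>+x. ennreal \<bar>g x - \<psi> x\<bar> \<partial>M) < ennreal (e/2)"
    using appr unfolding L1_approx_def by (meson half_gt_zero)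
  have [measurable]: "\<phi> \<in> borel_measurable M" "\<psi> \<in> borel_measurable M"
    using \<phi>(1) \<psi>(1) V by auto
  have "(\<integral>\<^sup>+x. ennreal \<bar>f x + g x - (\<phi> x + \<psi> x)\<bar> \<partial>M)
      \<le> (\<integral>\<^sup>+x. ennreal \<bar>f x - \<phi> x\<bar> + ennreal \<bar>g x - \<psi> x\<bar> \<partial>M)"
    by (intro nn_integral_mono) (auto simp: ennreal_plus[symmetric] simp del: ennreal_plus intro!: ennreal_leI)
  also have "\<dots> = (\<integral>\<^sup>+x. ennreal \<bar>f x - \<phi> x\<bar> \<partial>M) + (\<integral>\<^sup>+x. ennreal \<bar>g x - \<psi> x\<bar> \<partial>M)"
    by (intro nn_integral_add) auto
  also have "\<dots> < ennreal e"
    using \<phi>(2) \<psi>(2) e by (intro ennreal_half_add)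
  finally show "\<exists>\<phi>\<in>V. (\<integral>\<^sup>+x. ennreal \<bar>f x + g x - \<phi> x\<bar> \<partial>M) < ennreal e"
    using add[OF \<phi>(1) \<psi>(1)] by (intro bexI[of _ "\<lambda>x. \<phi> x + \<psi> x"])
qed

lemma L1_approx_scale:
  fixes f :: "'a \<Rightarrow> real"
  assumes f[measurable]: "f \<in> borel_measurable M"
    and V: "V \<subseteq> borel_measurable M" and scale: "\<And>\<phi> c. \<phi> \<in> V \<Longrightarrow> (\<lambda>x. c * \<phi> x) \<in> V"
    and appr: "L1_approx M V f"
  shows "L1_approx M V (\<lambda>x. c * f x)"
  unfolding L1_approx_def
proof (intro allI impI)
  fix e :: real assume e: "e > 0"
  \<comment> \<open>The \<open>+ 1\<close> in the denominator covers \<open>c = 0\<close>.\<close>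
  then obtain \<phi> where \<phi>: "\<phi> \<in> V" "(\<integral>\<^sup>+x. ennreal \<bar>f x - \<phi> x\<bar> \<partial>M) < ennreal (e/(\<bar>c\<bar>+1))"
    using appr unfolding L1_approx_def by (metis abs_ge_zero add_pos_nonneg add.commute divide_pos_pos zero_less_one)
  have [measurable]: "\<phi> \<in> borel_measurable M"
    using \<phi>(1) V by auto
  have "(\<integral>\<^sup>+x. ennreal \<bar>c * f x - c * \<phi> x\<bar> \<partial>M)
      = (\<integral>\<^sup>+x. ennreal \<bar>c\<bar> * ennreal \<bar>f x - \<phi> x\<bar> \<partial>M)"
    by (simp add: ennreal_mult[symmetric] abs_mult[symmetric] right_diff_distrib)
  also have "\<dots> = ennreal \<bar>c\<bar> * (\<integral>\<^sup>+x. ennreal \<bar>f x - \<phi> x\<bar> \<partial>M)"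
    by (intro nn_integral_cmult) auto
  also have "\<dots> \<le> ennreal \<bar>c\<bar> * ennreal (e/(\<bar>c\<bar>+1))"
    using \<phi>(2) by (intro mult_left_mono) auto
  also have "\<dots> = ennreal (\<bar>c\<bar> * (e/(\<bar>c\<bar>+1)))"
    using e by (intro ennreal_mult[symmetric]) auto
  also have "\<dots> < ennreal e"
    using e by (intro ennreal_lessI) (auto simp: field_simps)
  finally show "\<exists>\<phi>\<in>V. (\<integral>\<^sup>+x. ennreal \<bar>c * f x - \<phi> x\<bar> \<partial>M) < ennreal e"
    using scale[OF \<phi>(1)] by (intro bexI[of _ "\<lambda>x. c * \<phi> x"])
qed

lemma L1_approx_sum:
  fixes f :: "'i \<Rightarrow> 'a \<Rightarrow> real"
  assumes f: "\<And>i. i \<in> I \<Longrightarrow> f i \<in> borel_measurable M"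
    and V: "V \<subseteq> borel_measurable M" "(\<lambda>_. 0) \<in> V"
    and add: "\<And>\<phi> \<psi>. \<phi> \<in> V \<Longrightarrow> \<psi> \<in> V \<Longrightarrow> (\<lambda>x. \<phi> x + \<psi> x) \<in> V"
    and appr: "\<And>i. i \<in> I \<Longrightarrow> L1_approx M V (f i)"
  shows "L1_approx M V (\<lambda>x. \<Sum>i\<in>I. f i x)"
  using f appr
  by (induction I rule: infinite_finite_induct)
    (auto intro!: L1_approx_self[OF V(2)] L1_approx_add V(1) add)

text \<open>Dynkin's argument inside a fixed box: boxes form an intersection-stable generator, and
  complements and disjoint unions are taken relative to \<open>box a b\<close>. Its finite measure
  supplies the dominating function for countable unions, and \<open>fst b < T\<close> keeps all
  bumps admissible.\<close>

lemma L1_approx_indicator_Int_box: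
  fixes M :: "(real \<times> 'a::euclidean_space) measure" and a b :: "real \<times> 'a"
  assumes sets[measurable_cong]: "sets M = sets borel" and fin: "emeasure M (box a b) < \<infinity>" and b: "fst b < T"
    and A: "A \<in> sets borel"
  shows "L1_approx M (C_c_inf ({0..<T} \<times> UNIV)) (indicator (A \<inter> box a b))"
proof -
  let ?V = "C_c_inf ({0..<T} \<times> (UNIV :: 'a set))"
  have V: "?V \<subseteq> borel_measurable M" by (rule C_c_inf_subset_borel_measurable[OF sets])
  have int: "integrable M (indicator (box a b) :: _ \<Rightarrow> real)"
    using fin by (auto simp: integrable_indicator_iff sets)
  have bx: "L1_approx M ?V (indicator (box c d \<inter> box a b))" for c d
  proof -
    obtain c' d' where eq: "box c d \<inter> box a b = box c' d'" "fst d' < T"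
    proof
      show "box c d \<inter> box a b = box (\<Sum>i\<in>Basis. max (c\<bullet>i) (a\<bullet>i) *\<^sub>R i) (\<Sum>i\<in>Basis. min (d\<bullet>i) (b\<bullet>i) *\<^sub>R i)"
        by (rule box_Int_box)
      have "fst (\<Sum>i\<in>Basis. min (d\<bullet>i) (b\<bullet>i) *\<^sub>R i) = (\<Sum>i\<in>Basis. min (d\<bullet>i) (b\<bullet>i) *\<^sub>R i) \<bullet> (1, 0::'a)"
        by (simp only: inner_prod_def fst_conv snd_conv inner_zero_right add_0_right inner_real_def mult_1_right)
      also have "\<dots> = min (d\<bullet>(1, 0::'a)) (b\<bullet>(1, 0::'a))"
        by (subst inner_sum_left_Basis) (auto simp: Basis_prod_def)
      also have "\<dots> < T" using b by (auto simp: inner_prod_def min_less_iff_disj)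
      finally show "fst (\<Sum>i\<in>Basis. min (d\<bullet>i) (b\<bullet>i) *\<^sub>R i) < T" .
    qed
    show ?thesis
      unfolding eq(1)
    proof (rule L1_approx_dominated[OF _ _ V int, where g="\<lambda>n. box_bump n c' d'"])
      have "indicat_real (box c' d') p \<le> indicator (box a b) p" for p
        using eq(1) by (intro indicator_leI) auto
      then show "AE p in M. \<bar>box_bump n c' d' p\<bar> \<le> indicator (box a b) p" for n
        using box_bump_bounds(1)[of n c' d'] order_trans[OF box_bump_le_indicator[of n c' d']]
        by (intro AE_I2) (metis abs_of_nonneg)
      show "box_bump n c' d' \<in> borel_measurable M" for n
        using V box_bump_C_c_inf[OF eq(2)] by blast
    qed (auto intro!: L1_approx_self box_bump_C_c_inf eq(2) box_bump_LIMSEQ simp: sets)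
  qed
  have "Int_stable (range (\<lambda>(c, d). box c d :: (real \<times> 'a) set))"
    by (auto simp: Int_stable_def box_Int_box)
  moreover have "range (\<lambda>(c, d). box c d :: (real \<times> 'a) set) \<subseteq> Pow UNIV" by simp
  moreover have "A \<in> sigma_sets UNIV (range (\<lambda>(c, d). box c d))"
    using A unfolding borel_eq_box by simp
  ultimately show ?thesis
  proof (induction rule: sigma_sets_induct_disjoint)
    case (compl A)
    have [measurable]: "A \<in> sets borel" using compl(1) unfolding borel_eq_box by simp
    have "L1_approx M ?V (\<lambda>p. indicator (box a b) p + (-1) * indicator (A \<inter> box a b) p)"
      using compl bx[of a b]
      by (intro L1_approx_add L1_approx_scale V C_c_inf_add C_c_inf_scale) auto
    moreover have "(\<lambda>p. indicator (box a b) p + (-1) * indicator (A \<inter> box a b) p)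
        = (indicator ((UNIV - A) \<inter> box a b) :: _ \<Rightarrow> real)"
      by (auto simp: indicator_def)
    ultimately show ?case by simp
  next
    case (union A)
    have [measurable]: "A i \<in> sets borel" for i
      using union(2) unfolding borel_eq_box by (auto simp: subset_eq)
    have disj: "disjoint_family (\<lambda>i. A i \<inter> box a b)"
      using union(1) by (auto simp: disjoint_family_on_def)
    show ?case
    proof (rule L1_approx_dominated[OF _ _ V int, where g="\<lambda>n p. \<Sum>i<n. indicator (A i \<inter> box a b) p"])
      have eq: "(\<Sum>i<n. indicator (A i \<inter> box a b) p) = indicat_real (\<Union>i<n. A i \<inter> box a b) p" for n p
        by (subst indicator_UN_disjoint) (use disj in \<open>auto simp: disjoint_family_on_def\<close>)
      show "AE p in M. \<bar>\<Sum>i<n. indicat_real (A i \<inter> box a b) p\<bar> \<le> indicator (box a b) p" for n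
        unfolding eq by (auto intro!: AE_I2 indicator_leI simp: indicator_def)
      show "AE p in M. (\<lambda>n. \<Sum>i<n. indicat_real (A i \<inter> box a b) p) \<longlonglongrightarrow> indicator (\<Union> (range A) \<inter> box a b) p"
        unfolding eq by (intro AE_I2) (use LIMSEQ_indicator_UN[of "\<lambda>i. A i \<inter> box a b"] in \<open>simp add: Int_UN_distrib2\<close>)
    qed (auto intro!: L1_approx_sum V C_c_inf_add C_c_inf_zero union)
  next
    case (basic A)
    then show ?case using bx by auto
  next
    case empty
    have "L1_approx M ?V (\<lambda>_. 0)" by (intro L1_approx_self C_c_inf_zero)
    then show ?case by (simp add: indicator_def[abs_def])
  qed
qed

lemma L1_approx_C_c_inf:
  fixes M :: "(real \<times> 'a::euclidean_space) measure"
  assumes sets[measurable_cong]: "sets M = sets borel" and fin: "\<And>a b. emeasure M (box a b) < \<infinity>"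
    and conc: "AE p in M. fst p < T" and f: "integrable M f"
  shows "L1_approx M (C_c_inf ({0..<T} \<times> UNIV)) f"
  using f
proof (induction rule: integrable_induct)
  case (base A c)
  let ?V = "C_c_inf ({0..<T} \<times> (UNIV :: 'a set))"
  have V: "?V \<subseteq> borel_measurable M" by (rule C_c_inf_subset_borel_measurable[OF sets])
  \<comment> \<open>These boxes exhaust the half-space \<open>fst p < T\<close>, which carries
    \<open>M\<close>, while each upper time face stays strictly below \<open>T\<close>.\<close>
  define Q where "Q n = box (- real (Suc n), - real (Suc n) *\<^sub>R One) (T - 1 / Suc n, real (Suc n) *\<^sub>R (One::'a))" for n
  have Q: "\<forall>\<^sub>F n in sequentially. p \<in> Q n" if "fst p < T" for p
  proof -
    have "\<forall>\<^sub>F n in sequentially. inverse (T - fst p) < real n"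
      and "\<forall>\<^sub>F n in sequentially. \<bar>fst p\<bar> < real n"
      and "\<forall>\<^sub>F n in sequentially. norm (snd p) < real n"
      using filterlim_real_sequentially by (simp_all add: filterlim_at_top_dense)
    then show ?thesis
    proof eventually_elim
      case (elim n)
      have "1 / real (Suc n) < T - fst p"
        using elim(1) that by (simp add: field_simps)
      moreover have "\<bar>snd p \<bullet> i\<bar> < real n" if "i \<in> Basis" for i
        using Basis_le_norm[OF that, of "snd p"] elim(3) by linarith
      ultimately show ?case
        using elim(2) by (fastforce simp: Q_def mem_box Basis_prod_def inner_prod_def)
    qed
  qed
  have A: "A \<in> sets borel" using base by (simp add: sets)
  have [measurable]: "Q n \<in> sets borel" for n by (auto simp: Q_def)
  have "L1_approx M ?V (indicator A)"
  proof (rule L1_approx_dominated[OF _ _ V, where g="\<lambda>n. indicator (A \<inter> Q n)"])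
    show "integrable M (indicator A :: _ \<Rightarrow> real)"
      using base by (auto simp: integrable_indicator_iff)
    show "AE p in M. (\<lambda>n. indicat_real (A \<inter> Q n) p) \<longlonglongrightarrow> indicator A p"
      using conc
    proof eventually_elim
      case (elim p)
      show ?case
        by (rule tendsto_eventually, rule eventually_mono[OF Q[OF elim]]) (auto simp: indicator_def)
    qed
    show "L1_approx M ?V (indicator (A \<inter> Q n))" for n
      unfolding Q_def by (intro L1_approx_indicator_Int_box sets fin A) simp
  qed (use A in \<open>auto simp: indicator_def sets\<close>)
  then have "L1_approx M ?V (\<lambda>p. c * indicator A p)"
    by (intro L1_approx_scale V C_c_inf_scale) (use A in \<open>auto simp: sets\<close>)
  then show ?case by (simp add: mult.commute)
next
  case (add f g)
  then show ?case by (intro L1_approx_add C_c_inf_add C_c_inf_subset_borel_measurable sets) auto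
next
  case (lim f s)
  show ?case
    by (rule L1_approx_dominated[OF _ _ C_c_inf_subset_borel_measurable[OF sets], where h="\<lambda>x. 2 * norm (f x)" and g=s])
      (use lim in auto)
qed

section \<open>Functionals bounded by the \<open>L\<^sup>1\<close> norm\<close>

text \<open>Abstract setting of the boundary functional. Elements of \<open>V\<close> are genuine
  functions; by linearity and \<open>F_bound\<close> the value of \<open>F\<close> nevertheless
  depends only on the class almost everywhere.\<close>

locale L1_functional = sigma_finite_measure M
  for M :: "'a measure" +
  fixes V :: "('a \<Rightarrow> real) set" and F :: "('a \<Rightarrow> real) \<Rightarrow> real" and C :: real
  assumes V_integrable: "\<phi> \<in> V \<Longrightarrow> integrable M \<phi>"
    and V_add: "\<phi> \<in> V \<Longrightarrow> \<psi> \<in> V \<Longrightarrow> (\<lambda>x. \<phi> x + \<psi> x) \<in> V"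
    and V_scale: "\<phi> \<in> V \<Longrightarrow> (\<lambda>x. c * \<phi> x) \<in> V"
    and F_add: "\<phi> \<in> V \<Longrightarrow> \<psi> \<in> V \<Longrightarrow> F (\<lambda>x. \<phi> x + \<psi> x) = F \<phi> + F \<psi>"
    and F_scale: "\<phi> \<in> V \<Longrightarrow> F (\<lambda>x. c * \<phi> x) = c * F \<phi>"
    and F_bound: "\<phi> \<in> V \<Longrightarrow> \<bar>F \<phi>\<bar> \<le> C * (\<integral>x. \<bar>\<phi> x\<bar> \<partial>M)"
    and C_nonneg: "0 \<le> C"
    and V_dense: "integrable M f \<Longrightarrow> L1_approx M V f"
begin

abbreviation L1norm :: "('a \<Rightarrow> real) \<Rightarrow> real" where
  "L1norm f \<equiv> (\<integral>x. \<bar>f x\<bar> \<partial>M)"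

lemma L1norm_triangle:
  assumes "integrable M f" "integrable M g"
  shows "L1norm (\<lambda>x. f x + g x) \<le> L1norm f + L1norm g"
proof -
  have "L1norm (\<lambda>x. f x + g x) \<le> (\<integral>x. \<bar>f x\<bar> + \<bar>g x\<bar> \<partial>M)"
    using assms by (intro integral_mono) auto
  then show ?thesis using assms by simp
qed

lemma V_approx:
  assumes "integrable M f" "e > 0"
  obtains \<phi> where "\<phi> \<in> V" "L1norm (\<lambda>x. f x - \<phi> x) < e"
proof -
  obtain \<phi> where \<phi>: "\<phi> \<in> V" "(\<integral>\<^sup>+x. ennreal \<bar>f x - \<phi> x\<bar> \<partial>M) < ennreal e"
    using V_dense[OF assms(1)] assms(2) unfolding L1_approx_def by blast
  have "(\<integral>\<^sup>+x. ennreal \<bar>f x - \<phi> x\<bar> \<partial>M) = ennreal (L1norm (\<lambda>x. f x - \<phi> x))"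
    using assms(1) V_integrable[OF \<phi>(1)] by (auto intro!: nn_integral_eq_integral)
  then have "L1norm (\<lambda>x. f x - \<phi> x) < e"
    using \<phi>(2) assms(2) by (simp add: ennreal_less_iff)
  then show ?thesis using that \<phi>(1) by blast
qed

text \<open>
  Every value between this supremum and the corresponding infimum of upper bounds is compatible with the
  Lipschitz estimate; density makes the two coincide, so no approximating sequences are needed.
\<close>

definition ext :: "('a \<Rightarrow> real) \<Rightarrow> real" where
  "ext f = (SUP \<phi>\<in>V. F \<phi> - C * L1norm (\<lambda>x. f x - \<phi> x))"

text \<open>Linearity turns \<open>F_bound\<close> into a Lipschitz estimate for
  \<open>F \<phi> - F \<psi>\<close>, and the triangle inequality inserts \<open>f\<close>. Thus
  every lower bound for the value at \<open>f\<close> lies below every upper bound.\<close>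

lemma ext_gap:
  assumes f: "integrable M f" and "\<phi> \<in> V" "\<psi> \<in> V"
  shows "F \<phi> - C * L1norm (\<lambda>x. f x - \<phi> x) \<le> F \<psi> + C * L1norm (\<lambda>x. f x - \<psi> x)"
proof -
  have \<phi>\<psi>: "integrable M \<phi>" "integrable M \<psi>" using assms V_integrable by auto
  have "F \<phi> - F \<psi> = F (\<lambda>x. \<phi> x + (-1) * \<psi> x)"
    using assms by (simp only: F_add V_scale F_scale)
  also have "\<dots> \<le> C * L1norm (\<lambda>x. \<phi> x + (-1) * \<psi> x)"
    using F_bound[OF V_add[OF assms(2) V_scale[OF assms(3), of "-1"]]] by simp
  also have "\<dots> \<le> C * (L1norm (\<lambda>x. f x - \<phi> x) + L1norm (\<lambda>x. f x - \<psi> x))"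
  proof (rule mult_left_mono[OF _ C_nonneg])
    have "L1norm (\<lambda>x. \<phi> x + (-1) * \<psi> x) \<le> (\<integral>x. \<bar>f x - \<phi> x\<bar> + \<bar>f x - \<psi> x\<bar> \<partial>M)"
      using f \<phi>\<psi> by (intro integral_mono) auto
    then show "L1norm (\<lambda>x. \<phi> x + (-1) * \<psi> x) \<le> L1norm (\<lambda>x. f x - \<phi> x) + L1norm (\<lambda>x. f x - \<psi> x)"
      using f \<phi>\<psi> by simp
  qed
  finally show ?thesis by (simp add: algebra_simps)
qed

lemma V_nonempty: "V \<noteq> {}"
  using V_approx[of "\<lambda>_. 0" 1] by auto

lemma ext_approx:
  assumes f: "integrable M f" and \<phi>: "\<phi> \<in> V"
  shows "\<bar>ext f - F \<phi>\<bar> \<le> C * L1norm (\<lambda>x. f x - \<phi> x)"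
proof -
  have "F \<phi> - C * L1norm (\<lambda>x. f x - \<phi> x) \<le> ext f"
    unfolding ext_def using ext_gap[OF f _ \<phi>] by (intro cSUP_upper \<phi> bdd_aboveI2) auto
  moreover have "ext f \<le> F \<phi> + C * L1norm (\<lambda>x. f x - \<phi> x)"
    unfolding ext_def using ext_gap[OF f _ \<phi>] V_nonempty by (intro cSUP_least) auto
  ultimately show ?thesis by linarith
qed

text \<open>Approximating \<open>f\<close> from \<open>V\<close> makes both error terms small, so
  two values compatible with Lipschitz estimates must agree, whatever the constant \<open>K\<close>.
  Identities for \<open>ext\<close> are thereby reduced to estimates on \<open>V\<close>.\<close>

lemma ext_eq:
  assumes f: "integrable M f" and l: "\<And>\<phi>. \<phi> \<in> V \<Longrightarrow> \<bar>l - F \<phi>\<bar> \<le> K * L1norm (\<lambda>x. f x - \<phi> x)"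
  shows "ext f = l"
proof (rule ccontr)
  assume "ext f \<noteq> l"
  then have pos: "\<bar>ext f - l\<bar> / (C + \<bar>K\<bar> + 1) > 0"
    using C_nonneg by simp
  obtain \<phi> where \<phi>: "\<phi> \<in> V" and less: "L1norm (\<lambda>x. f x - \<phi> x) < \<bar>ext f - l\<bar> / (C + \<bar>K\<bar> + 1)"
    using V_approx[OF f pos] by blast
  let ?n = "L1norm (\<lambda>x. f x - \<phi> x)"
  have n: "0 \<le> ?n" by simp
  have "\<bar>ext f - l\<bar> \<le> \<bar>ext f - F \<phi>\<bar> + \<bar>l - F \<phi>\<bar>" by linarith
  also have "\<dots> \<le> C * ?n + K * ?n"
    using ext_approx[OF f \<phi>] l[OF \<phi>] by linarith
  also have "\<dots> \<le> (C + \<bar>K\<bar> + 1) * ?n"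
    unfolding distrib_right using n mult_right_mono[OF abs_ge_self[of K] n] by linarith
  also have "\<dots> < \<bar>ext f - l\<bar>"
    using less C_nonneg by (simp add: pos_less_divide_eq mult.commute)
  finally show False by simp
qed

lemma ext_V: "\<phi> \<in> V \<Longrightarrow> ext \<phi> = F \<phi>"
  using ext_approx[of \<phi> \<phi>] V_integrable by simp

lemma ext_add:
  assumes f: "integrable M f" and g: "integrable M g"
  shows "ext (\<lambda>x. f x + g x) = ext f + ext g"
proof (rule ccontr)
  assume neq: "ext (\<lambda>x. f x + g x) \<noteq> ext f + ext g"
  define d where "d = \<bar>ext (\<lambda>x. f x + g x) - (ext f + ext g)\<bar>"
  \<comment> \<open>The errors of the two summands and of the sum add up to \<open>4 * C\<close>
    times this quantity; the extra \<open>+ 1\<close> makes the final inequality strict and covers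
    \<open>C = 0\<close>.\<close>
  have d: "d / (4 * C + 1) > 0" using neq C_nonneg by (simp add: d_def)
  obtain \<phi> where \<phi>: "\<phi> \<in> V" "L1norm (\<lambda>x. f x - \<phi> x) < d / (4 * C + 1)"
    using V_approx[OF f d] by blast
  obtain \<psi> where \<psi>: "\<psi> \<in> V" "L1norm (\<lambda>x. g x - \<psi> x) < d / (4 * C + 1)"
    using V_approx[OF g d] by blast
  let ?n = "L1norm (\<lambda>x. f x - \<phi> x)" and ?m = "L1norm (\<lambda>x. g x - \<psi> x)"
  have int: "integrable M \<phi>" "integrable M \<psi>" using \<phi> \<psi> V_integrable by auto
  have "L1norm (\<lambda>x. f x + g x - (\<phi> x + \<psi> x)) \<le> ?n + ?m"
    using L1norm_triangle[of "\<lambda>x. f x - \<phi> x" "\<lambda>x. g x - \<psi> x"] f g int by (simp add: algebra_simps)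
  then have "C * L1norm (\<lambda>x. f x + g x - (\<phi> x + \<psi> x)) \<le> C * (?n + ?m)"
    by (rule mult_left_mono[OF _ C_nonneg])
  then have "d \<le> C * (?n + ?m) + C * ?n + C * ?m"
    using ext_approx[OF f \<phi>(1)] ext_approx[OF g \<psi>(1)]
      ext_approx[OF Bochner_Integration.integrable_add[OF f g] V_add[OF \<phi>(1) \<psi>(1)]] F_add[OF \<phi>(1) \<psi>(1)]
    unfolding d_def by linarith
  also have "\<dots> = (2 * C) * ?n + (2 * C) * ?m" by (simp add: algebra_simps)
  also have "\<dots> \<le> (2 * C) * (d / (4 * C + 1)) + (2 * C) * (d / (4 * C + 1))"
    using C_nonneg \<phi>(2) \<psi>(2) by (intro add_mono mult_left_mono) auto
  also have "\<dots> < d"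
  proof -
    define q where "q = d / (4 * C + 1)"
    have "d = (4 * C + 1) * q" using C_nonneg by (simp add: q_def)
    then have "d = 4 * C * q + q" by (simp add: distrib_right)
    moreover have "q > 0" using d by (simp add: q_def)
    ultimately show ?thesis unfolding q_def[symmetric] by linarith
  qed
  finally show False by simp
qed

lemma ext_scale:
  assumes f: "integrable M f"
  shows "ext (\<lambda>x. c * f x) = c * ext f"
proof (cases "c = 0")
  case True
  have "\<bar>0 - F \<phi>\<bar> \<le> C * L1norm (\<lambda>x. 0 - \<phi> x)" if "\<phi> \<in> V" for \<phi>
    using F_bound[OF that] by simp
  then have "ext (\<lambda>_. 0) = 0"
    by (intro ext_eq) auto
  then show ?thesis using True by simp
next
  case False
  show ?thesis
  proof (rule ext_eq)
    fix \<phi> assume \<phi>: "\<phi> \<in> V"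
    \<comment> \<open>A test function close to \<open>c * f\<close> is rescaled to one close to
      \<open>f\<close>; hence the separate case \<open>c = 0\<close>.\<close>
    let ?\<psi> = "\<lambda>x. inverse c * \<phi> x"
    have "\<bar>c * ext f - F \<phi>\<bar> = \<bar>c\<bar> * \<bar>ext f - F ?\<psi>\<bar>"
      using False by (simp add: F_scale[OF \<phi>] abs_mult[symmetric] right_diff_distrib mult.assoc[symmetric])
    also have "\<dots> \<le> \<bar>c\<bar> * (C * L1norm (\<lambda>x. f x - ?\<psi> x))"
      by (intro mult_left_mono ext_approx f V_scale \<phi>) auto
    also have "\<dots> = C * L1norm (\<lambda>x. c * (f x - ?\<psi> x))"
      by (simp add: abs_mult)
    also have "(\<lambda>x. c * (f x - ?\<psi> x)) = (\<lambda>x. c * f x - \<phi> x)"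
      using False by (simp add: right_diff_distrib fun_eq_iff)
    finally show "\<bar>c * ext f - F \<phi>\<bar> \<le> C * L1norm (\<lambda>x. c * f x - \<phi> x)" .
  qed (use f in auto)
qed

lemma ext_bound:
  assumes f: "integrable M f"
  shows "\<bar>ext f\<bar> \<le> C * L1norm f"
proof -
  obtain \<phi> where "\<phi> \<in> V" using V_nonempty by blast
  then have 0: "(\<lambda>x. 0) \<in> V" "F (\<lambda>x. 0) = 0"
    using V_scale[of \<phi> 0] F_scale[of \<phi> 0] by auto
  show ?thesis using ext_approx[OF f 0(1)] 0(2) by simp
qed

theorem representation:
  obtains \<sigma> where "\<sigma> \<in> borel_measurable M" "AE x in M. \<bar>\<sigma> x\<bar> \<le> C"
    "\<And>\<phi>. \<phi> \<in> V \<Longrightarrow> F \<phi> = (\<integral>x. \<sigma> x * \<phi> x \<partial>M)"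
proof -
  txt \<open>The weight \<open>h\<close> makes \<open>\<nu>\<close> finite although \<open>M\<close> is only \<open>\<sigma>\<close>-finite.\<close>
  obtain h0 where h0[measurable]: "h0 \<in> borel_measurable M" and h0_fin: "integral\<^sup>N M h0 \<noteq> \<infinity>"
    and h0_pos: "\<And>x. x \<in> space M \<Longrightarrow> 0 < h0 x \<and> h0 x < \<infinity>"
    using Ex_finite_integrable_function by auto
  define h where "h x = enn2real (h0 x)" for x
  have [measurable]: "h \<in> borel_measurable M" by (auto simp: h_def[abs_def])
  have h_pos: "h x > 0" if "x \<in> space M" for x
    using h0_pos[OF that] by (simp add: h_def enn2real_positive_iff)
  have h_nonneg: "h x \<ge> 0" for x by (simp add: h_def)
  have h_eq: "ennreal (h x) = h0 x" if "x \<in> space M" for x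
    using h0_pos[OF that] by (simp add: h_def)
  have h_int: "integrable M h"
  proof (rule integrableI_nonneg)
    have "(\<integral>\<^sup>+ x. ennreal (h x) \<partial>M) = integral\<^sup>N M h0"
      by (intro nn_integral_cong h_eq)
    then show "(\<integral>\<^sup>+ x. ennreal (h x) \<partial>M) < \<infinity>" using h0_fin by (simp add: top.not_eq_extremum)
  qed (auto simp: h_nonneg)
  have hA_int: "integrable M (\<lambda>x. h x * indicator A x)" if "A \<in> sets M" for A
    using integrable_real_mult_indicator[OF that h_int] by (simp add: mult.commute)
  \<comment> \<open>The functional \<open>ext\<close> has no sign. Adding \<open>C\<close> times the
    integral makes it nonnegative on nonnegative functions and bounds it by \<open>2 * C\<close>
    times the integral, so that it yields a positive measure; the shift is undone in the
    density.\<close>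
  define G where "G f = ext f + C * (\<integral>x. f x \<partial>M)" for f
  have G_nonneg: "0 \<le> G f" and G_le: "G f \<le> 2 * C * (\<integral>x. f x \<partial>M)"
    if "integrable M f" "\<And>x. 0 \<le> f x" for f
    using ext_bound[OF that(1)] that(2) by (auto simp: G_def algebra_simps)
  have G_add: "G (\<lambda>x. f x + g x) = G f + G g" if "integrable M f" "integrable M g" for f g
    using that by (simp add: G_def ext_add algebra_simps)
  define \<nu>0 where "\<nu>0 A = G (\<lambda>x. h x * indicator A x)" for A
  have \<nu>0_nonneg: "0 \<le> \<nu>0 A" and \<nu>0_le: "\<nu>0 A \<le> 2 * C * (\<integral>x. h x * indicator A x \<partial>M)"
    if "A \<in> sets M" for A
    using G_nonneg[OF hA_int[OF that]] G_le[OF hA_int[OF that]] h_nonneg by (auto simp: \<nu>0_def)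
  have \<nu>0_Un: "\<nu>0 (A \<union> B) = \<nu>0 A + \<nu>0 B" if "A \<in> sets M" "B \<in> sets M" "A \<inter> B = {}" for A B
  proof -
    have "(\<lambda>x. h x * indicator (A \<union> B) x) = (\<lambda>x. h x * indicator A x + h x * indicator B x)"
      using that(3) by (auto simp: indicator_def fun_eq_iff)
    then show ?thesis
      unfolding \<nu>0_def using G_add[OF hA_int[OF that(1)] hA_int[OF that(2)]] by simp
  qed
  have \<nu>0_empty: "\<nu>0 {} = 0"
    using \<nu>0_Un[of "{}" "{}"] by simp
  have \<nu>0_sums: "(\<lambda>i. \<nu>0 (A i)) sums \<nu>0 (\<Union>i. A i)"
    if A: "range A \<subseteq> sets M" "disjoint_family A" for A :: "nat \<Rightarrow> 'a set"
  proof -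
    have [measurable]: "A i \<in> sets M" for i using A by auto
    \<comment> \<open>Countable additivity follows from finite additivity once the tails vanish, and
      they do because they are bounded by integrals of \<open>h\<close> over sets decreasing to the
      empty set.\<close>
    have tail: "\<nu>0 (\<Union>i. A i) = (\<Sum>i<n. \<nu>0 (A i)) + \<nu>0 (\<Union>i\<in>{n..}. A i)" for n
    proof (induction n)
      case (Suc n)
      have "{n..} = insert n {Suc n..}" by auto
      then have "(\<Union>i\<in>{n..}. A i) = A n \<union> (\<Union>i\<in>{Suc n..}. A i)" by simp
      moreover have "A n \<inter> A i = {}" if "i \<ge> Suc n" for i
        using A(2) that by (intro disjoint_family_onD) auto
      then have "A n \<inter> (\<Union>i\<in>{Suc n..}. A i) = {}" by auto
      ultimately have "\<nu>0 (\<Union>i\<in>{n..}. A i) = \<nu>0 (A n) + \<nu>0 (\<Union>i\<in>{Suc n..}. A i)"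
        using \<nu>0_Un[of "A n" "\<Union>i\<in>{Suc n..}. A i"] by simp
      then show ?case using Suc by simp
    qed (simp add: atLeast_0)
    have "(\<lambda>n. \<integral>x. h x * indicator (\<Union>i\<in>{n..}. A i) x \<partial>M) \<longlonglongrightarrow> (\<integral>x. 0 \<partial>M)"
    proof (rule integral_dominated_convergence[where w=h])
      show "AE x in M. (\<lambda>n. h x * indicator (\<Union>i\<in>{n..}. A i) x) \<longlonglongrightarrow> 0"
      proof (rule AE_I2)
        fix x
        have "\<forall>\<^sub>F n in sequentially. x \<notin> (\<Union>i\<in>{n..}. A i)"
        proof (cases "\<exists>j. x \<in> A j")
          case True
          then obtain j where xj: "x \<in> A j" by blast
          have disj: "A j \<inter> A i = {}" if "i > j" for i
            using A(2) that by (intro disjoint_family_onD) auto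
          have "x \<notin> (\<Union>i\<in>{n..}. A i)" if "n > j" for n
          proof
            assume "x \<in> (\<Union>i\<in>{n..}. A i)"
            then obtain i where "i \<ge> n" "x \<in> A i" by auto
            then show False using disj[of i] xj that by auto
          qed
          then show ?thesis
            by (rule eventually_mono[OF eventually_gt_at_top[of j]])
        qed auto
        then show "(\<lambda>n. h x * indicator (\<Union>i\<in>{n..}. A i) x) \<longlonglongrightarrow> 0"
          by (intro tendsto_eventually) (auto elim!: eventually_mono simp: indicator_def)
      qed
    qed (auto simp: h_int h_nonneg indicator_def)
    then have "(\<lambda>n. 2 * C * (\<integral>x. h x * indicator (\<Union>i\<in>{n..}. A i) x \<partial>M)) \<longlonglongrightarrow> 2 * C * 0"
      by (intro tendsto_mult tendsto_const) simp
    then have "(\<lambda>n. \<nu>0 (\<Union>i\<in>{n..}. A i)) \<longlonglongrightarrow> 0"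
      by (intro tendsto_sandwich[OF _ _ tendsto_const, of 0 "\<lambda>n. \<nu>0 (\<Union>i\<in>{n..}. A i)"])
        (auto intro!: always_eventually \<nu>0_nonneg \<nu>0_le)
    then have "(\<lambda>n. \<nu>0 (\<Union>i. A i) - \<nu>0 (\<Union>i\<in>{n..}. A i)) \<longlonglongrightarrow> \<nu>0 (\<Union>i. A i) - 0"
      by (intro tendsto_diff tendsto_const)
    moreover have "(\<Sum>i<n. \<nu>0 (A i)) = \<nu>0 (\<Union>i. A i) - \<nu>0 (\<Union>i\<in>{n..}. A i)" for n
      using tail[of n] by linarith
    ultimately show ?thesis
      unfolding sums_def by simp
  qed
  define \<nu> where "\<nu> = measure_of (space M) (sets M) (\<lambda>A. ennreal (\<nu>0 A))"
  have sets_\<nu>[measurable_cong, simp]: "sets \<nu> = sets M" and space_\<nu>: "space \<nu> = space M"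
    by (auto simp: \<nu>_def sets.sigma_sets_eq sets.space_closed sets_measure_of_conv space_measure_of_conv)
  have emeasure_\<nu>: "emeasure \<nu> A = ennreal (\<nu>0 A)" if "A \<in> sets M" for A
  proof (rule emeasure_measure_of[OF \<nu>_def])
    show "countably_additive (sets \<nu>) (\<lambda>A. ennreal (\<nu>0 A))"
    proof (rule countably_additiveI)
      fix A :: "nat \<Rightarrow> 'a set" assume A: "range A \<subseteq> sets \<nu>" "disjoint_family A"
      then have "(\<lambda>i. \<nu>0 (A i)) sums \<nu>0 (\<Union>i. A i)" using \<nu>0_sums by simp
      then show "(\<Sum>i. ennreal (\<nu>0 (A i))) = ennreal (\<nu>0 (\<Union>i. A i))"
        using A \<nu>0_nonneg by (intro suminf_ennreal_eq) auto
    qed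
  qed (use that sets.space_closed in \<open>auto simp: positive_def \<nu>0_empty\<close>)
  have \<nu>_le: "emeasure \<nu> A \<le> (\<integral>\<^sup>+x. ennreal (2 * C * h x) * indicator A x \<partial>M)" if "A \<in> sets M" for A
  proof -
    have "emeasure \<nu> A \<le> ennreal (\<integral>x. 2 * C * (h x * indicator A x) \<partial>M)"
      using \<nu>0_le[OF that] by (simp add: emeasure_\<nu>[OF that] ennreal_leI)
    also have "\<dots> = (\<integral>\<^sup>+x. ennreal (2 * C * (h x * indicator A x)) \<partial>M)"
      using hA_int[OF that] C_nonneg h_nonneg by (intro nn_integral_eq_integral[symmetric]) auto
    also have "\<dots> = (\<integral>\<^sup>+x. ennreal (2 * C * h x) * indicator A x \<partial>M)"
      by (intro nn_integral_cong) (auto simp: indicator_def)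
    finally show ?thesis .
  qed
  have "absolutely_continuous M \<nu>"
    unfolding absolutely_continuous_def
  proof (intro subsetI null_setsI)
    fix A assume A: "A \<in> null_sets M"
    have "(\<integral>\<^sup>+x. ennreal (2 * C * h x) * indicator A x \<partial>M) = 0"
      by (rule nn_integral_null_set[OF A])
    then show "emeasure \<nu> A = 0" using \<nu>_le[of A] A by auto
  qed auto
  then obtain g where g[measurable]: "g \<in> borel_measurable M" and dens: "density M g = \<nu>"
    using Radon_Nikodym[of \<nu>] by auto
  have g_int: "(\<integral>\<^sup>+x. g x * indicator A x \<partial>M) = ennreal (\<nu>0 A)" if "A \<in> sets M" for A
    using emeasure_density[OF g that] dens emeasure_\<nu>[OF that] by simp
  have g_le: "AE x in M. g x \<le> ennreal (2 * C * h x)"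
  proof -
    \<comment> \<open>On the set where the bound fails, the estimate for \<open>\<nu>\<close> leaves
      no mass for the excess of \<open>g\<close>. The integral \<open>?I\<close> is finite and can
      therefore be cancelled.\<close>
    define A where "A = {x\<in>space M. ennreal (2 * C * h x) < g x}"
    have A[measurable]: "A \<in> sets M" unfolding A_def by measurable
    let ?I = "\<integral>\<^sup>+x. ennreal (2 * C * h x) * indicator A x \<partial>M"
    let ?D = "\<integral>\<^sup>+x. (g x - ennreal (2 * C * h x)) * indicator A x \<partial>M"
    have "?I + ?D = (\<integral>\<^sup>+x. ennreal (2 * C * h x) * indicator A x + (g x - ennreal (2 * C * h x)) * indicator A x \<partial>M)"
      by (intro nn_integral_add[symmetric]) auto
    also have "\<dots> = (\<integral>\<^sup>+x. g x * indicator A x \<partial>M)"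
      by (intro nn_integral_cong) (auto simp: A_def indicator_def)
    also have "\<dots> = emeasure \<nu> A" by (simp add: g_int[OF A] emeasure_\<nu>[OF A])
    also have "\<dots> \<le> ?I" by (rule \<nu>_le[OF A])
    finally have "?I + ?D \<le> ?I + 0" by simp
    moreover have "?I \<noteq> top"
    proof -
      have "?I = (\<integral>\<^sup>+x. ennreal (2 * C * (h x * indicator A x)) \<partial>M)"
        by (intro nn_integral_cong) (auto simp: indicator_def)
      also have "\<dots> = ennreal (\<integral>x. 2 * C * (h x * indicator A x) \<partial>M)"
        using hA_int[OF A] C_nonneg h_nonneg by (intro nn_integral_eq_integral) auto
      finally show ?thesis by simp
    qed
    ultimately have "?D = 0"
      unfolding ennreal_add_left_cancel_le by auto
    then have "AE x in M. (g x - ennreal (2 * C * h x)) * indicator A x = 0"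
      by (subst (asm) nn_integral_0_iff_AE) auto
    then show ?thesis
    proof (rule AE_mp, intro AE_I2 impI)
      fix x assume x: "x \<in> space M" and z: "(g x - ennreal (2 * C * h x)) * indicator A x = 0"
      show "g x \<le> ennreal (2 * C * h x)"
      proof (rule ccontr)
        assume n: "\<not> ?thesis"
        then have "x \<in> A" using x by (auto simp: A_def)
        then have "g x - ennreal (2 * C * h x) = 0" using z by simp
        then show False using n by (metis diff_eq_0_iff_ennreal ennreal_minus_eq_0 not_le)
      qed
    qed
  qed
  \<comment> \<open>Dividing by \<open>h\<close> removes the weight built into \<open>\<nu>\<close>,
    and subtracting \<open>C\<close> undoes the shift in \<open>G\<close>. The range between
    \<open>0\<close> and \<open>2 * C\<close> becomes the symmetric bound \<open>C\<close>.\<close>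
  define \<sigma> where "\<sigma> x = enn2real (g x) / h x - C" for x
  have \<sigma>_meas[measurable]: "\<sigma> \<in> borel_measurable M" by (auto simp: \<sigma>_def[abs_def])
  have \<sigma>_bound: "AE x in M. \<bar>\<sigma> x\<bar> \<le> C"
    using g_le
  proof (rule AE_mp, intro AE_I2 impI)
    fix x assume x: "x \<in> space M" and le: "g x \<le> ennreal (2 * C * h x)"
    have "enn2real (g x) \<le> 2 * C * h x"
      using le C_nonneg h_nonneg[of x] by (simp add: enn2real_leI)
    then have "enn2real (g x) / h x \<le> 2 * C"
      using h_pos[OF x] by (simp add: pos_divide_le_eq)
    moreover have "0 \<le> enn2real (g x) / h x" using h_nonneg[of x] by simp
    ultimately show "\<bar>\<sigma> x\<bar> \<le> C" by (auto simp: \<sigma>_def)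
  qed
  have \<sigma>_int: "integrable M (\<lambda>x. \<sigma> x * f x)" if "integrable M f" for f
  proof (rule Bochner_Integration.integrable_bound[of M "\<lambda>x. C * f x"])
    show "AE x in M. norm (\<sigma> x * f x) \<le> norm (C * f x)"
      using \<sigma>_bound by eventually_elim (auto simp: abs_mult C_nonneg intro!: mult_right_mono)
  qed (use that in auto)
  \<comment> \<open>The defect of the representation. It is linear, bounded in the
    \<open>L1norm\<close>, and zero on weighted indicators, which forces it to vanish.\<close>
  define D where "D f = ext f - (\<integral>x. \<sigma> x * f x \<partial>M)" for f
  have D_bound: "\<bar>D f\<bar> \<le> 2 * C * L1norm f" if f: "integrable M f" for f
  proof -
    have "\<bar>\<integral>x. \<sigma> x * f x \<partial>M\<bar> \<le> (\<integral>x. \<bar>\<sigma> x * f x\<bar> \<partial>M)" by simp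
    also have "\<dots> \<le> (\<integral>x. C * \<bar>f x\<bar> \<partial>M)"
    proof (rule integral_mono_AE)
      show "AE x in M. \<bar>\<sigma> x * f x\<bar> \<le> C * \<bar>f x\<bar>"
        using \<sigma>_bound by eventually_elim (auto simp: abs_mult intro!: mult_right_mono)
    qed (use f \<sigma>_int[OF f] in auto)
    finally show ?thesis using ext_bound[OF f] by (simp add: D_def)
  qed
  have D_add: "D (\<lambda>x. f x + g x) = D f + D g" if "integrable M f" "integrable M g" for f g
    using that by (simp add: D_def ext_add distrib_left \<sigma>_int)
  have D_scale: "D (\<lambda>x. c * f x) = c * D f" if "integrable M f" for c f
  proof -
    have "(\<integral>x. \<sigma> x * (c * f x) \<partial>M) = (\<integral>x. c * (\<sigma> x * f x) \<partial>M)"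
      by (simp add: mult.left_commute)
    then show ?thesis using that by (simp add: D_def ext_scale right_diff_distrib)
  qed
  have D_ind: "D (\<lambda>x. h x * indicator A x) = 0" if A: "A \<in> sets M" for A
  proof -
    have "(\<integral>x. (\<sigma> x + C) * (h x * indicator A x) \<partial>M) = enn2real (\<integral>\<^sup>+x. g x * indicator A x \<partial>M)"
    proof (subst integral_eq_nn_integral)
      have "(\<integral>\<^sup>+x. ennreal ((\<sigma> x + C) * (h x * indicator A x)) \<partial>M) = (\<integral>\<^sup>+x. g x * indicator A x \<partial>M)"
      proof (rule nn_integral_cong_AE)
        show "AE x in M. ennreal ((\<sigma> x + C) * (h x * indicator A x)) = g x * indicator A x"
          using g_le
        proof (rule AE_mp, intro AE_I2 impI)
          fix x assume x: "x \<in> space M" and le: "g x \<le> ennreal (2 * C * h x)"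
          have "g x < top" using le by (rule le_less_trans) simp
          then show "ennreal ((\<sigma> x + C) * (h x * indicator A x)) = g x * indicator A x"
            using h_pos[OF x] by (auto simp: \<sigma>_def indicator_def)
        qed
      qed
      then show "enn2real (\<integral>\<^sup>+x. ennreal ((\<sigma> x + C) * (h x * indicator A x)) \<partial>M)
          = enn2real (\<integral>\<^sup>+x. g x * indicator A x \<partial>M)" by simp
      show "AE x in M. 0 \<le> (\<sigma> x + C) * (h x * indicator A x)"
        using h_nonneg by (auto simp: \<sigma>_def)
    qed (use A in measurable)
    also have "\<dots> = \<nu>0 A" using g_int[OF A] \<nu>0_nonneg[OF A] by simp
    also have "\<dots> = ext (\<lambda>x. h x * indicator A x) + C * (\<integral>x. h x * indicator A x \<partial>M)"
      by (simp add: \<nu>0_def G_def)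
    finally show ?thesis
      using hA_int[OF A] \<sigma>_int[OF hA_int[OF A]] by (simp add: D_def distrib_right)
  qed
  have "D f = 0" if f: "integrable M f" for f
  proof -
    \<comment> \<open>The induction runs over functions \<open>u\<close> integrable for the weighted
      measure, applied to \<open>h * u\<close>. Its base case then consists of multiples of
      \<open>h * indicator A\<close>, where the defect is known to vanish, also when
      \<open>A\<close> has infinite measure for \<open>M\<close>.\<close>
    let ?N = "density M (\<lambda>x. ennreal (h x))"
    have [measurable]: "f \<in> borel_measurable M" using f by auto
    have iff: "integrable ?N u \<longleftrightarrow> integrable M (\<lambda>x. h x * u x)" if "u \<in> borel_measurable M" for u :: "'a \<Rightarrow> real"
      using that h_nonneg by (subst integrable_density) auto
    have N_int: "integrable M (\<lambda>x. h x * u x)" if "integrable ?N u" for u :: "'a \<Rightarrow> real"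
      using that iff borel_measurable_integrable[OF that] by simp
    have hf: "h x * (f x / h x) = f x" if "x \<in> space M" for x
      using h_pos[OF that] by simp
    have "integrable M (\<lambda>x. h x * (f x / h x))"
      using f by (subst Bochner_Integration.integrable_cong[OF refl hf]) auto
    then have "integrable ?N (\<lambda>x. f x / h x)"
      by (subst iff) auto
    then have "D (\<lambda>x. h x * (f x / h x)) = 0"
    proof (induction rule: integrable_induct)
      case (base A c)
      have "(\<lambda>x. h x * (indicator A x *\<^sub>R c)) = (\<lambda>x. c * (h x * indicator A x))"
        by auto
      then show ?case using D_scale[OF hA_int] D_ind base(1) by simp
    next
      case (add u v)
      then show ?case using D_add[OF N_int N_int] by (simp add: distrib_left)
    next
      case (lim u s)
      have hu: "integrable M (\<lambda>x. h x * u x)" and hs: "integrable M (\<lambda>x. h x * s i x)" for i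
        using lim N_int by auto
      have "(\<lambda>i. L1norm (\<lambda>x. h x * u x + (-1) * (h x * s i x))) \<longlonglongrightarrow> (\<integral>x. 0 \<partial>M)"
      proof (rule integral_dominated_convergence[where w="\<lambda>x. 3 * \<bar>h x * u x\<bar>"])
        show "AE x in M. (\<lambda>i. \<bar>h x * u x + (-1) * (h x * s i x)\<bar>) \<longlonglongrightarrow> 0"
          using lim.hyps(2) by (intro AE_I2) (auto intro!: tendsto_eq_intros simp: space_density)
        show "AE x in M. norm \<bar>h x * u x + (-1) * (h x * s i x)\<bar> \<le> 3 * \<bar>h x * u x\<bar>" for i
        proof (rule AE_I2)
          fix x assume "x \<in> space M"
          then have "\<bar>s i x\<bar> \<le> 2 * \<bar>u x\<bar>" using lim.hyps(3)[of x i] by (simp add: space_density)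
          then have "\<bar>h x * s i x\<bar> \<le> 2 * \<bar>h x * u x\<bar>"
            using mult_left_mono[of "\<bar>s i x\<bar>" "2 * \<bar>u x\<bar>" "h x"] h_nonneg[of x] by (simp add: abs_mult)
          then show "norm \<bar>h x * u x + (-1) * (h x * s i x)\<bar> \<le> 3 * \<bar>h x * u x\<bar>" by simp
        qed
      qed (use hu hs in auto)
      then have "(\<lambda>i. 2 * C * L1norm (\<lambda>x. h x * u x + (-1) * (h x * s i x))) \<longlonglongrightarrow> 2 * C * 0"
        by (intro tendsto_mult tendsto_const) simp
      moreover have "\<bar>D (\<lambda>x. h x * u x)\<bar> \<le> 2 * C * L1norm (\<lambda>x. h x * u x + (-1) * (h x * s i x))" for i
      proof -
        have "D (\<lambda>x. h x * u x + (-1) * (h x * s i x)) = D (\<lambda>x. h x * u x)"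
          using D_add[OF hu, of "\<lambda>x. (-1) * (h x * s i x)"] D_scale[OF hs, of "-1" i] hs lim.IH[of i] by simp
        then show ?thesis
          using D_bound[of "\<lambda>x. h x * u x + (-1) * (h x * s i x)"] hu hs by simp
      qed
      ultimately have "\<bar>D (\<lambda>x. h x * u x)\<bar> \<le> 2 * C * 0"
        by (intro LIMSEQ_le_const) auto
      then show ?case by simp
    qed
    \<comment> \<open>The product \<open>h * (f / h)\<close> agrees with \<open>f\<close> only on
      \<open>space M\<close>, so the two are different functions; their difference has norm
      \<open>0\<close> and is invisible to \<open>D\<close>.\<close>
    moreover have "D (\<lambda>x. h x * (f x / h x)) = D (\<lambda>x. h x * (f x / h x)) + D (\<lambda>x. f x - h x * (f x / h x)) - 0"
    proof -
      have i: "integrable M (\<lambda>x. f x - h x * (f x / h x))"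
        using f \<open>integrable M (\<lambda>x. h x * (f x / h x))\<close> by auto
      have "L1norm (\<lambda>x. f x - h x * (f x / h x)) = 0"
        by (subst Bochner_Integration.integral_cong[OF refl, of M _ "\<lambda>_. 0"]) (use h_pos in \<open>fastforce+\<close>)
      then show ?thesis using D_bound[OF i] by simp
    qed
    ultimately show ?thesis
      using D_add[of "\<lambda>x. h x * (f x / h x)" "\<lambda>x. f x - h x * (f x / h x)"] f
        \<open>integrable M (\<lambda>x. h x * (f x / h x))\<close> by simp
  qed
  then have "F \<phi> = (\<integral>x. \<sigma> x * \<phi> x \<partial>M)" if "\<phi> \<in> V" for \<phi>
    using ext_V[OF that] V_integrable[OF that] by (simp add: D_def)
  then show ?thesis using that \<sigma>_meas \<sigma>_bound by blast
qed

end

section \<open>Sum of two measures on a common sigma-algebra\<close>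

definition sum_measure :: "'a measure \<Rightarrow> 'a measure \<Rightarrow> 'a measure" where
  "sum_measure M N = measure_of (space M) (sets M) (\<lambda>A. emeasure M A + emeasure N A)"

lemma sets_sum_measure [simp, measurable_cong]: "sets (sum_measure M N) = sets M"
  and space_sum_measure [simp]: "space (sum_measure M N) = space M"
  by (auto simp: sum_measure_def sets.sigma_sets_eq sets.space_closed sets_measure_of_conv space_measure_of_conv)

lemma emeasure_sum_measure:
  assumes sets: "sets N = sets M" and A: "A \<in> sets M"
  shows "emeasure (sum_measure M N) A = emeasure M A + emeasure N A"
proof (rule emeasure_measure_of[OF sum_measure_def])
  show "countably_additive (sets (sum_measure M N)) (\<lambda>A. emeasure M A + emeasure N A)"
  proof (rule countably_additiveI)
    fix A :: "nat \<Rightarrow> 'a set" assume "range A \<subseteq> sets (sum_measure M N)" "disjoint_family A"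
    then show "(\<Sum>i. emeasure M (A i) + emeasure N (A i)) = emeasure M (\<Union> (range A)) + emeasure N (\<Union> (range A))"
      using sets by (subst suminf_add[symmetric]) (auto simp: suminf_emeasure)
  qed
qed (use A sets.space_closed in \<open>auto simp: positive_def\<close>)

lemma nn_integral_sum_measure:
  assumes sets: "sets N = sets M" and f: "f \<in> borel_measurable M"
  shows "(\<integral>\<^sup>+x. f x \<partial>sum_measure M N) = (\<integral>\<^sup>+x. f x \<partial>M) + (\<integral>\<^sup>+x. f x \<partial>N)"
proof -
  note [measurable_cong] = sets
  have space: "space N = space M" using sets by (rule sets_eq_imp_space_eq)
  show ?thesis
    using f
  proof (induction rule: borel_measurable_induct)
    case (cong f g)
    then show ?case
      using nn_integral_cong[of "sum_measure M N" f g] nn_integral_cong[of M f g] nn_integral_cong[of N f g] space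
      by simp
  next
    case (set A)
    then show ?case using emeasure_sum_measure[OF sets] sets by simp
  next
    case (mult u c)
    then show ?case by (subst (1 2 3) nn_integral_cmult) (auto simp: distrib_left)
  next
    case (add u v)
    then show ?case by (subst (1 2 3) nn_integral_add) (auto simp: ac_simps)
  next
    case (seq U)
    have "(\<integral>\<^sup>+x. (SUP i. U i) x \<partial>K) = (SUP i. \<integral>\<^sup>+x. U i x \<partial>K)" if "sets K = sets M" for K
    proof -
      note [measurable_cong] = that
      have "(\<integral>\<^sup>+x. (SUP i. U i x) \<partial>K) = (SUP i. \<integral>\<^sup>+x. U i x \<partial>K)"
        using seq by (intro nn_integral_monotone_convergence_SUP) auto
      then show ?thesis by (simp add: image_comp)
    qed
    note * = this[OF sets_sum_measure] this[OF refl] this[OF sets]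
    have "(SUP i. integral\<^sup>N M (U i) + integral\<^sup>N N (U i)) = (SUP i. integral\<^sup>N M (U i)) + (SUP i. integral\<^sup>N N (U i))"
      using \<open>incseq U\<close> by (intro ennreal_SUP_add) (auto simp: incseq_def le_fun_def intro!: nn_integral_mono)
    moreover have "integral\<^sup>N (sum_measure M N) (U i) = integral\<^sup>N M (U i) + integral\<^sup>N N (U i)" for i
      using seq.IH by simp
    ultimately show ?case using * by simp
  qed
qed

lemma
  fixes f :: "'a \<Rightarrow> real"
  assumes sets: "sets N = sets M" and M: "integrable M f" and N: "integrable N f"
  shows integrable_sum_measure: "integrable (sum_measure M N) f"
    and integral_sum_measure: "(\<integral>x. f x \<partial>sum_measure M N) = (\<integral>x. f x \<partial>M) + (\<integral>x. f x \<partial>N)"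
proof -
  have [measurable]: "f \<in> borel_measurable M" using M by auto
  note nn = nn_integral_sum_measure[OF sets]
  have fin: "(\<integral>\<^sup>+x. ennreal (norm (f x)) \<partial>M) < \<infinity>" "(\<integral>\<^sup>+x. ennreal (norm (f x)) \<partial>N) < \<infinity>"
    using M N by (auto simp: integrable_iff_bounded)
  then show int: "integrable (sum_measure M N) f"
    by (simp add: integrable_iff_bounded nn)
  have le: "(\<integral>\<^sup>+x. ennreal (s * f x) \<partial>K) < \<infinity>"
    if "(\<integral>\<^sup>+x. ennreal (norm (f x)) \<partial>K) < \<infinity>" "s = 1 \<or> s = -1" for s K
    by (rule le_less_trans[OF nn_integral_mono that(1)]) (use that(2) in \<open>auto intro!: ennreal_leI\<close>)
  have "enn2real (\<integral>\<^sup>+x. ennreal (s * f x) \<partial>sum_measure M N)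
      = enn2real (\<integral>\<^sup>+x. ennreal (s * f x) \<partial>M) + enn2real (\<integral>\<^sup>+x. ennreal (s * f x) \<partial>N)"
    if "s = 1 \<or> s = -1" for s
    using le[OF fin(1) that] le[OF fin(2) that] by (subst nn) (auto simp: enn2real_plus)
  from this[of 1] this[of "-1"]
  show "(\<integral>x. f x \<partial>sum_measure M N) = (\<integral>x. f x \<partial>M) + (\<integral>x. f x \<partial>N)"
    using M N int by (simp add: real_lebesgue_integral_def)
qed

section \<open>Hausdorff measure of a Lipschitz boundary\<close>

lemma hausdorff_content_le_sum:
  fixes B :: "'i \<Rightarrow> 'a::metric_space set"
  assumes I: "finite I" and A: "A \<subseteq> (\<Union>i\<in>I. B i)" and \<delta>: "\<delta> \<ge> 0"
    and B: "\<And>i. i \<in> I \<Longrightarrow> bounded (B i)" "\<And>i. i \<in> I \<Longrightarrow> diameter (B i) \<le> \<delta>"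
  shows "hausdorff_content k \<delta> A \<le> (\<Sum>i\<in>I. hausdorff_weight k (B i))"
proof -
  obtain g where g: "bij_betw g {..<card I} I"
    using ex_bij_betw_nat_finite[OF I] by (auto simp: atLeast0LessThan)
  \<comment> \<open>The finite covering is padded to a sequence by empty sets, whose weight is
    \<open>0\<close> also for \<open>k = 0\<close>.\<close>
  define C where "C n = (if n < card I then B (g n) else {})" for n
  have gI: "g n \<in> I" if "n < card I" for n using g that by (auto simp: bij_betw_def)
  have "A \<subseteq> (\<Union>n. C n)"
  proof
    fix x assume "x \<in> A"
    then obtain i where i: "i \<in> I" "x \<in> B i" using A by auto
    then obtain n where "n < card I" "g n = i" using g unfolding bij_betw_def by (metis imageE lessThan_iff)
    then show "x \<in> (\<Union>n. C n)" using i by (auto simp: C_def)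
  qed
  then have "hausdorff_content k \<delta> A \<le> (\<Sum>n. hausdorff_weight k (C n))"
    unfolding hausdorff_content_def using B gI \<delta> by (intro INF_lower) (auto simp: C_def)
  also have "\<dots> = (\<Sum>n<card I. hausdorff_weight k (C n))"
    by (intro suminf_finite) (auto simp: C_def hausdorff_weight_def)
  also have "\<dots> = (\<Sum>n<card I. hausdorff_weight k (B (g n)))"
    by (intro sum.cong) (auto simp: C_def)
  also have "\<dots> = (\<Sum>i\<in>I. hausdorff_weight k (B i))"
    by (rule sum.reindex_bij_betw[OF g])
  finally show ?thesis .
qed

definition slab :: "'a::euclidean_space \<Rightarrow> 'a \<Rightarrow> real \<Rightarrow> 'a set" where
  "slab e z s = cbox (\<Sum>j\<in>Basis. (if j = e then 0 else z \<bullet> j - s) *\<^sub>R j)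
                     (\<Sum>j\<in>Basis. (if j = e then 1 else z \<bullet> j + s) *\<^sub>R j)"

lemma mem_slab:
  assumes "e \<in> Basis"
  shows "y \<in> slab e z s \<longleftrightarrow> 0 \<le> y \<bullet> e \<and> y \<bullet> e \<le> 1 \<and> (\<forall>j\<in>Basis - {e}. \<bar>y \<bullet> j - z \<bullet> j\<bar> \<le> s)"
proof -
  have iff: "y \<in> slab e z s \<longleftrightarrow> (\<forall>j\<in>Basis. (if j = e then 0 else z \<bullet> j - s) \<le> y \<bullet> j \<and>
      y \<bullet> j \<le> (if j = e then 1 else z \<bullet> j + s))"
    by (simp add: slab_def mem_box)
  show ?thesis
  proof (intro iffI)
    assume y: "y \<in> slab e z s"
    have "\<bar>y \<bullet> j - z \<bullet> j\<bar> \<le> s" if "j \<in> Basis - {e}" for j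
      using bspec[OF y[unfolded iff], of j] that by (auto simp: abs_le_iff)
    then show "0 \<le> y \<bullet> e \<and> y \<bullet> e \<le> 1 \<and> (\<forall>j\<in>Basis - {e}. \<bar>y \<bullet> j - z \<bullet> j\<bar> \<le> s)"
      using bspec[OF y[unfolded iff] assms] by simp
  next
    assume y: "0 \<le> y \<bullet> e \<and> y \<bullet> e \<le> 1 \<and> (\<forall>j\<in>Basis - {e}. \<bar>y \<bullet> j - z \<bullet> j\<bar> \<le> s)"
    have "z \<bullet> j - s \<le> y \<bullet> j \<and> y \<bullet> j \<le> z \<bullet> j + s" if "j \<in> Basis" "j \<noteq> e" for j
    proof -
      have "\<bar>y \<bullet> j - z \<bullet> j\<bar> \<le> s" using y that by blast
      then show ?thesis by (simp add: abs_le_iff)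
    qed
    then show "y \<in> slab e z s" using y unfolding iff by simp
  qed
qed

lemma emeasure_slab:
  fixes e :: "'a::euclidean_space"
  assumes e: "e \<in> Basis" and s: "s \<ge> 0"
  shows "emeasure lborel (slab e z s) = ennreal ((2 * s) ^ (DIM('a) - 1))"
proof -
  have "emeasure lborel (slab e z s) = ennreal (\<Prod>j\<in>Basis. (if j = e then 1 else 2 * s))"
    unfolding slab_def by (subst emeasure_lborel_cbox) (use s in \<open>auto simp: inner_diff_left intro!: prod.cong arg_cong[where f=ennreal]\<close>)
  also have "(\<Prod>j\<in>Basis. (if j = e then 1 else 2 * s)) = (\<Prod>j\<in>Basis - {e}. 2 * s)"
    using e by (subst prod.remove[of _ e]) (auto intro!: prod.cong)
  also have "\<dots> = (2 * s) ^ (DIM('a) - 1)"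
    using e by simp
  finally show ?thesis .
qed

text \<open>
  Thickening by a unit interval in direction \<open>e\<close> turns a covering of a set in the hyperplane
  into a covering in the full space, whose size Lebesgue measure controls.
\<close>

lemma hausdorff_outer_ge_of_projection:
  fixes S :: "'a::euclidean_space set" and p :: "'a \<Rightarrow> 'a"
  assumes e: "e \<in> Basis" and s: "s \<ge> 0"
    and p: "\<And>x y. dist (p x) (p y) \<le> dist x y"
    and sub: "\<And>z. z \<bullet> e = 0 \<Longrightarrow> (\<forall>j\<in>Basis - {e}. \<bar>z \<bullet> j - a \<bullet> j\<bar> \<le> s) \<Longrightarrow> z \<in> p ` S"
  shows "ennreal (unit_ball_vol (real (DIM('a) - 1)) * (s / 2) ^ (DIM('a) - 1)) \<le> hausdorff_outer (DIM('a) - 1) S"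
proof -
  define k where "k = DIM('a) - 1"
  define v where "v = unit_ball_vol (real k)"
  have v: "v > 0" by (simp add: v_def)
  have pow: "(2 * x) ^ k = 4 ^ k * (x / 2) ^ k" for x :: real
    unfolding power_mult_distrib[symmetric] by simp
  \<comment> \<open>The scale \<open>1\<close> is arbitrary: the volume comparison holds for
    coverings by bounded sets of any diameter, and the outer measure dominates each content.\<close>
  have "ennreal (v * (s / 2) ^ k) \<le> hausdorff_content k 1 S"
    unfolding hausdorff_content_def
  proof (rule INF_greatest)
    fix C :: "nat \<Rightarrow> 'a set"
    assume C: "C \<in> {C. S \<subseteq> (\<Union>i. C i) \<and> (\<forall>i. bounded (C i) \<and> diameter (C i) \<le> 1)}"
    define d where "d i = diameter (C i)" for i
    have d: "d i \<ge> 0" for i using C diameter_ge_0[of "C i"] by (auto simp: d_def)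
    \<comment> \<open>The projection of a set of diameter \<open>d\<close> lies in the cube of side
      \<open>2 * d\<close> about the projection of any one of its points. Comparing
      \<open>(2 * d) ^ k\<close> with the weight \<open>v * (d / 2) ^ k\<close> costs the factor
      \<open>4 ^ k / v\<close>.\<close>
    define B where "B i = (if C i = {} then {} else slab e (p (SOME c. c \<in> C i)) (d i))" for i
    have "slab e a s \<subseteq> (\<Union>i. B i)"
    proof
      fix y assume y: "y \<in> slab e a s"
      define z where "z = y - (y \<bullet> e) *\<^sub>R e"
      have ze: "z \<bullet> e = 0" using e by (simp add: z_def inner_diff_left)
      have zj: "z \<bullet> j = y \<bullet> j" if "j \<in> Basis - {e}" for j
        using that e by (auto simp: z_def inner_diff_left inner_not_same_Basis)
      have "z \<in> p ` S" using y ze zj by (intro sub) (auto simp: mem_slab[OF e])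
      then obtain x where x: "x \<in> S" "z = p x" by blast
      then obtain i where i: "x \<in> C i" using C by blast
      let ?c = "SOME c. c \<in> C i"
      have c: "?c \<in> C i" using i by (rule someI)
      have "\<bar>z \<bullet> j - p ?c \<bullet> j\<bar> \<le> d i" if j: "j \<in> Basis" for j
      proof -
        have "\<bar>z \<bullet> j - p ?c \<bullet> j\<bar> \<le> norm (z - p ?c)"
          using Basis_le_norm[OF j, of "z - p ?c"] by (simp add: inner_diff_left)
        also have "\<dots> \<le> dist x ?c" using p[of x ?c] x by (simp add: dist_norm)
        also have "\<dots> \<le> d i" unfolding d_def using C i c by (intro diameter_bounded_bound) auto
        finally show ?thesis .
      qed
      then have "\<forall>j\<in>Basis - {e}. \<bar>y \<bullet> j - p ?c \<bullet> j\<bar> \<le> d i" using zj by fastforce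
      moreover have "0 \<le> y \<bullet> e" "y \<bullet> e \<le> 1" using y by (auto simp: mem_slab[OF e])
      moreover have "B i = slab e (p ?c) (d i)" using i by (auto simp: B_def)
      ultimately have "y \<in> B i" by (simp add: mem_slab[OF e])
      then show "y \<in> (\<Union>i. B i)" by blast
    qed
    then have "emeasure lborel (slab e a s) \<le> (\<Sum>i. emeasure lborel (B i))"
      by (intro order_trans[OF emeasure_mono emeasure_subadditive_countably]) (auto simp: B_def slab_def)
    also have "\<dots> \<le> (\<Sum>i. ennreal (4 ^ k / v) * hausdorff_weight k (C i))"
    proof (intro suminf_le allI)
      fix i
      have "(2 * d i) ^ k = (4 ^ k / v) * (v * (d i / 2) ^ k)"
        unfolding pow using v by simp
      then have "ennreal ((2 * d i) ^ k) = ennreal (4 ^ k / v) * ennreal (v * (d i / 2) ^ k)"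
        using d[of i] v ennreal_mult[of "4 ^ k / v" "v * (d i / 2) ^ k"] by simp
      then show "emeasure lborel (B i) \<le> ennreal (4 ^ k / v) * hausdorff_weight k (C i)"
        by (auto simp: B_def emeasure_slab[OF e d, folded k_def] hausdorff_weight_def v_def[symmetric] d_def[symmetric])
    qed auto
    also have "\<dots> = ennreal (4 ^ k / v) * (\<Sum>i. hausdorff_weight k (C i))"
      by (rule ennreal_suminf_cmult)
    finally have "ennreal (v / 4 ^ k) * ennreal ((2 * s) ^ k)
        \<le> ennreal (v / 4 ^ k) * (ennreal (4 ^ k / v) * (\<Sum>i. hausdorff_weight k (C i)))"
      unfolding emeasure_slab[OF e s, folded k_def] by (rule mult_left_mono) simp
    also have "\<dots> = (\<Sum>i. hausdorff_weight k (C i))"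
    proof -
      have "ennreal (v / 4 ^ k) * ennreal (4 ^ k / v) = ennreal ((v / 4 ^ k) * (4 ^ k / v))"
        using v by (intro ennreal_mult[symmetric]) auto
      also have "(v / 4 ^ k) * (4 ^ k / v) = 1" using v by simp
      finally have "ennreal (v / 4 ^ k) * ennreal (4 ^ k / v) = 1" by simp
      then show ?thesis by (simp add: mult.assoc[symmetric])
    qed
    also have "ennreal (v / 4 ^ k) * ennreal ((2 * s) ^ k) = ennreal ((v / 4 ^ k) * (2 * s) ^ k)"
      using s v by (intro ennreal_mult[symmetric]) auto
    also have "(v / 4 ^ k) * (2 * s) ^ k = v * (s / 2) ^ k"
      unfolding pow by simp
    finally show "ennreal (v * (s / 2) ^ k) \<le> (\<Sum>i. hausdorff_weight k (C i))" .
  qed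
  also have "\<dots> \<le> hausdorff_outer k S"
    unfolding hausdorff_outer_def by (intro SUP_upper) auto
  finally show ?thesis unfolding v_def k_def .
qed

section \<open>A single Lipschitz chart of the boundary\<close>

locale epigraph_chart =
  fixes L :: real and U \<Omega> :: "'a::euclidean_space set" and A :: "'a \<Rightarrow> 'a" and c e :: 'a and f :: "'a \<Rightarrow> real"
  assumes A: "orthogonal_transformation A" and e: "e \<in> Basis" and lip: "lipschitz_on L {z. z \<bullet> e = 0} f"
    and eq: "U \<inter> \<Omega> = U \<inter> {x. let y = A x + c in y \<bullet> e > f (y - (y \<bullet> e) *\<^sub>R e)}"
    and open_U: "open U" and open_\<Omega>: "open \<Omega>"
begin

definition hpart :: "'a \<Rightarrow> 'a" where "hpart y = y - (y \<bullet> e) *\<^sub>R e"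
definition proj :: "'a \<Rightarrow> 'a" where "proj x = hpart (A x + c)"
definition height :: "'a \<Rightarrow> real" where "height x = (A x + c) \<bullet> e - f (proj x)"

lemma hpart_e [simp]: "hpart y \<bullet> e = 0"
  using e by (simp add: hpart_def inner_diff_left)

lemma norm_hpart_le: "norm (hpart y) \<le> norm y"
proof (rule power2_le_imp_le)
  have "(norm (hpart y))\<^sup>2 = (norm y)\<^sup>2 - (y \<bullet> e)\<^sup>2"
    using e unfolding power2_norm_eq_inner
    by (simp add: hpart_def inner_diff_left inner_diff_right inner_commute power2_eq_square)
  then show "(norm (hpart y))\<^sup>2 \<le> (norm y)\<^sup>2" by simp
qed simp

lemma dist_A: "dist (A x) (A y) = dist x y"
  using orthogonal_transformation_norm[OF A, of "x - y"] orthogonal_transformation_linear[OF A]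
  by (simp add: dist_norm linear_diff)

lemma dist_proj_le: "dist (proj x) (proj y) \<le> dist x y"
proof -
  have "proj x - proj y = hpart (A x - A y)"
    by (simp add: proj_def hpart_def inner_add_left inner_diff_left algebra_simps)
  then show ?thesis using norm_hpart_le[of "A x - A y"] dist_A[of x y] by (simp add: dist_norm)
qed

lemma mem_\<Omega>_iff: "x \<in> U \<Longrightarrow> x \<in> \<Omega> \<longleftrightarrow> height x > 0"
  using eq by (auto simp: height_def proj_def hpart_def Let_def set_eq_iff)

lemma A_surj: obtains x where "A x = y"
  using orthogonal_transformation_surj[OF A] by (metis surjD)

lemma continuous_height: "continuous_on UNIV height"
proof -
  have A': "continuous_on UNIV A"
    using orthogonal_transformation_linear[OF A] by (simp add: linear_continuous_on linear_conv_bounded_linear)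
  then have "continuous_on UNIV proj"
    unfolding proj_def[abs_def] hpart_def by (intro continuous_intros)
  moreover have "continuous_on (proj ` UNIV) f"
    using lipschitz_on_continuous_on[OF lip] by (rule continuous_on_subset) (auto simp: proj_def)
  ultimately have "continuous_on UNIV (\<lambda>x. f (proj x))"
    by (auto intro: continuous_on_compose2[where t="proj ` UNIV" and g=f])
  then show ?thesis using A' unfolding height_def[abs_def] by (intro continuous_intros)
qed

text \<open>Where \<open>height\<close> is negative there is an open set missing
  \<open>\<Omega>\<close>, and where it is positive the point lies in the open set
  \<open>\<Omega>\<close>. Conversely, arbitrarily close to a zero there are points of
  \<open>U\<close> with positive height.\<close>

lemma frontier_iff:
  assumes x: "x \<in> U"
  shows "x \<in> frontier \<Omega> \<longleftrightarrow> height x = 0"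
proof
  assume fr: "x \<in> frontier \<Omega>"
  then have "x \<notin> \<Omega>" using open_\<Omega> by (simp add: frontier_def interior_open)
  then have le: "height x \<le> 0" using mem_\<Omega>_iff[OF x] by simp
  show "height x = 0"
  proof (rule ccontr)
    assume "height x \<noteq> 0"
    let ?W = "U \<inter> {x. height x < 0}"
    have "open ?W"
      using open_U continuous_height by (intro open_Int open_Collect_less) auto
    moreover have "?W \<inter> \<Omega> = {}" using mem_\<Omega>_iff by force
    ultimately have "?W \<inter> closure \<Omega> = {}" by (simp add: open_Int_closure_eq_empty)
    then show False using fr x le \<open>height x \<noteq> 0\<close> by (auto simp: frontier_def)
  qed
next
  assume h: "height x = 0"
  \<comment> \<open>Moving by \<open>t *\<^sub>R v\<close> leaves \<open>proj\<close> fixed and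
    changes \<open>height\<close> by exactly \<open>t\<close>.\<close>
  obtain v where v: "A v = e" by (rule A_surj)
  have nv: "norm v = 1" using orthogonal_transformation_norm[OF A, of v] v e by simp
  have lin: "linear A" by (rule orthogonal_transformation_linear[OF A])
  have height_shift: "height (x + t *\<^sub>R v) = t" for t
  proof -
    have 1: "A (x + t *\<^sub>R v) + c = (A x + c) + t *\<^sub>R e"
      using v lin by (simp add: linear_add linear_cmul)
    have "proj (x + t *\<^sub>R v) = proj x"
      unfolding proj_def 1 using e by (simp add: hpart_def inner_add_left algebra_simps)
    then show ?thesis
      using h e unfolding height_def 1 by (simp add: inner_add_left)
  qed
  obtain r where r: "r > 0" "ball x r \<subseteq> U" using open_U x open_contains_ball by blast
  have "x \<in> closure \<Omega>"
    unfolding closure_approachable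
  proof (intro allI impI)
    fix d :: real assume d: "d > 0"
    let ?t = "min (d/2) (r/2)"
    have t: "?t > 0" "?t < d" "?t < r" using d r by (auto simp: min_def)
    have dist: "dist (x + ?t *\<^sub>R v) x = ?t" using t nv by (simp add: dist_norm)
    then have "x + ?t *\<^sub>R v \<in> U" using r t by (auto simp: dist_commute subset_eq)
    then have "x + ?t *\<^sub>R v \<in> \<Omega>" using mem_\<Omega>_iff height_shift t by simp
    then show "\<exists>y\<in>\<Omega>. dist y x < d" using dist t(2) by (intro bexI[of _ "x + ?t *\<^sub>R v"]) simp_all
  qed
  moreover have "x \<notin> \<Omega>" using mem_\<Omega>_iff[OF x] h by simp
  ultimately show "x \<in> frontier \<Omega>" using open_\<Omega> by (simp add: frontier_def interior_open)
qed

text \<open>A point of height \<open>0\<close> is determined by its projection as a point of the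
  graph of \<open>f\<close>; the parametrisation by the hyperplane is Lipschitz with constant
  \<open>1 + L\<close>.\<close>

lemma dist_graph_le:
  assumes "height x = 0" "height y = 0"
  shows "dist x y \<le> (1 + L) * norm (proj x - proj y)"
proof -
  have pt: "A x + c = proj x + f (proj x) *\<^sub>R e" if "height x = 0" for x
  proof -
    have h: "(A x + c) \<bullet> e = f (proj x)" using that by (simp only: height_def right_minus_eq)
    have "A x + c = proj x + ((A x + c) \<bullet> e) *\<^sub>R e" unfolding proj_def hpart_def by (simp only: diff_add_cancel)
    then show ?thesis by (simp only: h)
  qed
  have "dist x y = norm ((A x + c) - (A y + c))" using dist_A[of x y] by (simp add: dist_norm)
  also have "\<dots> = norm ((proj x - proj y) + (f (proj x) - f (proj y)) *\<^sub>R e)"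
    using pt assms by (simp add: algebra_simps)
  also have "\<dots> \<le> norm (proj x - proj y) + \<bar>f (proj x) - f (proj y)\<bar>"
    using e by (intro order_trans[OF norm_triangle_ineq]) simp
  also have "\<bar>f (proj x) - f (proj y)\<bar> \<le> L * norm (proj x - proj y)"
    using lipschitz_onD[OF lip, of "proj x" "proj y"] by (simp add: dist_norm proj_def)
  finally show ?thesis by (simp add: algebra_simps)
qed

lemma norm_hyperplane_le:
  assumes "z \<bullet> e = 0" "\<And>j. j \<in> Basis - {e} \<Longrightarrow> \<bar>z \<bullet> j\<bar> \<le> s" "s \<ge> 0"
  shows "norm z \<le> real DIM('a) * s"
proof -
  have "norm z \<le> (\<Sum>j\<in>Basis. \<bar>z \<bullet> j\<bar>)" by (rule norm_le_l1)
  also have "\<dots> \<le> (\<Sum>j\<in>(Basis::'a set). s)"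
  proof (rule sum_mono)
    fix j :: 'a assume "j \<in> Basis"
    then show "\<bar>z \<bullet> j\<bar> \<le> s" using assms by (cases "j = e") auto
  qed
  finally show ?thesis by simp
qed

text \<open>The boundary points in the ball project onto a whole cube of the hyperplane: the graph
  point above any \<open>z\<close> near \<open>proj x0\<close> is close to \<open>x0\<close> by
  \<open>dist_graph_le\<close>. The projection does not increase distances, so the cube bounds the
  measure from below.\<close>

lemma hausdorff_frontier_ball_ge:
  assumes x0: "x0 \<in> frontier \<Omega>" and ball: "ball x0 r \<subseteq> U" and r: "r > 0"
  shows "ennreal (unit_ball_vol (real (DIM('a) - 1)) * (r / (4 * real DIM('a) * (1 + L))) ^ (DIM('a) - 1))
    \<le> hausdorff_outer (DIM('a) - 1) (frontier \<Omega> \<inter> ball x0 r)"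
proof -
  have L: "L \<ge> 0" using lipschitz_on_nonneg[OF lip] .
  \<comment> \<open>Chosen so that the graph over the cube of half-side \<open>s\<close> stays
    within \<open>r / 2\<close> of \<open>x0\<close>; the dimension enters through the estimate of
    the norm by the sum of the components.\<close>
  define s where "s = r / (2 * real DIM('a) * (1 + L))"
  have s: "s > 0" using r L by (simp add: s_def add_pos_nonneg)
  have s_eq: "(1 + L) * (real DIM('a) * s) = r / 2" using L by (simp add: s_def field_simps add_nonneg_eq_0_iff)
  have x0U: "x0 \<in> U" using ball r by auto
  have "z \<in> proj ` (frontier \<Omega> \<inter> ball x0 r)"
    if z: "z \<bullet> e = 0" "\<forall>j\<in>Basis - {e}. \<bar>z \<bullet> j - proj x0 \<bullet> j\<bar> \<le> s" for z
  proof -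
    obtain x where x: "A x = z + f z *\<^sub>R e - c" by (rule A_surj)
    have px: "proj x = z" using x z(1) e by (simp add: proj_def hpart_def inner_add_left)
    have hx: "height x = 0" using x z(1) e px by (simp add: height_def inner_add_left)
    have "norm (z - proj x0) \<le> real DIM('a) * s"
      using z s by (intro norm_hyperplane_le) (auto simp: inner_diff_left proj_def)
    then have "(1 + L) * norm (z - proj x0) \<le> r / 2"
      using mult_left_mono[of "norm (z - proj x0)" "real DIM('a) * s" "1 + L"] L s_eq by simp
    moreover have h0: "height x0 = 0" using frontier_iff[OF x0U] x0 by simp
    ultimately have "dist x x0 < r"
      using dist_graph_le[OF hx h0] r unfolding px by linarith
    then have "x \<in> ball x0 r" by (simp add: dist_commute)
    moreover from this have "x \<in> frontier \<Omega>" using ball hx frontier_iff by blast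
    ultimately show ?thesis using px by blast
  qed
  then have "ennreal (unit_ball_vol (real (DIM('a) - 1)) * (s / 2) ^ (DIM('a) - 1))
      \<le> hausdorff_outer (DIM('a) - 1) (frontier \<Omega> \<inter> ball x0 r)"
    using s dist_proj_le e by (intro hausdorff_outer_ge_of_projection[where p=proj and e=e and a="proj x0"]) auto
  also have "s / 2 = r / (4 * real DIM('a) * (1 + L))" by (simp add: s_def)
  finally show ?thesis .
qed

text \<open>A cube of side \<open>2 * r\<close> in the hyperplane is divided into
  \<open>N ^ k\<close> cells. The graph over one cell has diameter at most \<open>D / N\<close>, so
  the total weight \<open>W\<close> does not depend on \<open>N\<close>, while \<open>N\<close>
  makes the pieces as small as \<open>\<delta>\<close> demands.\<close>

lemma hausdorff_frontier_ball_finite: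
  assumes ball: "ball x0 r \<subseteq> U" and r: "r > 0"
  shows "hausdorff_outer (DIM('a) - 1) (frontier \<Omega> \<inter> ball x0 r) < \<infinity>"
proof -
  define k where "k = DIM('a) - 1"
  define v where "v = unit_ball_vol (real k)"
  have v: "v > 0" by (simp add: v_def)
  have L: "L \<ge> 0" using lipschitz_on_nonneg[OF lip] .
  define W where "W = v * ((1 + L) * real DIM('a) * r) ^ k"
  have "hausdorff_content k \<delta> (frontier \<Omega> \<inter> ball x0 r) \<le> ennreal W" if \<delta>: "\<delta> > 0" for \<delta>
  proof -
    define D where "D = (1 + L) * (real DIM('a) * (2 * r))"
    have D: "D > 0" using L r by (simp add: D_def add_pos_nonneg)
    obtain N0 :: nat where N0: "D / \<delta> < real N0" using reals_Archimedean2 by blast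
    define N where "N = Suc N0"
    have N1: "N > 0" by (simp add: N_def)
    have "D / \<delta> < real N" using N0 by (simp add: N_def)
    then have "D < real N * \<delta>" using \<delta> by (simp add: pos_divide_less_eq)
    then have N2: "D / real N \<le> \<delta>" using N1 by (simp add: pos_divide_le_eq mult.commute)
    note N = N1 N2
    define lo where "lo j m = proj x0 \<bullet> j - r + 2 * r * real m / real N" for j m
    define I where "I = PiE (Basis - {e}) (\<lambda>_. {..<N})"
    define B where "B \<kappa> = {x. height x = 0 \<and> (\<forall>j\<in>Basis - {e}. lo j (\<kappa> j) \<le> proj x \<bullet> j \<and>
        proj x \<bullet> j \<le> lo j (\<kappa> j) + 2 * r / real N)}" for \<kappa> :: "'a \<Rightarrow> nat"
    have "finite I" unfolding I_def by (intro finite_PiE) auto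
    have dist_B: "dist x y \<le> D / real N" if "x \<in> B \<kappa>" "y \<in> B \<kappa>" for x y \<kappa>
    proof -
      have "norm (proj x - proj y) \<le> real DIM('a) * (2 * r / real N)"
      proof (rule norm_hyperplane_le)
        fix j assume "j \<in> Basis - {e}"
        then show "\<bar>(proj x - proj y) \<bullet> j\<bar> \<le> 2 * r / real N"
          using that unfolding B_def mem_Collect_eq inner_diff_left abs_le_iff by (smt (verit, best))
      qed (use r in \<open>auto simp: inner_diff_left proj_def\<close>)
      then have "(1 + L) * norm (proj x - proj y) \<le> (1 + L) * (real DIM('a) * (2 * r / real N))"
        using L by (intro mult_left_mono) auto
      then show ?thesis
        using dist_graph_le[of x y] that by (simp add: B_def D_def)
    qed
    have cover: "frontier \<Omega> \<inter> ball x0 r \<subseteq> (\<Union>\<kappa>\<in>I. B \<kappa>)"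
    proof
      fix x assume x: "x \<in> frontier \<Omega> \<inter> ball x0 r"
      then have "x \<in> U" using ball by auto
      then have h: "height x = 0" using frontier_iff x by auto
      \<comment> \<open>Position along axis \<open>j\<close> in units of the mesh
        \<open>2 * r / N\<close>; its integer part selects the cell, and openness of the ball gives
        \<open>t j < N\<close>.\<close>
      define t where "t j = (proj x \<bullet> j - proj x0 \<bullet> j + r) * real N / (2 * r)" for j
      have t: "0 \<le> t j" "t j < real N" if j: "j \<in> Basis" for j
      proof -
        have "\<bar>proj x \<bullet> j - proj x0 \<bullet> j\<bar> \<le> dist (proj x) (proj x0)"
          using Basis_le_norm[OF j, of "proj x - proj x0"] by (simp add: inner_diff_left dist_norm)
        also have "\<dots> < r" using dist_proj_le[of x x0] x by (auto simp: dist_commute)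
        finally have "\<bar>proj x \<bullet> j - proj x0 \<bullet> j\<bar> < r" .
        then have "0 < proj x \<bullet> j - proj x0 \<bullet> j + r" "proj x \<bullet> j - proj x0 \<bullet> j + r < 2 * r" by linarith+
        then show "0 \<le> t j" "t j < real N" using N r by (auto simp: t_def pos_divide_less_eq mult.commute)
      qed
      define \<kappa> where "\<kappa> = (\<lambda>j\<in>Basis - {e}. nat \<lfloor>t j\<rfloor>)"
      have "\<kappa> \<in> I" unfolding I_def \<kappa>_def using t by (auto simp: nat_less_iff floor_less_iff)
      moreover have "x \<in> B \<kappa>"
        unfolding B_def
      proof (intro CollectI conjI h ballI)
        fix j assume j: "j \<in> Basis - {e}"
        have \<kappa>: "real (\<kappa> j) \<le> t j" "t j \<le> real (\<kappa> j) + 1"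
          using t(1)[of j] j floor_correct[of "t j"] by (auto simp: \<kappa>_def)
        have pt: "proj x \<bullet> j = proj x0 \<bullet> j - r + 2 * r * t j / real N"
          using N r by (simp add: t_def)
        show "lo j (\<kappa> j) \<le> proj x \<bullet> j"
          unfolding pt lo_def using \<kappa>(1) r N by (intro add_left_mono divide_right_mono mult_left_mono) auto
        have "2 * r * t j / real N \<le> 2 * r * (real (\<kappa> j) + 1) / real N"
          using \<kappa>(2) r N by (intro divide_right_mono mult_left_mono) auto
        then show "proj x \<bullet> j \<le> lo j (\<kappa> j) + 2 * r / real N"
          unfolding pt lo_def by (simp add: distrib_left add_divide_distrib)
      qed
      ultimately show "x \<in> (\<Union>\<kappa>\<in>I. B \<kappa>)" by blast
    qed
    have bdd: "bounded (B \<kappa>)" for \<kappa>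
      using dist_B unfolding bounded_def by (cases "B \<kappa> = {}") blast+
    have diam: "diameter (B \<kappa>) \<le> D / real N" for \<kappa>
      using dist_B D by (intro diameter_le) (auto simp: dist_norm)
    have "hausdorff_content k \<delta> (frontier \<Omega> \<inter> ball x0 r) \<le> (\<Sum>\<kappa>\<in>I. hausdorff_weight k (B \<kappa>))"
      by (rule hausdorff_content_le_sum[OF \<open>finite I\<close> cover])
        (use \<delta> bdd diam N(2) order_trans in \<open>auto intro: order_trans\<close>)
    also have "\<dots> \<le> (\<Sum>\<kappa>\<in>I. ennreal (v * (D / real N / 2) ^ k))"
      using diam diameter_ge_0[OF bdd]
      by (intro sum_mono) (auto simp: hausdorff_weight_def v_def intro!: ennreal_leI mult_left_mono power_mono divide_right_mono)
    also have "\<dots> = of_nat (card I) * ennreal (v * (D / real N / 2) ^ k)" by simp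
    also have "\<dots> = ennreal (real (card I) * (v * (D / real N / 2) ^ k))"
      using D v by (simp add: ennreal_mult ennreal_of_nat_eq_real_of_nat)
    also have "real (card I) * (v * (D / real N / 2) ^ k) = W"
    proof -
      have "card I = N ^ k" unfolding I_def k_def using e by (simp add: card_PiE)
      moreover have "real N ^ k * (D / real N / 2) ^ k = (D / 2) ^ k"
        using N by (simp add: power_mult_distrib[symmetric])
      ultimately show ?thesis by (simp add: W_def D_def mult.left_commute mult.assoc)
    qed
    finally show ?thesis .
  qed
  then have "hausdorff_outer k (frontier \<Omega> \<inter> ball x0 r) \<le> ennreal W"
    unfolding hausdorff_outer_def by (intro SUP_least) auto
  then show ?thesis unfolding k_def by (rule le_less_trans) simp
qed

end

text \<open>Uniformity comes from the common \<open>\<epsilon>\<close> and \<open>L\<close>: each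
  ball of radius \<open>\<epsilon>\<close> about a boundary point lies in one chart, and
  \<open>\<kappa>\<close> depends on \<open>L\<close> and the dimension alone.\<close>

lemma uniformly_lipschitz_boundaryE:
  fixes \<Omega> :: "'a::euclidean_space set"
  assumes "uniformly_lipschitz_boundary \<Omega>" and "open \<Omega>"
  obtains \<epsilon> \<kappa> where "\<epsilon> > 0" "\<kappa> > 0"
    "\<And>x r. x \<in> frontier \<Omega> \<Longrightarrow> 0 < r \<Longrightarrow> r \<le> \<epsilon> \<Longrightarrow>
      ennreal (\<kappa> * r ^ (DIM('a) - 1)) \<le> hausdorff_outer (DIM('a) - 1) (frontier \<Omega> \<inter> ball x r)"
    "\<And>x. x \<in> frontier \<Omega> \<Longrightarrow> hausdorff_outer (DIM('a) - 1) (frontier \<Omega> \<inter> ball x \<epsilon>) < \<infinity>"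
proof -
  obtain \<epsilon> L \<U> where \<epsilon>: "\<epsilon> > 0" and L: "L > 0" and op: "\<forall>U\<in>\<U>. open U"
    and ball: "\<forall>x\<in>frontier \<Omega>. \<exists>U\<in>\<U>. ball x \<epsilon> \<subseteq> U" and epi: "\<forall>U\<in>\<U>. lipschitz_epigraph_in L U \<Omega>"
    using assms(1) unfolding uniformly_lipschitz_boundary_def by blast
  define \<kappa> where "\<kappa> = unit_ball_vol (real (DIM('a) - 1)) * (1 / (4 * real DIM('a) * (1 + L))) ^ (DIM('a) - 1)"
  have "\<kappa> > 0" using L unfolding \<kappa>_def by (intro mult_pos_pos zero_less_power divide_pos_pos unit_ball_vol_pos) auto
  have chart: "\<exists>U A c e f. epigraph_chart L U \<Omega> A c e f \<and> ball x \<epsilon> \<subseteq> U" if "x \<in> frontier \<Omega>" for x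
    using ball epi op that assms(2) unfolding lipschitz_epigraph_in_def epigraph_chart_def by meson
  show ?thesis
  proof (rule that[OF \<epsilon> \<open>\<kappa> > 0\<close>])
    fix x r assume x: "x \<in> frontier \<Omega>" and r: "0 < r" "r \<le> \<epsilon>"
    obtain U A c e f where ch: "epigraph_chart L U \<Omega> A c e f" and b: "ball x \<epsilon> \<subseteq> U" using chart[OF x] by blast
    interpret epigraph_chart L U \<Omega> A c e f by (rule ch)
    have "\<kappa> * r ^ (DIM('a) - 1)
        = unit_ball_vol (real (DIM('a) - 1)) * (r / (4 * real DIM('a) * (1 + L))) ^ (DIM('a) - 1)"
      by (simp add: \<kappa>_def power_divide)
    then show "ennreal (\<kappa> * r ^ (DIM('a) - 1)) \<le> hausdorff_outer (DIM('a) - 1) (frontier \<Omega> \<inter> ball x r)"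
      using hausdorff_frontier_ball_ge[OF x _ r(1)] b r subset_ball[OF r(2), of x] by auto
  next
    fix x assume x: "x \<in> frontier \<Omega>"
    obtain U A c e f where ch: "epigraph_chart L U \<Omega> A c e f" and b: "ball x \<epsilon> \<subseteq> U" using chart[OF x] by blast
    interpret epigraph_chart L U \<Omega> A c e f by (rule ch)
    show "hausdorff_outer (DIM('a) - 1) (frontier \<Omega> \<inter> ball x \<epsilon>) < \<infinity>"
      by (rule hausdorff_frontier_ball_finite[OF b \<epsilon>])
  qed
qed

section \<open>Surface measure and the volume of boundary layers\<close>

abbreviation surface_measure :: "'a::euclidean_space set \<Rightarrow> 'a measure" where
  "surface_measure \<Omega> \<equiv> restrict_space (hausdorff_measure (DIM('a) - 1)) (frontier \<Omega>)"

lemma measurable_ident_surface_measure: "(\<lambda>x. x) \<in> surface_measure \<Omega> \<rightarrow>\<^sub>M borel"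
  by (intro measurable_restrict_space1 measurable_ident_sets) simp

lemma emeasure_surface_measure:
  fixes \<Omega> :: "'a::euclidean_space set"
  assumes "A \<in> sets borel"
  shows "emeasure (surface_measure \<Omega>) (frontier \<Omega> \<inter> A) = hausdorff_outer (DIM('a) - 1) (frontier \<Omega> \<inter> A)"
  using assms by (simp add: emeasure_restrict_space emeasure_hausdorff_measure)

lemma hausdorff_outer_frontier_bounded:
  fixes \<Omega> :: "'a::euclidean_space set"
  assumes "\<epsilon> > 0"
    and fin: "\<And>x. x \<in> frontier \<Omega> \<Longrightarrow> hausdorff_outer k (frontier \<Omega> \<inter> ball x \<epsilon>) < \<infinity>"
    and B: "bounded B"
  shows "hausdorff_outer k (frontier \<Omega> \<inter> B) < \<infinity>"
proof -
  have "compact (frontier \<Omega> \<inter> closure B)"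
    using B by (intro closed_Int_compact) (auto simp: compact_closure)
  moreover have "frontier \<Omega> \<inter> closure B \<subseteq> (\<Union>x\<in>frontier \<Omega>. ball x \<epsilon>)"
    using assms(1) by auto
  ultimately obtain F where F: "F \<subseteq> frontier \<Omega>" "finite F" "frontier \<Omega> \<inter> closure B \<subseteq> (\<Union>x\<in>F. ball x \<epsilon>)"
    using compactE_image[of "frontier \<Omega> \<inter> closure B" "frontier \<Omega>" "\<lambda>x. ball x \<epsilon>"] by (metis open_ball)
  have "hausdorff_outer k (\<Union>x\<in>F. frontier \<Omega> \<inter> ball x \<epsilon>) < \<infinity>"
    using F(2,1)
  proof (induction F rule: finite_induct)
    case (insert x F)
    have "hausdorff_outer k (\<Union>x\<in>insert x F. frontier \<Omega> \<inter> ball x \<epsilon>)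
        \<le> hausdorff_outer k (frontier \<Omega> \<inter> ball x \<epsilon>) + hausdorff_outer k (\<Union>x\<in>F. frontier \<Omega> \<inter> ball x \<epsilon>)"
      unfolding UN_insert by (rule hausdorff_outer_Un)
    also have "\<dots> < \<infinity>" using insert fin[of x] by (auto simp: less_top[symmetric])
    finally show ?case .
  qed (simp add: hausdorff_outer_empty)
  moreover have "frontier \<Omega> \<inter> B \<subseteq> (\<Union>x\<in>F. frontier \<Omega> \<inter> ball x \<epsilon>)"
    using F(3) closure_subset[of B] by blast
  ultimately show ?thesis
    using hausdorff_outer_mono[of "frontier \<Omega> \<inter> B" _ k] le_less_trans by blast
qed

lemma emeasure_surface_measure_bounded:
  fixes \<Omega> :: "'a::euclidean_space set"
  assumes "open \<Omega>" "uniformly_lipschitz_boundary \<Omega>" "bounded B" "B \<in> sets borel"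
  shows "emeasure (surface_measure \<Omega>) (frontier \<Omega> \<inter> B) < \<infinity>"
proof -
  obtain \<epsilon> where "\<epsilon> > 0"
    "\<And>x. x \<in> frontier \<Omega> \<Longrightarrow> hausdorff_outer (DIM('a) - 1) (frontier \<Omega> \<inter> ball x \<epsilon>) < \<infinity>"
    using uniformly_lipschitz_boundaryE[OF assms(2,1)] by metis
  then show ?thesis
    unfolding emeasure_surface_measure[OF assms(4)]
    by (rule hausdorff_outer_frontier_bounded[OF _ _ assms(3)])
qed

lemma sigma_finite_surface_measure:
  fixes \<Omega> :: "'a::euclidean_space set"
  assumes "open \<Omega>" "uniformly_lipschitz_boundary \<Omega>"
  shows "sigma_finite_measure (surface_measure \<Omega>)"
proof
  show "\<exists>A. countable A \<and> A \<subseteq> sets (surface_measure \<Omega>) \<and> \<Union>A = space (surface_measure \<Omega>) \<and>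
      (\<forall>a\<in>A. emeasure (surface_measure \<Omega>) a \<noteq> \<infinity>)"
  proof (intro exI conjI ballI)
    let ?A = "range (\<lambda>n::nat. frontier \<Omega> \<inter> cball 0 (real n))"
    show "countable ?A" by simp
    show "?A \<subseteq> sets (surface_measure \<Omega>)"
      unfolding sets_restrict_space by (intro image_subsetI imageI) simp
    have "(\<Union>n::nat. cball 0 (real n)) = (UNIV :: 'a set)"
      using real_arch_simple by (auto simp: set_eq_iff)
    then have "\<Union>?A = frontier \<Omega>" by (simp only: Int_UN_distrib[symmetric] Int_UNIV_right)
    then show "\<Union>?A = space (surface_measure \<Omega>)" by (simp add: space_restrict_space)
    fix a assume "a \<in> ?A"
    then obtain n :: nat where a: "a = frontier \<Omega> \<inter> cball 0 (real n)" by blast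
    show "emeasure (surface_measure \<Omega>) a \<noteq> \<infinity>"
      unfolding a
      using emeasure_surface_measure_bounded[OF assms bounded_cball borel_closed[OF closed_cball], of 0 "real n"]
      by (simp only: less_top infinity_ennreal_def)
  qed
qed

text \<open>The indicator of \<open>dist x y < \<rho>\<close> is integrated in both orders, weighted
  with \<open>g x\<close> in one and \<open>h y\<close> in the other. Separate functions are allowed
  because a test function in the layer has to be compared with its slightly enlarged boundary
  values.\<close>

lemma tube_bound:
  fixes \<Omega> :: "'a::euclidean_space set"
  assumes "open \<Omega>" "uniformly_lipschitz_boundary \<Omega>"
  obtains K \<epsilon> where "K > 0" "\<epsilon> > 0"
    "\<And>\<rho> g h. 0 < \<rho> \<Longrightarrow> \<rho> \<le> \<epsilon> \<Longrightarrow> g \<in> borel_measurable borel \<Longrightarrow> h \<in> borel_measurable borel \<Longrightarrow>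
      (\<And>x y. y \<in> frontier \<Omega> \<Longrightarrow> dist x y < \<rho> \<Longrightarrow> g x \<le> h y) \<Longrightarrow>
      (\<integral>\<^sup>+x. g x * indicator {x. \<exists>y\<in>frontier \<Omega>. dist x y < \<rho> / 2} x \<partial>lborel)
        \<le> ennreal (K * \<rho>) * (\<integral>\<^sup>+y. h y \<partial>surface_measure \<Omega>)"
proof -
  define k where "k = DIM('a) - 1"
  obtain \<epsilon> \<kappa> where \<epsilon>: "\<epsilon> > 0" and \<kappa>: "\<kappa> > 0"
    and lower: "\<And>x r. x \<in> frontier \<Omega> \<Longrightarrow> 0 < r \<Longrightarrow> r \<le> \<epsilon> \<Longrightarrow>
      ennreal (\<kappa> * r ^ k) \<le> hausdorff_outer k (frontier \<Omega> \<inter> ball x r)"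
    using uniformly_lipschitz_boundaryE[OF assms(2,1)] unfolding k_def by metis
  define \<omega> where "\<omega> = unit_ball_vol (real (DIM('a)))"
  have \<omega>: "\<omega> > 0" by (simp add: \<omega>_def)
  \<comment> \<open>The volume \<open>\<omega> * \<rho> ^ (k + 1)\<close> of a ball divided by the
    lower bound \<open>\<kappa> * (\<rho> / 2) ^ k\<close> for its surface measure is
    \<open>K * \<rho>\<close>.\<close>
  define K where "K = \<omega> * 2 ^ k / \<kappa>"
  let ?S = "surface_measure \<Omega>"
  interpret S: sigma_finite_measure ?S by (rule sigma_finite_surface_measure[OF assms])
  interpret LS: pair_sigma_finite lborel ?S ..
  have snd_meas[measurable]: "snd \<in> (lborel :: 'a measure) \<Otimes>\<^sub>M ?S \<rightarrow>\<^sub>M borel"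
    by (rule measurable_compose[OF measurable_snd measurable_ident_surface_measure])
  have fst_meas[measurable]: "fst \<in> (lborel :: 'a measure) \<Otimes>\<^sub>M ?S \<rightarrow>\<^sub>M borel"
    using measurable_fst[of "lborel :: 'a measure" ?S] by simp
  show ?thesis
  proof (rule that[of K \<epsilon>])
    show "K > 0" using \<omega> \<kappa> by (simp add: K_def)
    fix \<rho> :: real and g h :: "'a \<Rightarrow> ennreal"
    assume \<rho>: "0 < \<rho>" "\<rho> \<le> \<epsilon>" and g[measurable]: "g \<in> borel_measurable borel" and h[measurable]: "h \<in> borel_measurable borel"
      and gh: "\<And>x y. y \<in> frontier \<Omega> \<Longrightarrow> dist x y < \<rho> \<Longrightarrow> g x \<le> h y"
    define W where "W = {x. \<exists>y\<in>frontier \<Omega>. dist x y < \<rho> / 2}"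
    have "W = (\<Union>y\<in>frontier \<Omega>. ball y (\<rho> / 2))" by (auto simp: W_def dist_commute)
    then have W[measurable]: "W \<in> sets borel" by (auto intro: borel_open)
    define m where "m = \<kappa> * (\<rho> / 2) ^ k"
    have m: "m > 0" using \<kappa> \<rho> by (simp add: m_def)
    let ?Q = "\<lambda>x y. indicator {p. dist (fst p) (snd p) < \<rho>} (x, y) :: ennreal"
    have Q: "{p. dist (fst p) (snd p) < \<rho>} \<in> sets (borel :: ('a \<times> 'a) measure)"
      by (intro borel_open open_Collect_less continuous_intros)
    have pair: "(\<lambda>p. (fst p, snd p)) \<in> (lborel :: 'a measure) \<Otimes>\<^sub>M ?S \<rightarrow>\<^sub>M borel"
      by (intro borel_measurable_Pair fst_meas snd_meas)
    then have Qm: "case_prod ?Q \<in> borel_measurable ((lborel :: 'a measure) \<Otimes>\<^sub>M ?S)"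
      using measurable_compose[OF pair borel_measurable_indicator[OF Q]] by (simp add: case_prod_beta')
    \<comment> \<open>The lower bound is available for balls centred on the frontier only. It
      transfers to the centre \<open>x\<close> because the ball of half the radius about a boundary
      point \<open>y\<close> near \<open>x\<close> is contained in \<open>ball x \<rho>\<close>;
      hence the half width of \<open>W\<close>.\<close>
    have lowW: "ennreal m \<le> (\<integral>\<^sup>+y. ?Q x y \<partial>?S)" if x: "x \<in> W" for x
    proof -
      obtain y where y: "y \<in> frontier \<Omega>" "dist x y < \<rho> / 2" using x by (auto simp: W_def)
      have "ennreal m \<le> hausdorff_outer k (frontier \<Omega> \<inter> ball y (\<rho> / 2))"
        unfolding m_def using y \<rho> by (intro lower) auto
      also have "\<dots> \<le> hausdorff_outer k (frontier \<Omega> \<inter> ball x \<rho>)"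
      proof (intro hausdorff_outer_mono Int_mono subset_refl subsetI)
        fix z assume "z \<in> ball y (\<rho> / 2)"
        then show "z \<in> ball x \<rho>" using y(2) dist_triangle[of x z y] by simp
      qed
      also have "\<dots> = emeasure ?S (frontier \<Omega> \<inter> ball x \<rho>)"
        unfolding k_def by (intro emeasure_surface_measure[symmetric]) auto
      also have "\<dots> = (\<integral>\<^sup>+y. indicator (frontier \<Omega> \<inter> ball x \<rho>) y \<partial>?S)"
        by (intro nn_integral_indicator[symmetric]) (auto simp: sets_restrict_space)
      also have "\<dots> = (\<integral>\<^sup>+y. ?Q x y \<partial>?S)"
        by (intro nn_integral_cong) (auto simp: space_restrict_space indicator_def)
      finally show ?thesis .
    qed
    have Qx: "(\<lambda>y. ?Q x y) \<in> borel_measurable ?S" for x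
      using measurable_Pair2[OF Qm, of x] by simp
    have "ennreal m * (\<integral>\<^sup>+x. g x * indicator W x \<partial>lborel) = (\<integral>\<^sup>+x. ennreal m * (g x * indicator W x) \<partial>lborel)"
      by (intro nn_integral_cmult[symmetric]) auto
    also have "\<dots> \<le> (\<integral>\<^sup>+x. \<integral>\<^sup>+y. g x * ?Q x y \<partial>?S \<partial>lborel)"
    proof (rule nn_integral_mono)
      fix x :: 'a
      have "g x * (ennreal m * indicator W x) \<le> g x * (\<integral>\<^sup>+y. ?Q x y \<partial>?S)"
        using lowW[of x] by (intro mult_left_mono) (auto simp: indicator_def)
      also have "\<dots> = (\<integral>\<^sup>+y. g x * ?Q x y \<partial>?S)"
        by (rule nn_integral_cmult[OF Qx, symmetric])
      finally show "ennreal m * (g x * indicator W x) \<le> (\<integral>\<^sup>+y. g x * ?Q x y \<partial>?S)"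
        by (simp only: mult.left_commute)
    qed
    also have "\<dots> \<le> (\<integral>\<^sup>+x. \<integral>\<^sup>+y. h y * ?Q x y \<partial>?S \<partial>lborel)"
      using gh by (intro nn_integral_mono) (auto simp: indicator_def space_restrict_space)
    also have "\<dots> = (\<integral>\<^sup>+y. \<integral>\<^sup>+x. h y * ?Q x y \<partial>lborel \<partial>?S)"
    proof (rule LS.Fubini'[symmetric])
      have "(\<lambda>p. h (snd p)) \<in> borel_measurable ((lborel :: 'a measure) \<Otimes>\<^sub>M ?S)"
        by (rule measurable_compose[OF snd_meas h])
      then show "(\<lambda>(x, y). h y * ?Q x y) \<in> borel_measurable ((lborel :: 'a measure) \<Otimes>\<^sub>M ?S)"
        using Qm by (simp add: case_prod_beta')
    qed
    also have "\<dots> = (\<integral>\<^sup>+y. h y * ennreal (\<omega> * \<rho> ^ DIM('a)) \<partial>?S)"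
    proof (rule nn_integral_cong)
      fix y :: 'a
      have "(\<integral>\<^sup>+x. h y * ?Q x y \<partial>lborel) = (\<integral>\<^sup>+x. h y * indicator (ball y \<rho>) x \<partial>lborel)"
        by (intro nn_integral_cong) (auto simp: indicator_def dist_commute)
      also have "\<dots> = h y * emeasure lborel (ball y \<rho>)"
        by (intro nn_integral_cmult_indicator) auto
      also have "emeasure lborel (ball y \<rho>) = ennreal (\<omega> * \<rho> ^ DIM('a))"
        using \<rho> by (simp add: emeasure_ball \<omega>_def)
      finally show "(\<integral>\<^sup>+x. h y * ?Q x y \<partial>lborel) = h y * ennreal (\<omega> * \<rho> ^ DIM('a))" .
    qed
    also have "\<dots> = (\<integral>\<^sup>+y. h y \<partial>?S) * ennreal (\<omega> * \<rho> ^ DIM('a))"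
      by (intro nn_integral_multc measurable_compose[OF measurable_ident_surface_measure h])
    finally have "ennreal (1 / m) * (ennreal m * (\<integral>\<^sup>+x. g x * indicator W x \<partial>lborel))
        \<le> ennreal (1 / m) * ((\<integral>\<^sup>+y. h y \<partial>?S) * ennreal (\<omega> * \<rho> ^ DIM('a)))"
      by (rule mult_left_mono) simp
    also have "ennreal (1 / m) * (ennreal m * (\<integral>\<^sup>+x. g x * indicator W x \<partial>lborel))
        = (\<integral>\<^sup>+x. g x * indicator W x \<partial>lborel)"
      using m by (simp add: mult.assoc[symmetric] ennreal_mult[symmetric])
    also have "ennreal (1 / m) * ((\<integral>\<^sup>+y. h y \<partial>?S) * ennreal (\<omega> * \<rho> ^ DIM('a)))
        = (ennreal (1 / m) * ennreal (\<omega> * \<rho> ^ DIM('a))) * (\<integral>\<^sup>+y. h y \<partial>?S)"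
      by (simp add: mult_ac)
    also have "ennreal (1 / m) * ennreal (\<omega> * \<rho> ^ DIM('a)) = ennreal (1 / m * (\<omega> * \<rho> ^ DIM('a)))"
      using m \<omega> \<rho> by (intro ennreal_mult[symmetric]) auto
    also have "1 / m * (\<omega> * \<rho> ^ DIM('a)) = K * \<rho>"
    proof -
      have "DIM('a) = Suc k" by (simp add: k_def)
      then show ?thesis using \<rho> \<kappa> by (simp add: m_def K_def power_divide)
    qed
    finally show "(\<integral>\<^sup>+x. g x * indicator {x. \<exists>y\<in>frontier \<Omega>. dist x y < \<rho> / 2} x \<partial>lborel)
        \<le> ennreal (K * \<rho>) * (\<integral>\<^sup>+y. h y \<partial>?S)"
      by (simp add: W_def)
  qed (rule \<epsilon>)
qed

section \<open>Cutoff functions\<close>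

text \<open>A bump on \<open>[-1, 1]\<close> written as a difference of consecutive steps, so that
  sums of its integer translates telescope. This yields a partition of unity without dividing by the
  sum.\<close>

definition hat :: "real \<Rightarrow> real" where "hat t = step (t + 1) - step t"
definition hat' :: "real \<Rightarrow> real" where "hat' t = step' (t + 1) - step' t"

lemma hat_nonneg: "0 \<le> hat t"
  using step_bounds[of "t + 1"] step_bounds[of t] step_eq_0[of t] step_eq_1[of "t + 1"]
  by (cases "t \<le> 0") (auto simp: hat_def)

lemma hat_le_1: "hat t \<le> 1"
  using step_bounds[of "t + 1"] step_bounds[of t] by (auto simp: hat_def)

lemma hat_eq_0: "\<bar>t\<bar> > 1 \<Longrightarrow> hat t = 0" and hat'_eq_0: "\<bar>t\<bar> > 1 \<Longrightarrow> hat' t = 0"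
  using step_eq_0[of t] step_eq_0[of "t+1"] step_eq_1[of t] step_eq_1[of "t+1"] step'_eq_0[of t] step'_eq_0[of "t+1"]
  by (auto simp: hat_def hat'_def abs_if split: if_splits)

lemma hat_has_real_derivative: "(hat has_real_derivative hat' t) (at t)"
proof -
  have "((\<lambda>t. step (t + 1)) has_real_derivative step' (t + 1)) (at t)"
    using DERIV_shift[of step "step' (t+1)" t 1] step_has_real_derivative[of "t+1"] by simp
  then show ?thesis
    unfolding hat_def[abs_def] hat'_def by (intro DERIV_diff step_has_real_derivative)
qed

lemma C_k_diff: "C_k k \<phi> \<Longrightarrow> C_k k \<psi> \<Longrightarrow> C_k k (\<lambda>x. \<phi> x - \<psi> x)"
  using C_k_add[of k \<phi> "\<lambda>x. (-1) * \<psi> x"] C_k_mult[OF C_k_const[of k "-1"], of \<psi>] by simp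

lemma C_k_hat: "C_k k hat"
proof -
  have "C_k k (\<lambda>t::real. step (1 \<bullet> t + 1))" by (rule C_k_inner_affine[OF C_k_step])
  then show ?thesis
    unfolding hat_def[abs_def] using C_k_step by (intro C_k_diff) (auto simp: inner_real_def)
qed

lemma sum_hat_shift: "(\<Sum>n\<in>{..M}. hat (u - real n)) = step (u + 1) - step (u - real M)"
proof -
  have "(\<Sum>n<Suc M. hat (u - real n)) = (\<Sum>n<Suc M. step (u + 1 - real n) - step (u + 1 - real (Suc n)))"
    by (intro sum.cong) (auto simp: hat_def algebra_simps)
  also have "\<dots> = step (u + 1 - real 0) - step (u + 1 - real (Suc M))"
    by (rule sum_lessThan_telescope')
  finally show ?thesis by (simp add: lessThan_Suc_atMost)
qed

section \<open>A smooth partition of unity on a cubic grid\<close>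

locale grid =
  fixes \<epsilon> :: real and N :: nat and dummy :: "'a::euclidean_space itself"
  assumes \<epsilon>: "\<epsilon> > 0"
begin

text \<open>Coordinate relative to the centre of cell \<open>k\<close>, in units of the mesh
  \<open>\<epsilon>\<close>. The shift by \<open>N\<close> lets natural indices up to
  \<open>2 * N\<close> reach grid points on both sides of the origin.\<close>

definition loc :: "('a \<Rightarrow> nat) \<Rightarrow> 'a \<Rightarrow> 'a \<Rightarrow> real" where
  "loc k i x = x \<bullet> i / \<epsilon> + real N - real (k i)"

definition bump :: "('a \<Rightarrow> nat) \<Rightarrow> 'a \<Rightarrow> real" where
  "bump k x = (\<Prod>i\<in>Basis. hat (loc k i x))"

definition bump' :: "('a \<Rightarrow> nat) \<Rightarrow> 'a \<Rightarrow> 'a \<Rightarrow> real" where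
  "bump' k x y = (\<Sum>i\<in>Basis. (y \<bullet> i / \<epsilon>) * hat' (loc k i x) * (\<Prod>j\<in>Basis - {i}. hat (loc k j x)))"

definition cell :: "('a \<Rightarrow> nat) \<Rightarrow> 'a set" where
  "cell k = {x. \<forall>i\<in>Basis. \<bar>loc k i x\<bar> \<le> 1}"

definition cells :: "('a \<Rightarrow> nat) set" where
  "cells = PiE Basis (\<lambda>_. {..2 * N})"

lemma finite_cells: "finite cells"
  unfolding cells_def by (intro finite_PiE) auto

lemma cell_eq_cbox:
  "cell k = cbox (\<Sum>i\<in>Basis. (\<epsilon> * (real (k i) - real N - 1)) *\<^sub>R i) (\<Sum>i\<in>Basis. (\<epsilon> * (real (k i) - real N + 1)) *\<^sub>R i)"
proof -
  have "\<bar>loc k i x\<bar> \<le> 1 \<longleftrightarrow> \<epsilon> * (real (k i) - real N - 1) \<le> x \<bullet> i \<and> x \<bullet> i \<le> \<epsilon> * (real (k i) - real N + 1)" for x i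
    using \<epsilon> by (auto simp: loc_def abs_le_iff field_simps)
  then show ?thesis by (auto simp: cell_def mem_box)
qed

lemma compact_cell: "compact (cell k)"
  by (simp add: cell_eq_cbox)

lemma bump_bounds: "0 \<le> bump k x" "bump k x \<le> 1"
  unfolding bump_def by (auto intro!: prod_nonneg prod_le_1 hat_nonneg hat_le_1)

lemma bump_eq_0: "x \<notin> cell k \<Longrightarrow> bump k x = 0"
  unfolding bump_def cell_def by (rule prod_zero) (auto simp: not_le intro: hat_eq_0)

lemma bump'_eq_0:
  assumes "x \<notin> cell k"
  shows "bump' k x y = 0"
proof -
  obtain j where j: "j \<in> Basis" "\<bar>loc k j x\<bar> > 1" using assms by (auto simp: cell_def not_le)
  have "(y \<bullet> i / \<epsilon>) * hat' (loc k i x) * (\<Prod>j\<in>Basis - {i}. hat (loc k j x)) = 0" if "i \<in> Basis" for i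
  proof (cases "i = j")
    case True
    then show ?thesis using hat'_eq_0[OF j(2)] by simp
  next
    case False
    then have "(\<Prod>j\<in>Basis - {i}. hat (loc k j x)) = 0"
      using j hat_eq_0[OF j(2)] by (intro prod_zero) auto
    then show ?thesis by simp
  qed
  then show ?thesis unfolding bump'_def by (intro sum.neutral) auto
qed

lemma C_k_bump: "C_k m (bump k)"
proof -
  have "C_k m (\<lambda>x. hat (loc k i x))" for i :: 'a
  proof -
    have "C_k m (\<lambda>x. hat ((inverse \<epsilon> *\<^sub>R i) \<bullet> x + (real N - real (k i))))"
      by (rule C_k_inner_affine[OF C_k_hat])
    moreover have "(inverse \<epsilon> *\<^sub>R i) \<bullet> x + (real N - real (k i)) = loc k i x" for x
      by (simp add: loc_def divide_inverse inner_commute mult.commute)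
    ultimately show ?thesis by simp
  qed
  then show ?thesis unfolding bump_def[abs_def] by (intro C_k_prod)
qed

lemma bump_has_derivative: "(bump k has_derivative bump' k x) (at x)"
proof -
  have "((\<lambda>x. hat (loc k i x)) has_derivative (\<lambda>y. (y \<bullet> i / \<epsilon>) * hat' (loc k i x))) (at x)" for i
  proof -
    have 1: "(loc k i has_derivative (\<lambda>y. y \<bullet> i / \<epsilon>)) (at x)"
      unfolding loc_def[abs_def] using \<epsilon> by (auto intro!: derivative_eq_intros)
    have 2: "(hat has_derivative (\<lambda>h. hat' (loc k i x) * h)) (at (loc k i x))"
      using hat_has_real_derivative[of "loc k i x"] by (simp add: has_field_derivative_def)
    show ?thesis using has_derivative_compose[OF 1 2] by (simp add: mult.commute)
  qed
  then show ?thesis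
    unfolding bump_def[abs_def] bump'_def by (intro has_derivative_prod)
qed

lemma abs_bump'_le:
  assumes D: "\<And>t. \<bar>step' t\<bar> \<le> D"
  shows "\<bar>bump' k x y\<bar> \<le> real DIM('a) * (2 * D / \<epsilon>) * norm y"
proof -
  have D0: "D \<ge> 0" using D[of 0] by linarith
  have "\<bar>bump' k x y\<bar> \<le> (\<Sum>i\<in>Basis. \<bar>(y \<bullet> i / \<epsilon>) * hat' (loc k i x) * (\<Prod>j\<in>Basis - {i}. hat (loc k j x))\<bar>)"
    unfolding bump'_def by (rule sum_abs)
  also have "\<dots> \<le> (\<Sum>i\<in>(Basis :: 'a set). (2 * D / \<epsilon>) * norm y)"
  proof (rule sum_mono)
    fix i :: 'a assume i: "i \<in> Basis"
    have p: "\<bar>\<Prod>j\<in>Basis - {i}. hat (loc k j x)\<bar> \<le> 1"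
      unfolding abs_prod using hat_nonneg hat_le_1 by (intro prod_le_1) auto
    have "\<bar>hat' (loc k i x)\<bar> \<le> 2 * D"
      using D[of "loc k i x + 1"] D[of "loc k i x"] unfolding hat'_def by linarith
    moreover have "\<bar>y \<bullet> i / \<epsilon>\<bar> \<le> norm y / \<epsilon>"
      using Basis_le_norm[OF i, of y] \<epsilon> by (simp add: divide_right_mono)
    ultimately have "\<bar>y \<bullet> i / \<epsilon>\<bar> * \<bar>hat' (loc k i x)\<bar> * \<bar>\<Prod>j\<in>Basis - {i}. hat (loc k j x)\<bar> \<le> norm y / \<epsilon> * (2 * D) * 1"
      using p \<epsilon> D0 by (intro mult_mono) auto
    then show "\<bar>(y \<bullet> i / \<epsilon>) * hat' (loc k i x) * (\<Prod>j\<in>Basis - {i}. hat (loc k j x))\<bar> \<le> (2 * D / \<epsilon>) * norm y"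
      by (simp add: abs_mult mult_ac)
  qed
  finally show ?thesis by simp
qed

lemma dist_cell_le:
  assumes "x \<in> cell k" "z \<in> cell k"
  shows "dist x z \<le> 2 * real DIM('a) * \<epsilon>"
proof -
  have "norm (x - z) \<le> (\<Sum>i\<in>Basis. \<bar>(x - z) \<bullet> i\<bar>)" by (rule norm_le_l1)
  also have "\<dots> \<le> (\<Sum>i\<in>(Basis :: 'a set). 2 * \<epsilon>)"
  proof (rule sum_mono)
    fix i :: 'a assume i: "i \<in> Basis"
    then have "\<bar>loc k i x\<bar> \<le> 1" "\<bar>loc k i z\<bar> \<le> 1" using assms by (auto simp: cell_def)
    then have "\<bar>loc k i x - loc k i z\<bar> \<le> 2" by linarith
    moreover have "(x - z) \<bullet> i = \<epsilon> * (loc k i x - loc k i z)"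
      using \<epsilon> by (simp add: loc_def inner_diff_left field_simps)
    ultimately show "\<bar>(x - z) \<bullet> i\<bar> \<le> 2 * \<epsilon>" using \<epsilon> by (simp add: abs_mult)
  qed
  finally show ?thesis by (simp add: dist_norm mult_ac)
qed

text \<open>At most three integers lie within distance \<open>1\<close> of a real number. The bound
  is independent of the number of cells, and so is the gradient estimate for sums of bumps.\<close>

lemma card_active_le: "card {k\<in>cells. x \<in> cell k} \<le> 3 ^ DIM('a)"
proof -
  define A where "A i = {n::nat. \<bar>x \<bullet> i / \<epsilon> + real N - real n\<bar> \<le> 1}" for i
  have A: "finite (A i) \<and> card (A i) \<le> 3" for i
  proof -
    define u where "u = x \<bullet> i / \<epsilon> + real N"
    have sub: "A i \<subseteq> nat ` {\<lceil>u - 1\<rceil>..\<lceil>u - 1\<rceil> + 2}"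
    proof
      fix n assume "n \<in> A i"
      then have "\<bar>u - real n\<bar> \<le> 1" by (simp add: A_def u_def)
      then have "u - 1 \<le> real n" "real n \<le> u + 1" by linarith+
      then have "\<lceil>u - 1\<rceil> \<le> int n" "int n \<le> \<lceil>u - 1\<rceil> + 2" by linarith+
      then show "n \<in> nat ` {\<lceil>u - 1\<rceil>..\<lceil>u - 1\<rceil> + 2}"
        by (intro image_eqI[of _ _ "int n"]) auto
    qed
    then have "finite (A i)" by (rule finite_subset) simp
    moreover have "card (A i) \<le> card (nat ` {\<lceil>u - 1\<rceil>..\<lceil>u - 1\<rceil> + 2})"
      by (rule card_mono[OF _ sub]) simp
    moreover have "\<dots> \<le> card {\<lceil>u - 1\<rceil>..\<lceil>u - 1\<rceil> + 2}" by (rule card_image_le) simp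
    ultimately show ?thesis by simp
  qed
  have "card {k\<in>cells. x \<in> cell k} \<le> card (PiE Basis A)"
  proof (rule card_mono)
    show "finite (PiE Basis A)" using A by (intro finite_PiE) auto
    show "{k\<in>cells. x \<in> cell k} \<subseteq> PiE Basis A"
      by (auto simp: cells_def cell_def loc_def A_def PiE_def)
  qed
  also have "\<dots> = (\<Prod>i\<in>Basis. card (A i))" by (simp add: card_PiE)
  also have "\<dots> \<le> (\<Prod>i\<in>(Basis :: 'a set). 3)" using A by (intro prod_mono) auto
  finally show ?thesis by simp
qed

lemma sum_bump:
  "(\<Sum>k\<in>cells. bump k x)
    = (\<Prod>i\<in>Basis. step (x \<bullet> i / \<epsilon> + real N + 1) - step (x \<bullet> i / \<epsilon> + real N - real (2 * N)))"
proof -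
  have "(\<Sum>k\<in>cells. bump k x) = (\<Sum>k\<in>cells. \<Prod>i\<in>Basis. hat (x \<bullet> i / \<epsilon> + real N - real (k i)))"
    by (simp add: bump_def loc_def)
  also have "\<dots> = (\<Prod>i\<in>Basis. \<Sum>n\<in>{..2 * N}. hat (x \<bullet> i / \<epsilon> + real N - real n))"
    unfolding cells_def by (rule prod_sum_PiE[symmetric]) auto
  finally show ?thesis by (simp only: sum_hat_shift)
qed

lemma sum_bump_le_1: "(\<Sum>k\<in>cells. bump k x) \<le> 1"
proof -
  have "\<bar>\<Sum>k\<in>cells. bump k x\<bar> \<le> 1"
    unfolding sum_bump abs_prod
  proof (rule prod_le_1)
    fix i :: 'a
    show "0 \<le> \<bar>step (x \<bullet> i / \<epsilon> + real N + 1) - step (x \<bullet> i / \<epsilon> + real N - real (2 * N))\<bar> \<and>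
        \<bar>step (x \<bullet> i / \<epsilon> + real N + 1) - step (x \<bullet> i / \<epsilon> + real N - real (2 * N))\<bar> \<le> 1"
      using step_bounds[of "x \<bullet> i / \<epsilon> + real N + 1"] step_bounds[of "x \<bullet> i / \<epsilon> + real N - real (2 * N)"]
      by linarith
  qed
  then show ?thesis by linarith
qed

lemma sum_bump_eq_1:
  assumes "norm x < \<epsilon> * real N"
  shows "(\<Sum>k\<in>cells. bump k x) = 1"
  unfolding sum_bump
proof (rule prod.neutral, rule ballI)
  fix i :: 'a assume i: "i \<in> Basis"
  have "\<bar>x \<bullet> i\<bar> \<le> \<epsilon> * real N" using Basis_le_norm[OF i, of x] assms by linarith
  then have "\<bar>x \<bullet> i / \<epsilon>\<bar> \<le> real N"
    unfolding abs_divide using \<epsilon> by (simp add: pos_divide_le_eq mult.commute)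
  then have "x \<bullet> i / \<epsilon> + real N + 1 \<ge> 1" "x \<bullet> i / \<epsilon> + real N - real (2 * N) \<le> 0"
    unfolding abs_le_iff by simp_all
  then show "step (x \<bullet> i / \<epsilon> + real N + 1) - step (x \<bullet> i / \<epsilon> + real N - real (2 * N)) = 1"
    by (simp only: step_eq_0 step_eq_1)
qed

text \<open>The full sum is locally constant here. Consequently the derivative of a partial sum can
  be nonzero only where some cell containing the point was left out.\<close>

lemma sum_bump'_eq_0:
  assumes "norm x < \<epsilon> * real N"
  shows "(\<Sum>k\<in>cells. bump' k x y) = 0"
proof -
  have "((\<lambda>x. \<Sum>k\<in>cells. bump k x) has_derivative (\<lambda>y. \<Sum>k\<in>cells. bump' k x y)) (at x)"
    by (intro has_derivative_sum bump_has_derivative)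
  moreover have "((\<lambda>x. \<Sum>k\<in>cells. bump k x) has_derivative (\<lambda>y. 0)) (at x)"
  proof (rule has_derivative_transform_within_open[OF has_derivative_const])
    show "x \<in> ball 0 (\<epsilon> * real N)" using assms by simp
    show "1 = (\<Sum>k\<in>cells. bump k z)" if "z \<in> ball 0 (\<epsilon> * real N)" for z
      using sum_bump_eq_1[of z] that by simp
  qed simp
  ultimately show ?thesis using has_derivative_unique by metis
qed

end

text \<open>The cutoff sums the bumps of all cells contained in \<open>\<Omega>\<close>. Cells are
  smaller than \<open>\<delta>\<close>, so no cell is lost at points whose
  \<open>\<delta>\<close>-ball lies in \<open>\<Omega>\<close>; a nonzero derivative betrays a lost
  cell, and then the connected \<open>\<delta>\<close>-ball meets both \<open>\<Omega>\<close> and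
  its complement. The constant is fixed before \<open>\<Omega>\<close>, \<open>R\<close> and
  \<open>\<delta>\<close>.\<close>

lemma cutoff_exists:
  obtains C where "C > 0"
    "\<And>(\<Omega> :: 'a::euclidean_space set) R \<delta>. \<delta> > 0 \<Longrightarrow>
      \<exists>\<beta>. (\<forall>k. C_k k \<beta>) \<and> (\<forall>x. 0 \<le> \<beta> x \<and> \<beta> x \<le> 1) \<and>
        (\<exists>K. compact K \<and> K \<subseteq> \<Omega> \<and> (\<forall>x. x \<notin> K \<longrightarrow> \<beta> x = 0)) \<and>
        (\<forall>x. norm x < R \<longrightarrow> ball x \<delta> \<subseteq> \<Omega> \<longrightarrow> \<beta> x = 1) \<and>
        (\<forall>x y. \<bar>frechet_derivative \<beta> (at x) y\<bar> \<le> C / \<delta> * norm y) \<and>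
        (\<forall>x y. x \<in> \<Omega> \<longrightarrow> norm x < R \<longrightarrow> frechet_derivative \<beta> (at x) y \<noteq> 0 \<longrightarrow>
          (\<exists>z\<in>frontier \<Omega>. dist x z < \<delta>))"
proof -
  obtain D where D: "D \<ge> 0" "\<And>t. \<bar>step' t\<bar> \<le> D" using step'_bounded by blast
  define d where "d = real DIM('a)"
  have d: "d > 0" by (simp add: d_def)
  \<comment> \<open>At most \<open>3 ^ DIM('a)\<close> bumps are active at a point, each with
    gradient at most \<open>d * (2 * D) / \<epsilon>\<close>, and \<open>1 / \<epsilon>\<close> is
    \<open>4 * d / \<delta>\<close>. The \<open>+ 1\<close> gives positivity even if
    \<open>D = 0\<close>.\<close>
  define C where "C = 3 ^ DIM('a) * (d * (2 * D) * (4 * d)) + 1"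
  have C: "C > 0" using D d by (simp add: C_def add_nonneg_pos)
  show ?thesis
  proof (rule that[OF C])
    fix \<Omega> :: "'a set" and R \<delta> :: real assume \<delta>: "\<delta> > 0"
    \<comment> \<open>With this mesh any two points of a cell are at distance at most
      \<open>\<delta> / 2\<close>.\<close>
    define \<epsilon> where "\<epsilon> = \<delta> / (4 * d)"
    have \<epsilon>: "\<epsilon> > 0" using \<delta> d by (simp add: \<epsilon>_def)
    obtain N :: nat where N: "R / \<epsilon> < real N" using reals_Archimedean2 by blast
    then have RN: "R \<le> \<epsilon> * real N" using \<epsilon> by (simp add: pos_divide_less_eq mult.commute)
    interpret grid \<epsilon> N "TYPE('a)" by standard (rule \<epsilon>)
    define G where "G = {k\<in>cells. cell k \<subseteq> \<Omega>}"
    have fG: "finite G" using finite_cells by (simp add: G_def)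
    define \<beta> where "\<beta> x = (\<Sum>k\<in>G. bump k x)" for x
    define \<beta>' where "\<beta>' x y = (\<Sum>k\<in>G. bump' k x y)" for x y
    have fd: "frechet_derivative \<beta> (at x) = \<beta>' x" for x
    proof -
      have "(\<beta> has_derivative \<beta>' x) (at x)"
        unfolding \<beta>_def[abs_def] \<beta>'_def by (intro has_derivative_sum bump_has_derivative)
      then show ?thesis by (rule frechet_derivative_at[symmetric])
    qed
    have sum_le: "(\<Sum>k\<in>G. bump k x) \<le> (\<Sum>k\<in>cells. bump k x)" for x
      using finite_cells bump_bounds(1) by (intro sum_mono2) (auto simp: G_def)
    have "2 * d * \<epsilon> < \<delta>" using \<delta> d by (simp add: \<epsilon>_def)
    then have near: "dist x z < \<delta>" if "x \<in> cell k" "z \<in> cell k" for x z k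
      using dist_cell_le[OF that] by (simp add: d_def)
    have full: "(\<Sum>k\<in>G. q k) = (\<Sum>k\<in>cells. q k)"
      if q: "\<And>k. x \<notin> cell k \<Longrightarrow> q k = 0" and act: "\<And>k. k \<in> cells \<Longrightarrow> x \<in> cell k \<Longrightarrow> cell k \<subseteq> \<Omega>"
      for q :: "('a \<Rightarrow> nat) \<Rightarrow> real" and x
      using finite_cells q act by (intro sum.mono_neutral_left) (auto simp: G_def)
    have \<beta>_le: "\<beta> x \<le> 1" for x
      using sum_le[of x] sum_bump_le_1[of x] by (simp add: \<beta>_def)
    show "\<exists>\<beta>. (\<forall>k. C_k k \<beta>) \<and> (\<forall>x. 0 \<le> \<beta> x \<and> \<beta> x \<le> 1) \<and>
        (\<exists>K. compact K \<and> K \<subseteq> \<Omega> \<and> (\<forall>x. x \<notin> K \<longrightarrow> \<beta> x = 0)) \<and>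
        (\<forall>x. norm x < R \<longrightarrow> ball x \<delta> \<subseteq> \<Omega> \<longrightarrow> \<beta> x = 1) \<and>
        (\<forall>x y. \<bar>frechet_derivative \<beta> (at x) y\<bar> \<le> C / \<delta> * norm y) \<and>
        (\<forall>x y. x \<in> \<Omega> \<longrightarrow> norm x < R \<longrightarrow> frechet_derivative \<beta> (at x) y \<noteq> 0 \<longrightarrow>
          (\<exists>z\<in>frontier \<Omega>. dist x z < \<delta>))"
    proof (intro exI[of _ \<beta>] conjI allI impI)
      show "C_k k \<beta>" for k unfolding \<beta>_def[abs_def] by (intro C_k_sum C_k_bump)
      show "0 \<le> \<beta> x" for x unfolding \<beta>_def by (intro sum_nonneg bump_bounds)
      show "\<exists>K. compact K \<and> K \<subseteq> \<Omega> \<and> (\<forall>x. x \<notin> K \<longrightarrow> \<beta> x = 0)"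
      proof (intro exI[of _ "\<Union>k\<in>G. cell k"] conjI allI impI)
        show "compact (\<Union>k\<in>G. cell k)" using fG compact_cell by (intro compact_UN) auto
        show "(\<Union>k\<in>G. cell k) \<subseteq> \<Omega>" by (auto simp: G_def)
        show "\<beta> x = 0" if "x \<notin> (\<Union>k\<in>G. cell k)" for x
          unfolding \<beta>_def using that by (intro sum.neutral) (auto intro: bump_eq_0)
      qed
      show "\<beta> x = 1" if x: "norm x < R" "ball x \<delta> \<subseteq> \<Omega>" for x
      proof -
        have "\<beta> x = (\<Sum>k\<in>cells. bump k x)"
          unfolding \<beta>_def using x(2) near by (intro full[of x]) (auto simp: bump_eq_0 subset_eq)
        then show ?thesis using sum_bump_eq_1[of x] x(1) RN by simp
      qed
      show "\<bar>frechet_derivative \<beta> (at x) y\<bar> \<le> C / \<delta> * norm y" for x y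
      proof -
        have "\<bar>\<beta>' x y\<bar> \<le> (\<Sum>k\<in>G. \<bar>bump' k x y\<bar>)" unfolding \<beta>'_def by (rule sum_abs)
        also have "\<dots> \<le> (\<Sum>k\<in>cells. \<bar>bump' k x y\<bar>)"
          using finite_cells by (intro sum_mono2) (auto simp: G_def)
        also have "\<dots> = (\<Sum>k\<in>{k\<in>cells. x \<in> cell k}. \<bar>bump' k x y\<bar>)"
          using finite_cells by (intro sum.mono_neutral_right) (auto simp: bump'_eq_0)
        also have "\<dots> \<le> (\<Sum>k\<in>{k\<in>cells. x \<in> cell k}. d * (2 * D / \<epsilon>) * norm y)"
          using abs_bump'_le[OF D(2)] by (intro sum_mono) (simp add: d_def)
        also have "\<dots> = real (card {k\<in>cells. x \<in> cell k}) * (d * (2 * D / \<epsilon>) * norm y)" by simp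
        also have "\<dots> \<le> 3 ^ DIM('a) * (d * (2 * D / \<epsilon>) * norm y)"
        proof (rule mult_right_mono)
          show "real (card {k\<in>cells. x \<in> cell k}) \<le> 3 ^ DIM('a)"
            using card_active_le[of x] by (metis of_nat_le_iff of_nat_numeral of_nat_power)
        qed (use d D \<epsilon> in auto)
        also have "\<dots> = 3 ^ DIM('a) * (d * (2 * D) * (4 * d)) / \<delta> * norm y"
          using d \<delta> by (simp add: \<epsilon>_def)
        also have "\<dots> \<le> C / \<delta> * norm y"
          using \<delta> by (intro mult_right_mono divide_right_mono) (auto simp: C_def)
        finally show ?thesis by (simp add: fd)
      qed
      show "\<exists>z\<in>frontier \<Omega>. dist x z < \<delta>"
        if x: "x \<in> \<Omega>" "norm x < R" and ne: "frechet_derivative \<beta> (at x) y \<noteq> 0" for x y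
      proof -
        have "\<exists>k\<in>cells. x \<in> cell k \<and> \<not> cell k \<subseteq> \<Omega>"
        proof (rule ccontr)
          assume "\<not> ?thesis"
          then have "\<beta>' x y = (\<Sum>k\<in>cells. bump' k x y)"
            unfolding \<beta>'_def by (intro full[of x]) (auto simp: bump'_eq_0)
          then show False using sum_bump'_eq_0[of x y] x(2) RN ne by (simp add: fd)
        qed
        then obtain k z where k: "x \<in> cell k" "z \<in> cell k" "z \<notin> \<Omega>" by blast
        have "ball x \<delta> \<inter> frontier \<Omega> \<noteq> {}"
        proof (rule connected_Int_frontier)
          show "ball x \<delta> \<inter> \<Omega> \<noteq> {}" using x(1) \<delta> centre_in_ball by blast
          show "ball x \<delta> - \<Omega> \<noteq> {}" using near[OF k(1,2)] k(3) by auto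
        qed simp
        then show ?thesis by auto
      qed
      show "\<beta> x \<le> 1" for x by (rule \<beta>_le)
    qed
  qed
qed

section \<open>Lateral and initial measures\<close>

lemma measurable_ident_lateral_measure: "(\<lambda>p. p) \<in> lateral_measure T \<Omega> \<rightarrow>\<^sub>M borel"
proof -
  have "fst \<in> lateral_measure T \<Omega> \<rightarrow>\<^sub>M borel" "snd \<in> lateral_measure T \<Omega> \<rightarrow>\<^sub>M borel"
    unfolding lateral_measure_def
    by (rule measurable_compose[OF measurable_fst] measurable_compose[OF measurable_snd],
        intro measurable_restrict_space1 measurable_ident_sets, simp)+
  then have "(\<lambda>p. (fst p, snd p)) \<in> lateral_measure T \<Omega> \<rightarrow>\<^sub>M borel"
    by (rule borel_measurable_Pair)
  then show ?thesis by simp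
qed

lemma space_lateral_measure: "space (lateral_measure T \<Omega>) = {0<..<T} \<times> frontier \<Omega>"
  by (simp add: lateral_measure_def space_pair_measure space_restrict_space)

lemma nn_integral_lateral_measure:
  fixes \<Omega> :: "'a::euclidean_space set" and f :: "real \<times> 'a \<Rightarrow> ennreal"
  assumes "open \<Omega>" "uniformly_lipschitz_boundary \<Omega>" and f: "f \<in> borel_measurable borel"
  shows "(\<integral>\<^sup>+p. f p \<partial>lateral_measure T \<Omega>)
    = (\<integral>\<^sup>+t. (\<integral>\<^sup>+y. f (t, y) \<partial>surface_measure \<Omega>) * indicator {0<..<T} t \<partial>lborel)"
proof -
  interpret S: sigma_finite_measure "surface_measure \<Omega>" by (rule sigma_finite_surface_measure[OF assms(1,2)])
  have "f \<in> borel_measurable (lateral_measure T \<Omega>)"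
    by (rule measurable_compose[OF measurable_ident_lateral_measure f])
  then have "(\<integral>\<^sup>+p. f p \<partial>lateral_measure T \<Omega>)
      = (\<integral>\<^sup>+t. (\<integral>\<^sup>+y. f (t, y) \<partial>surface_measure \<Omega>) \<partial>restrict_space lborel {0<..<T})"
    unfolding lateral_measure_def by (rule S.nn_integral_fst[symmetric])
  also have "\<dots> = (\<integral>\<^sup>+t. (\<integral>\<^sup>+y. f (t, y) \<partial>surface_measure \<Omega>) * indicator {0<..<T} t \<partial>lborel)"
    by (rule nn_integral_restrict_space) simp
  finally show ?thesis .
qed

lemma nn_integral_lebesgue_on:
  fixes f :: "'a::euclidean_space \<Rightarrow> ennreal"
  assumes "f \<in> borel_measurable borel" "S \<in> sets borel"
  shows "(\<integral>\<^sup>+x. f x \<partial>lebesgue_on S) = (\<integral>\<^sup>+x. f x * indicator S x \<partial>lborel)"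
proof -
  have "(\<integral>\<^sup>+x. f x \<partial>lebesgue_on S) = (\<integral>\<^sup>+x. f x * indicator S x \<partial>lebesgue)"
    using assms(2) by (auto intro!: nn_integral_restrict_space)
  also have "\<dots> = (\<integral>\<^sup>+x. f x * indicator S x \<partial>lborel)"
    using assms by (auto intro!: nn_integral_completion)
  finally show ?thesis .
qed

lemma nn_integral_lebesgue_on_Times:
  fixes f :: "real \<times> 'a::euclidean_space \<Rightarrow> ennreal"
  assumes f: "f \<in> borel_measurable borel" and \<Omega>: "\<Omega> \<in> sets borel"
  shows "(\<integral>\<^sup>+p. f p \<partial>lebesgue_on ({0<..<T} \<times> \<Omega>))
    = (\<integral>\<^sup>+t. (\<integral>\<^sup>+x. f (t, x) * indicator \<Omega> x \<partial>lborel) * indicator {0<..<T} t \<partial>lborel)"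
proof -
  let ?S = "{0<..<T} \<times> \<Omega>"
  have S: "?S \<in> sets borel" using \<Omega> by (simp add: borel_prod[symmetric])
  have "(\<integral>\<^sup>+p. f p \<partial>lebesgue_on ?S) = (\<integral>\<^sup>+p. f p * indicator ?S p \<partial>lborel)"
    by (rule nn_integral_lebesgue_on[OF f S])
  also have "\<dots> = (\<integral>\<^sup>+p. f p * indicator ?S p \<partial>(lborel \<Otimes>\<^sub>M lborel))"
    by (simp add: lborel_prod)
  also have "\<dots> = (\<integral>\<^sup>+t. \<integral>\<^sup>+x. f (t, x) * indicator ?S (t, x) \<partial>lborel \<partial>lborel)"
    using f S by (intro lborel.nn_integral_fst[symmetric]) (auto simp: lborel_prod)
  also have "\<dots> = (\<integral>\<^sup>+t. (\<integral>\<^sup>+x. f (t, x) * indicator \<Omega> x \<partial>lborel) * indicator {0<..<T} t \<partial>lborel)"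
    by (intro nn_integral_cong) (auto simp: indicator_def)
  finally show ?thesis .
qed

lemma frechet_derivative_eq_sum:
  fixes \<phi> :: "'a::euclidean_space \<Rightarrow> real"
  assumes "\<phi> differentiable (at p)"
  shows "frechet_derivative \<phi> (at p) h = (\<Sum>i\<in>Basis. (h \<bullet> i) * frechet_derivative \<phi> (at p) i)"
proof -
  have lin: "linear (frechet_derivative \<phi> (at p))"
    using assms by (simp add: linear_frechet_derivative)
  have "frechet_derivative \<phi> (at p) h = frechet_derivative \<phi> (at p) (\<Sum>i\<in>Basis. (h \<bullet> i) *\<^sub>R i)"
    by (simp add: euclidean_representation)
  also have "\<dots> = (\<Sum>i\<in>Basis. (h \<bullet> i) * frechet_derivative \<phi> (at p) i)"
    using lin by (simp add: linear_sum linear_cmul)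
  finally show ?thesis .
qed

text \<open>Reading the transport operator as one directional derivative in space-time allows the
  product rule to be applied to it in a single step.\<close>

lemma transport_eq_frechet_derivative:
  fixes \<phi> :: "real \<times> 'a::euclidean_space \<Rightarrow> real"
  assumes d: "\<phi> differentiable (at p)"
  shows "w * time_deriv \<phi> p + v \<bullet> space_grad \<phi> p = frechet_derivative \<phi> (at p) (w, v)"
proof -
  have lin: "linear (frechet_derivative \<phi> (at p))"
    using d by (simp add: linear_frechet_derivative)
  have "frechet_derivative \<phi> (at p) (w, v)
      = frechet_derivative \<phi> (at p) (w *\<^sub>R (1, 0) + (\<Sum>i\<in>Basis. (v \<bullet> i) *\<^sub>R (0, i)))"
  proof -
    have "(\<Sum>i\<in>Basis. (v \<bullet> i) *\<^sub>R (0::real, i)) = (0, v)"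
      by (rule prod_eqI) (simp_all add: fst_sum snd_sum euclidean_representation)
    then show ?thesis by simp
  qed
  also have "\<dots> = w * time_deriv \<phi> p + (\<Sum>i\<in>Basis. (v \<bullet> i) * frechet_derivative \<phi> (at p) (0, i))"
    using lin by (simp only: linear_add linear_sum linear_cmul time_deriv_def real_scaleR_def)
  also have "(\<Sum>i\<in>Basis. (v \<bullet> i) * frechet_derivative \<phi> (at p) (0, i)) = v \<bullet> space_grad \<phi> p"
    by (simp add: space_grad_def inner_sum_right mult.commute)
  finally show ?thesis by simp
qed

lemma C_k_differentiable: "C_k (Suc k) \<phi> \<Longrightarrow> \<phi> differentiable (at p)"
  by simp

lemma C_c_inf_differentiable: "\<phi> \<in> C_c_inf S \<Longrightarrow> \<phi> differentiable (at p)"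
  using C_k_differentiable C_c_inf_C_k by blast

lemma C_c_inf_derivative_continuous:
  "\<phi> \<in> C_c_inf S \<Longrightarrow> i \<in> Basis \<Longrightarrow> continuous_on A (\<lambda>p. frechet_derivative \<phi> (at p) i)"
  using C_c_inf_C_k[of \<phi> S "Suc 0"] by (auto intro: continuous_on_subset[OF _ subset_UNIV])

text \<open>Below \<open>t = 0\<close> the representative is an arbitrary smooth extension.
  Therefore values are controlled for times in \<open>{0..<T}\<close> only, and vanishing
  derivatives off \<open>K\<close> are claimed at times in \<open>{0<..<T}\<close>, where a whole
  neighbourhood lies in the zero set.\<close>

lemma C_c_infE:
  fixes \<phi> :: "real \<times> 'a::euclidean_space \<Rightarrow> real"
  assumes \<phi>: "\<phi> \<in> C_c_inf ({0..<T} \<times> UNIV)"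
  obtains K R B where "compact K" "K \<subseteq> {0..<T} \<times> UNIV" "R > 0" "B \<ge> 0"
    "\<And>p. fst p \<in> {0..<T} \<Longrightarrow> p \<notin> K \<Longrightarrow> \<phi> p = 0"
    "\<And>p. p \<in> K \<Longrightarrow> norm (snd p) < R"
    "\<And>p. fst p \<in> {0..<T} \<Longrightarrow> \<bar>\<phi> p\<bar> \<le> B"
    "\<And>p h. fst p \<in> {0<..<T} \<Longrightarrow> p \<notin> K \<Longrightarrow> frechet_derivative \<phi> (at p) h = 0"
    "\<And>p h. p \<in> K \<Longrightarrow> \<bar>frechet_derivative \<phi> (at p) h\<bar> \<le> B * norm h"
proof -
  obtain K where K: "compact K" "K \<subseteq> {0..<T} \<times> UNIV" and zero: "\<And>p. p \<in> {0..<T} \<times> UNIV - K \<Longrightarrow> \<phi> p = 0"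
    using \<phi> by (auto simp: C_c_inf_def)
  have zero': "\<phi> p = 0" if "fst p \<in> {0..<T}" "p \<notin> K" for p
    using that by (intro zero) (auto simp: mem_Times_iff)
  obtain R where R: "R > 0" "\<forall>p\<in>K. norm p < R"
    using compact_imp_bounded[OF K(1)] bounded_pos_less by metis
  have R': "norm (snd p) < R" if "p \<in> K" for p
    using R(2) that norm_snd_le[of "snd p" "fst p"] by fastforce
  have bdd: "\<exists>b>0. \<forall>p\<in>K. \<bar>q p\<bar> \<le> b" if "continuous_on K q" for q :: "real \<times> 'a \<Rightarrow> real"
    using compact_imp_bounded[OF compact_continuous_image[OF that K(1)]] unfolding bounded_pos by auto
  obtain B1 where B1: "B1 > 0" "\<And>p. p \<in> K \<Longrightarrow> \<bar>\<phi> p\<bar> \<le> B1"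
    using bdd[OF C_c_inf_continuous[OF \<phi>]] by blast
  have "continuous_on K (\<lambda>p. \<Sum>i\<in>Basis. \<bar>frechet_derivative \<phi> (at p) i\<bar>)"
    by (intro continuous_intros C_c_inf_derivative_continuous[OF \<phi>])
  then obtain B2 where B2: "B2 > 0" "\<And>p. p \<in> K \<Longrightarrow> \<bar>\<Sum>i\<in>Basis. \<bar>frechet_derivative \<phi> (at p) i\<bar>\<bar> \<le> B2"
    using bdd by blast
  show ?thesis
  proof (rule that[of K R "B1 + B2"])
    show "\<bar>\<phi> p\<bar> \<le> B1 + B2" if "fst p \<in> {0..<T}" for p
      using zero'[OF that] B1 B2(1) by (cases "p \<in> K") fastforce+
    show "frechet_derivative \<phi> (at p) h = 0" if p: "fst p \<in> {0<..<T}" "p \<notin> K" for p h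
    proof -
      have "(\<phi> has_derivative (\<lambda>_. 0)) (at p)"
      proof (rule has_derivative_transform_within_open[OF has_derivative_const])
        show "open ({0<..<T} \<times> UNIV - K)"
          using K(1) by (intro open_Diff open_Times compact_imp_closed) auto
        show "p \<in> {0<..<T} \<times> UNIV - K" using p by (simp add: mem_Times_iff)
        show "0 = \<phi> q" if "q \<in> {0<..<T} \<times> UNIV - K" for q
          using that by (intro zero'[symmetric]) auto
      qed
      then show ?thesis using frechet_derivative_at by metis
    qed
    show "\<bar>frechet_derivative \<phi> (at p) h\<bar> \<le> (B1 + B2) * norm h" if p: "p \<in> K" for p h
    proof -
      have "\<bar>frechet_derivative \<phi> (at p) h\<bar> \<le> (\<Sum>i\<in>Basis. \<bar>(h \<bullet> i) * frechet_derivative \<phi> (at p) i\<bar>)"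
        unfolding frechet_derivative_eq_sum[OF C_c_inf_differentiable[OF \<phi>], of p h] by (rule sum_abs)
      also have "\<dots> \<le> (\<Sum>i\<in>Basis. norm h * \<bar>frechet_derivative \<phi> (at p) i\<bar>)"
        by (intro sum_mono) (auto simp: abs_mult Basis_le_norm intro!: mult_right_mono)
      also have "\<dots> = norm h * (\<Sum>i\<in>Basis. \<bar>frechet_derivative \<phi> (at p) i\<bar>)"
        by (simp add: sum_distrib_left)
      also have "\<dots> \<le> norm h * (B1 + B2)"
        using B2(2)[OF p] B1(1) by (intro mult_left_mono) auto
      finally show ?thesis by (simp add: mult.commute)
    qed
  qed (use K R R' zero' B1 B2 in auto)
qed

lemma C_k_compose_snd: "C_k k \<beta> \<Longrightarrow> C_k k (\<lambda>p :: real \<times> 'a::euclidean_space. \<beta> (snd p))"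
proof (induction k arbitrary: \<beta>)
  case 0
  then show ?case by (auto intro!: continuous_on_compose2[where t=UNIV and g=\<beta>] continuous_on_snd continuous_on_id)
next
  case (Suc k)
  have *: "((\<lambda>p :: real \<times> 'a. \<beta> (snd p)) has_derivative (\<lambda>h. frechet_derivative \<beta> (at (snd p)) (snd h))) (at p)" for p
    using has_derivative_compose[OF bounded_linear_imp_has_derivative[OF bounded_linear_snd] C_k_has_derivative[OF Suc.prems]] .
  have lin: "linear (frechet_derivative \<beta> (at x))" for x
    using Suc.prems by (simp add: linear_frechet_derivative)
  show ?case
    unfolding C_k_Suc_iff[OF *]
  proof
    fix i :: "real \<times> 'a" assume "i \<in> Basis"
    then consider "snd i \<in> Basis" | "snd i = 0" by (auto simp: Basis_prod_def)
    then show "C_k k (\<lambda>p :: real \<times> 'a. frechet_derivative \<beta> (at (snd p)) (snd i))"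
    proof cases
      case 1
      then show ?thesis using Suc.prems Suc.IH[of "\<lambda>x. frechet_derivative \<beta> (at x) (snd i)"] by simp
    next
      case 2
      then show ?thesis using lin by (simp add: linear_0 C_k_const)
    qed
  qed
qed

lemma integrable_C_c_inf:
  fixes M :: "(real \<times> 'a::euclidean_space) measure"
  assumes sets[measurable_cong]: "sets M = sets borel" and fin: "\<And>a b. emeasure M (box a b) < \<infinity>"
    and conc: "AE p in M. fst p \<in> {0..<T}" and \<phi>: "\<phi> \<in> C_c_inf ({0..<T} \<times> UNIV)"
  shows "integrable M \<phi>"
proof -
  obtain K R B where K: "compact K" and zero: "\<And>p. fst p \<in> {0..<T} \<Longrightarrow> p \<notin> K \<Longrightarrow> \<phi> p = 0"
    and B: "B \<ge> 0" "\<And>p. fst p \<in> {0..<T} \<Longrightarrow> \<bar>\<phi> p\<bar> \<le> B"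
    using C_c_infE[OF \<phi>] by metis
  obtain a where "K \<subseteq> box (-a) a"
    using bounded_subset_box_symmetric[OF compact_imp_bounded[OF K]] by blast
  have [measurable]: "\<phi> \<in> borel_measurable M" using C_c_inf_subset_borel_measurable[OF sets] \<phi> by blast
  show ?thesis
  proof (rule Bochner_Integration.integrable_bound[where f="\<lambda>p. B * indicator (box (-a) a) p"])
    show "integrable M (\<lambda>p. B * indicator (box (-a) a) p)"
      using fin by (intro integrable_mult_right integrable_real_indicator) (auto simp: sets)
    show "AE p in M. norm (\<phi> p) \<le> norm (B * indicator (box (-a) a) p)"
      using conc
    proof eventually_elim
      case (elim p)
      then show ?case
        using zero[OF elim] B \<open>K \<subseteq> box (-a) a\<close> by (cases "p \<in> box (-a) a") auto
    qed
  qed auto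
qed

text \<open>Pushing the lateral and the initial measure forward to the Borel sets of all of
  space-time puts them on a common sigma-algebra: they can be added, and the density theorem applies
  to the sum.\<close>

definition lateral_borel :: "real \<Rightarrow> 'a::euclidean_space set \<Rightarrow> (real \<times> 'a) measure" where
  "lateral_borel T \<Omega> = distr (lateral_measure T \<Omega>) borel (\<lambda>p. p)"

definition initial_borel :: "'a::euclidean_space set \<Rightarrow> (real \<times> 'a) measure" where
  "initial_borel \<Omega> = distr (lebesgue_on \<Omega>) borel (\<lambda>x. (0, x))"

lemma sets_lateral_borel [simp, measurable_cong]: "sets (lateral_borel T \<Omega>) = sets borel"
  and sets_initial_borel [simp, measurable_cong]: "sets (initial_borel \<Omega>) = sets borel"
  by (simp_all add: lateral_borel_def initial_borel_def)

lemma measurable_initial: "(\<lambda>x. (0::real, x)) \<in> lebesgue_on \<Omega> \<rightarrow>\<^sub>M borel"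
proof -
  have "(\<lambda>x :: 'a::euclidean_space. (0::real, x)) \<in> borel_measurable lborel"
    by (auto intro!: borel_measurable_continuous_onI continuous_intros)
  then have "(\<lambda>x :: 'a. (0::real, x)) \<in> borel_measurable lebesgue"
    by (rule measurable_completion)
  then show ?thesis by (rule measurable_restrict_space1)
qed

lemma AE_lateral_borel: "AE p in lateral_borel T \<Omega>. fst p \<in> {0<..<T}"
  unfolding lateral_borel_def
proof (subst AE_distr_iff[OF measurable_ident_lateral_measure])
  have "{p. fst p \<in> {0<..<T}} = {0<..<T} \<times> (UNIV :: 'a set)" by auto
  then have "{p :: real \<times> 'a. fst p \<in> {0<..<T}} \<in> sets borel" by (auto intro!: borel_open open_Times)
  then show "{p \<in> space borel. fst p \<in> {0<..<T}} \<in> sets (borel :: (real \<times> 'a) measure)" by simp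
qed (auto simp: space_lateral_measure)

lemma AE_initial_borel: "AE p in initial_borel \<Omega>. fst p = 0"
  unfolding initial_borel_def
proof (subst AE_distr_iff[OF measurable_initial])
  have "{p. fst p = 0} = {0::real} \<times> (UNIV :: 'a set)" by auto
  moreover have "{0::real} \<times> (UNIV :: 'a set) \<in> sets borel" by (intro borel_closed closed_Times) auto
  ultimately have "{p :: real \<times> 'a. fst p = 0} \<in> sets borel" by simp
  then show "{p \<in> space borel. fst p = 0} \<in> sets (borel :: (real \<times> 'a) measure)" by simp
qed auto

lemma emeasure_lateral_borel_bounded:
  fixes \<Omega> :: "'a::euclidean_space set"
  assumes "open \<Omega>" "uniformly_lipschitz_boundary \<Omega>" and B: "bounded B" "B \<in> sets borel"
  shows "emeasure (lateral_borel T \<Omega>) B < \<infinity>"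
proof -
  obtain R where R: "\<forall>p\<in>B. norm p \<le> R" using B(1) by (auto simp: bounded_iff)
  have sub: "snd p \<in> cball 0 R" if "p \<in> B" for p
    using R that norm_snd_le[of "snd p" "fst p"] by fastforce
  have "emeasure (lateral_borel T \<Omega>) B = (\<integral>\<^sup>+p. indicator B p \<partial>lateral_borel T \<Omega>)"
    using B(2) by simp
  also have "\<dots> = (\<integral>\<^sup>+p. indicator B p \<partial>lateral_measure T \<Omega>)"
    unfolding lateral_borel_def using B(2) by (intro nn_integral_distr measurable_ident_lateral_measure) auto
  also have "\<dots> = (\<integral>\<^sup>+t. (\<integral>\<^sup>+y. indicator B (t, y) \<partial>surface_measure \<Omega>) * indicator {0<..<T} t \<partial>lborel)"
    using B(2) by (intro nn_integral_lateral_measure assms(1,2)) auto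
  also have "\<dots> \<le> (\<integral>\<^sup>+t. (\<integral>\<^sup>+y. indicator (frontier \<Omega> \<inter> cball 0 R) y \<partial>surface_measure \<Omega>) * indicator {0<..<T} t \<partial>lborel)"
    using sub by (intro nn_integral_mono mult_right_mono) (auto simp: indicator_def space_restrict_space)
  also have "\<dots> = (\<integral>\<^sup>+t. emeasure (surface_measure \<Omega>) (frontier \<Omega> \<inter> cball 0 R) * indicator {0<..<T} t \<partial>lborel)"
    by (subst nn_integral_indicator) (auto simp: sets_restrict_space)
  also have "\<dots> = emeasure (surface_measure \<Omega>) (frontier \<Omega> \<inter> cball 0 R) * emeasure lborel {0<..<T}"
    by (intro nn_integral_cmult_indicator) simp
  also have "\<dots> < \<infinity>"
  proof -
    have "emeasure lborel {0<..<T} < \<infinity>" by (cases "0 \<le> T") auto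
    then show ?thesis
      using emeasure_surface_measure_bounded[OF assms(1,2) bounded_cball borel_closed[OF closed_cball], of 0 R]
      by (simp add: ennreal_mult_less_top)
  qed
  finally show ?thesis .
qed

lemma emeasure_initial_borel_bounded:
  fixes \<Omega> :: "'a::euclidean_space set"
  assumes "open \<Omega>" and B: "bounded B" "B \<in> sets borel"
  shows "emeasure (initial_borel \<Omega>) B < \<infinity>"
proof -
  obtain R where R: "\<forall>p\<in>B. norm p \<le> R" using B(1) by (auto simp: bounded_iff)
  have sub: "x \<in> cball 0 R" if "(0, x) \<in> B" for x :: 'a
    using R that norm_snd_le[of x 0] by fastforce
  have pre: "(\<lambda>x. (0::real, x)) -` B \<inter> space (lebesgue_on \<Omega>) \<in> sets (lebesgue_on \<Omega>)"
    by (rule measurable_sets[OF measurable_initial B(2)])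
  have "emeasure (initial_borel \<Omega>) B = emeasure (lebesgue_on \<Omega>) ((\<lambda>x. (0, x)) -` B \<inter> space (lebesgue_on \<Omega>))"
    unfolding initial_borel_def using B(2) by (intro emeasure_distr measurable_initial) auto
  also have "\<dots> \<le> emeasure (lebesgue_on \<Omega>) (\<Omega> \<inter> cball 0 R)"
    using sub assms(1) by (intro emeasure_mono) (auto simp: sets_restrict_space space_restrict_space)
  also have "\<dots> = emeasure lebesgue (\<Omega> \<inter> cball 0 R)"
    using assms(1) by (intro emeasure_restrict_space) auto
  also have "\<dots> \<le> emeasure lebesgue (cball (0::'a) R)"
    by (intro emeasure_mono) auto
  also have "\<dots> < \<infinity>" using emeasure_bounded_finite[OF bounded_cball] by simp
  finally show ?thesis .
qed

lemma
  fixes \<Omega> :: "'a::euclidean_space set"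
  assumes "open \<Omega>" "uniformly_lipschitz_boundary \<Omega>" and "T > 0" and \<phi>: "\<phi> \<in> C_c_inf ({0..<T} \<times> UNIV)"
  shows integrable_lateral_borel: "integrable (lateral_borel T \<Omega>) \<phi>"
    and integrable_initial_borel: "integrable (initial_borel \<Omega>) \<phi>"
    and integrable_lateral_measure: "integrable (lateral_measure T \<Omega>) \<phi>"
    and integrable_initial: "integrable (lebesgue_on \<Omega>) (\<lambda>x. \<phi> (0, x))"
proof -
  have [measurable]: "\<phi> \<in> borel_measurable borel" by (rule C_c_inf_measurable[OF \<phi>])
  show 1: "integrable (lateral_borel T \<Omega>) \<phi>"
    using emeasure_lateral_borel_bounded[OF assms(1,2)]
    by (intro integrable_C_c_inf[OF _ _ _ \<phi>] eventually_mono[OF AE_lateral_borel]) auto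
  show 2: "integrable (initial_borel \<Omega>) \<phi>"
    using emeasure_initial_borel_bounded[OF assms(1)] \<open>T > 0\<close>
    by (intro integrable_C_c_inf[OF _ _ _ \<phi>] eventually_mono[OF AE_initial_borel]) auto
  show "integrable (lateral_measure T \<Omega>) \<phi>"
    using 1 unfolding lateral_borel_def by (subst (asm) integrable_distr_eq[OF measurable_ident_lateral_measure]) auto
  show "integrable (lebesgue_on \<Omega>) (\<lambda>x. \<phi> (0, x))"
    using 2 unfolding initial_borel_def by (subst (asm) integrable_distr_eq[OF measurable_initial]) auto
qed

lemma integral_lateral_borel:
  fixes f :: "real \<times> 'a::euclidean_space \<Rightarrow> real"
  assumes "f \<in> borel_measurable borel"
  shows "(\<integral>p. f p \<partial>lateral_borel T \<Omega>) = (\<integral>p. f p \<partial>lateral_measure T \<Omega>)"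
    and "(\<integral>p. f p \<partial>initial_borel \<Omega>) = (\<integral>x. f (0, x) \<partial>lebesgue_on \<Omega>)"
  using assms unfolding lateral_borel_def initial_borel_def
  by (simp_all add: integral_distr measurable_ident_lateral_measure measurable_initial)

section \<open>Boundary layers\<close>

lemma borel_measurable_lebesgue_on:
  fixes f :: "'a::euclidean_space \<Rightarrow> 'b::euclidean_space"
  shows "f \<in> borel_measurable borel \<Longrightarrow> f \<in> borel_measurable (lebesgue_on S)"
  by (intro measurable_restrict_space1 measurable_completion) simp

lemma integrable_lebesgue_on_indicator:
  fixes B S :: "'a::euclidean_space set"
  assumes "bounded B" "B \<in> sets borel" "S \<in> sets borel"
  shows "integrable (lebesgue_on S) (indicator B :: 'a \<Rightarrow> real)"
proof -
  have "(\<integral>\<^sup>+x. ennreal (norm (indicator B x :: real)) \<partial>lebesgue_on S) = (\<integral>\<^sup>+x. indicator B x \<partial>lebesgue_on S)"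
    by (intro nn_integral_cong) (simp add: indicator_def)
  also have "\<dots> = (\<integral>\<^sup>+x. indicator B x * indicator S x \<partial>lborel)"
    using assms by (intro nn_integral_lebesgue_on) auto
  also have "\<dots> \<le> (\<integral>\<^sup>+x. indicator B x \<partial>lborel)"
    by (intro nn_integral_mono) (simp add: indicator_def)
  also have "\<dots> = emeasure lborel B"
    using assms(2) by simp
  also have "\<dots> < \<infinity>" using emeasure_bounded_finite[OF assms(1)] by simp
  finally show ?thesis
    unfolding integrable_iff_bounded using assms(2) by (auto intro: borel_measurable_lebesgue_on)
qed

text \<open>Uniform continuity gives the error \<open>\<kappa>\<close>, confined to a ball so that
  it remains integrable over an unbounded boundary. If \<open>norm x \<ge> R\<close> the left side
  vanishes; otherwise \<open>d \<le> 1\<close> places \<open>y\<close> in the ball of radius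
  \<open>R + 1\<close>.\<close>

lemma C_c_inf_uniform:
  fixes \<phi> :: "real \<times> 'a::euclidean_space \<Rightarrow> real"
  assumes \<phi>: "\<phi> \<in> C_c_inf ({0..<T} \<times> UNIV)" and R: "\<And>t x. t \<in> {0..<T} \<Longrightarrow> norm x \<ge> R \<Longrightarrow> \<phi> (t, x) = 0"
    and \<kappa>: "\<kappa> > 0"
  obtains d where "d > 0" "\<And>t s x y. t \<in> {0..<T} \<Longrightarrow> s \<in> {0..<T} \<Longrightarrow> \<bar>t - s\<bar> < d \<Longrightarrow> dist x y < d \<Longrightarrow>
      \<bar>\<phi> (t, x)\<bar> \<le> \<bar>\<phi> (s, y)\<bar> + \<kappa> * indicator (cball 0 (R + 1)) y"
proof -
  let ?Q = "{0..T} \<times> cball (0::'a) (R + 1)"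
  have "uniformly_continuous_on ?Q \<phi>"
    by (intro compact_uniformly_continuous C_c_inf_continuous[OF \<phi>] compact_Times) auto
  then obtain d0 where d0: "d0 > 0" "\<And>p q. p \<in> ?Q \<Longrightarrow> q \<in> ?Q \<Longrightarrow> dist p q < d0 \<Longrightarrow> dist (\<phi> p) (\<phi> q) < \<kappa>"
    using \<kappa> unfolding uniformly_continuous_on_def by metis
  define d where "d = min 1 (d0 / 2)"
  show ?thesis
  proof (rule that[of d])
    show "d > 0" using d0 by (simp add: d_def)
    fix t s :: real and x y :: 'a
    assume ts: "t \<in> {0..<T}" "s \<in> {0..<T}" and t: "\<bar>t - s\<bar> < d" and xy: "dist x y < d"
    show "\<bar>\<phi> (t, x)\<bar> \<le> \<bar>\<phi> (s, y)\<bar> + \<kappa> * indicator (cball 0 (R + 1)) y"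
    proof (cases "norm x \<ge> R")
      case True
      then show ?thesis using R[OF ts(1)] \<kappa> by (simp add: indicator_def)
    next
      case False
      have "norm y \<le> norm x + dist x y"
        using norm_triangle_ineq2[of y x] by (simp add: dist_norm norm_minus_commute)
      then have ny: "norm y \<le> R + 1" using False xy by (simp add: d_def)
      have "dist (t, x) (s, y) \<le> \<bar>t - s\<bar> + dist x y"
        using norm_Pair_le[of "t - s" "x - y"] by (simp add: dist_norm)
      then have "dist (t, x) (s, y) < d0" using t xy by (simp add: d_def)
      then have "dist (\<phi> (t, x)) (\<phi> (s, y)) < \<kappa>"
        using ts ny False by (intro d0(2)) auto
      then show ?thesis using ny by (simp add: dist_real_def indicator_def)
    qed
  qed
qed

lemma eventually_inverse_Suc_less: "e > 0 \<Longrightarrow> \<forall>\<^sub>F n in sequentially. 2 / real (Suc n) < e"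
proof -
  assume e: "e > 0"
  have "\<forall>\<^sub>F n in sequentially. 2 / e < real n"
    using filterlim_real_sequentially by (simp add: filterlim_at_top_dense)
  then show ?thesis
  proof eventually_elim
    case (elim n)
    then have "2 / e < real (Suc n)" by simp
    then show ?case using e by (simp only: divide_less_eq mult.commute split: if_splits) auto
  qed
qed

text \<open>The derivative of the time cutoff lives on \<open>[1 / N, 2 / N]\<close>, whose length
  cancels the factor \<open>N\<close>. On this interval \<open>\<phi> (t, x)\<close> is replaced by
  \<open>\<phi> (0, x)\<close> up to \<open>\<kappa>\<close>.\<close>

lemma time_layer_bound:
  fixes \<phi> :: "real \<times> 'a::euclidean_space \<Rightarrow> real"
  assumes T: "T > 0" and \<Omega>: "\<Omega> \<in> sets borel"
    and \<phi>: "\<phi> \<in> C_c_inf ({0..<T} \<times> UNIV)" and R: "\<And>t x. t \<in> {0..<T} \<Longrightarrow> norm x \<ge> R \<Longrightarrow> \<phi> (t, x) = 0"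
    and D: "\<And>t. \<bar>step' t\<bar> \<le> D" and \<kappa>: "\<kappa> > 0"
  shows "\<forall>\<^sub>F n in sequentially.
    (\<integral>\<^sup>+p. ennreal (\<bar>\<phi> p\<bar> * (real (Suc n) * \<bar>step' (real (Suc n) * fst p - 1)\<bar>)) \<partial>lebesgue_on ({0<..<T} \<times> \<Omega>))
    \<le> ennreal D * (\<integral>\<^sup>+x. ennreal (\<bar>\<phi> (0, x)\<bar> + \<kappa> * indicator (cball 0 (R + 1)) x) \<partial>lebesgue_on \<Omega>)"
proof -
  obtain d where d: "d > 0" and uc: "\<And>t s x y. t \<in> {0..<T} \<Longrightarrow> s \<in> {0..<T} \<Longrightarrow> \<bar>t - s\<bar> < d \<Longrightarrow> dist x y < d \<Longrightarrow>
      \<bar>\<phi> (t, x)\<bar> \<le> \<bar>\<phi> (s, y)\<bar> + \<kappa> * indicator (cball 0 (R + 1)) y"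
    using C_c_inf_uniform[OF \<phi> R \<kappa>] by metis
  have D0: "D \<ge> 0" using D[of 0] by linarith
  have [measurable]: "\<phi> \<in> borel_measurable borel" "step' \<in> borel_measurable borel"
    using C_c_inf_measurable[OF \<phi>] C_k_continuous[OF C_k_step'[of 0]] by (auto intro: borel_measurable_continuous_onI)
  have fst_b[measurable]: "fst \<in> (borel :: (real \<times> 'a) measure) \<rightarrow>\<^sub>M borel"
    by (intro borel_measurable_continuous_onI continuous_intros)
  have pair_b[measurable]: "(\<lambda>x. (t, x)) \<in> (borel :: 'a measure) \<rightarrow>\<^sub>M borel" for t :: real
    by (intro borel_measurable_continuous_onI continuous_intros)
  have [measurable]: "cball 0 (R + 1) \<in> sets (borel :: 'a measure)" "\<Omega> \<in> sets borel" by (simp_all add: \<Omega>)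
  define J where "J = (\<integral>\<^sup>+x. ennreal (\<bar>\<phi> (0, x)\<bar> + \<kappa> * indicator (cball 0 (R + 1)) x) \<partial>lebesgue_on \<Omega>)"
  have J_eq: "J = (\<integral>\<^sup>+x. ennreal (\<bar>\<phi> (0, x)\<bar> + \<kappa> * indicator (cball 0 (R + 1)) x) * indicator \<Omega> x \<partial>lborel)"
    unfolding J_def by (intro nn_integral_lebesgue_on \<Omega>) measurable
  have "\<forall>\<^sub>F n in sequentially. 2 / real (Suc n) < min d T"
    using d T by (intro eventually_inverse_Suc_less) auto
  then show ?thesis
  proof eventually_elim
    case (elim n)
    let ?N = "real (Suc n)"
    let ?I = "{1 / ?N .. 2 / ?N}"
    have "(\<integral>\<^sup>+p. ennreal (\<bar>\<phi> p\<bar> * (?N * \<bar>step' (?N * fst p - 1)\<bar>)) \<partial>lebesgue_on ({0<..<T} \<times> \<Omega>))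
        = (\<integral>\<^sup>+t. (\<integral>\<^sup>+x. ennreal (\<bar>\<phi> (t, x)\<bar> * (?N * \<bar>step' (?N * t - 1)\<bar>)) * indicator \<Omega> x \<partial>lborel)
            * indicator {0<..<T} t \<partial>lborel)"
      by (subst nn_integral_lebesgue_on_Times[OF _ \<Omega>]) simp_all
    also have "\<dots> \<le> (\<integral>\<^sup>+t. (ennreal (?N * D) * J) * indicator ?I t \<partial>lborel)"
    proof (rule nn_integral_mono)
      fix t :: real
      show "(\<integral>\<^sup>+x. ennreal (\<bar>\<phi> (t, x)\<bar> * (?N * \<bar>step' (?N * t - 1)\<bar>)) * indicator \<Omega> x \<partial>lborel)
            * indicator {0<..<T} t \<le> (ennreal (?N * D) * J) * indicator ?I t"
      proof (cases "t \<in> ?I \<and> t \<in> {0<..<T}")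
        case False
        have "step' (?N * t - 1) = 0" if "t \<notin> ?I"
        proof (rule step'_eq_0)
          have "t < 1 / ?N \<or> t > 2 / ?N" using that by auto
          then show "?N * t - 1 < 0 \<or> 1 < ?N * t - 1"
            by (simp add: pos_less_divide_eq pos_divide_less_eq mult.commute)
        qed
        then show ?thesis using False by (cases "t \<in> ?I") simp_all
      next
        case True
        have t: "t \<in> {0..<T}" "\<bar>t - 0\<bar> < d" using True elim by auto
        have "(\<integral>\<^sup>+x. ennreal (\<bar>\<phi> (t, x)\<bar> * (?N * \<bar>step' (?N * t - 1)\<bar>)) * indicator \<Omega> x \<partial>lborel)
            \<le> (\<integral>\<^sup>+x. ennreal (?N * D) * (ennreal (\<bar>\<phi> (0, x)\<bar> + \<kappa> * indicator (cball 0 (R + 1)) x) * indicator \<Omega> x) \<partial>lborel)"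
        proof (rule nn_integral_mono)
          fix x :: 'a
          have "\<bar>\<phi> (t, x)\<bar> \<le> \<bar>\<phi> (0, x)\<bar> + \<kappa> * indicator (cball 0 (R + 1)) x"
            using t T d by (intro uc) auto
          then have "\<bar>\<phi> (t, x)\<bar> * (?N * \<bar>step' (?N * t - 1)\<bar>)
              \<le> (\<bar>\<phi> (0, x)\<bar> + \<kappa> * indicator (cball 0 (R + 1)) x) * (?N * D)"
            using D \<kappa> D0 by (intro mult_mono mult_left_mono) auto
          then have "ennreal (\<bar>\<phi> (t, x)\<bar> * (?N * \<bar>step' (?N * t - 1)\<bar>))
              \<le> ennreal ((?N * D) * (\<bar>\<phi> (0, x)\<bar> + \<kappa> * indicator (cball 0 (R + 1)) x))"
            by (intro ennreal_leI) (simp only: mult.commute)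
          also have "\<dots> = ennreal (?N * D) * ennreal (\<bar>\<phi> (0, x)\<bar> + \<kappa> * indicator (cball 0 (R + 1)) x)"
            using D0 \<kappa> by (intro ennreal_mult) auto
          finally show "ennreal (\<bar>\<phi> (t, x)\<bar> * (?N * \<bar>step' (?N * t - 1)\<bar>)) * indicator \<Omega> x
              \<le> ennreal (?N * D) * (ennreal (\<bar>\<phi> (0, x)\<bar> + \<kappa> * indicator (cball 0 (R + 1)) x) * indicator \<Omega> x)"
            unfolding mult.assoc[symmetric] by (rule mult_right_mono) simp
        qed
        also have "\<dots> = ennreal (?N * D) * J"
          unfolding J_eq using \<Omega> by (intro nn_integral_cmult) measurable
        finally show ?thesis using True by simp
      qed
    qed
    also have "\<dots> = (ennreal (?N * D) * J) * emeasure lborel ?I"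
      by (intro nn_integral_cmult_indicator) simp
    also have "emeasure lborel ?I = ennreal (1 / ?N)"
      by (subst emeasure_lborel_Icc) (auto simp: divide_right_mono diff_divide_distrib[symmetric])
    also have "(ennreal (?N * D) * J) * ennreal (1 / ?N) = (ennreal (?N * D) * ennreal (1 / ?N)) * J"
      by (simp only: mult_ac)
    also have "ennreal (?N * D) * ennreal (1 / ?N) = ennreal ((?N * D) * (1 / ?N))"
      using D0 by (intro ennreal_mult[symmetric]) auto
    also have "(?N * D) * (1 / ?N) = D" by simp
    finally show ?case unfolding J_def .
  qed
qed

text \<open>The estimate of \<open>tube_bound\<close> is applied on every time slice, with the slice
  of \<open>\<phi>\<close> as \<open>g\<close> and its boundary values enlarged by
  \<open>\<kappa>\<close> as \<open>h\<close>. The constant comes before the test function,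
  \<open>T\<close>, \<open>R\<close> and \<open>\<kappa>\<close>; only the starting index depends on
  them.\<close>

lemma boundary_layer_bound:
  fixes \<Omega> :: "'a::euclidean_space set"
  assumes "open \<Omega>" "uniformly_lipschitz_boundary \<Omega>"
  obtains K where "K > 0"
    "\<And>T \<phi> R \<kappa>. \<phi> \<in> C_c_inf ({0..<T} \<times> UNIV) \<Longrightarrow> (\<And>t x. t \<in> {0..<T} \<Longrightarrow> norm x \<ge> R \<Longrightarrow> \<phi> (t, x) = 0) \<Longrightarrow>
      \<kappa> > 0 \<Longrightarrow> \<forall>\<^sub>F n in sequentially.
      (\<integral>\<^sup>+p. ennreal \<bar>\<phi> p\<bar> * indicator {x. \<exists>y\<in>frontier \<Omega>. dist x y < 1 / real (Suc n)} (snd p)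
          \<partial>lebesgue_on ({0<..<T} \<times> \<Omega>))
      \<le> ennreal (K / real (Suc n)) *
        (\<integral>\<^sup>+p. ennreal (\<bar>\<phi> p\<bar> + \<kappa> * indicator ({0..T} \<times> cball 0 (R + 1)) p) \<partial>lateral_measure T \<Omega>)"
proof -
  show ?thesis
  proof (rule tube_bound[OF assms])
  fix K0 \<epsilon> :: real assume K0: "K0 > 0" and \<epsilon>: "\<epsilon> > 0"
    and tube: "\<And>\<rho> g h. 0 < \<rho> \<Longrightarrow> \<rho> \<le> \<epsilon> \<Longrightarrow> g \<in> borel_measurable borel \<Longrightarrow> h \<in> borel_measurable borel \<Longrightarrow>
      (\<And>x y. y \<in> frontier \<Omega> \<Longrightarrow> dist x y < \<rho> \<Longrightarrow> g x \<le> h y) \<Longrightarrow>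
      (\<integral>\<^sup>+x. g x * indicator {x. \<exists>y\<in>frontier \<Omega>. dist x y < \<rho> / 2} x \<partial>lborel)
        \<le> ennreal (K0 * \<rho>) * (\<integral>\<^sup>+y. h y \<partial>surface_measure \<Omega>)"
  show ?thesis
  proof (rule that[of "2 * K0"])
    fix T :: real and \<phi> :: "real \<times> 'a \<Rightarrow> real" and R \<kappa> :: real
    assume \<phi>: "\<phi> \<in> C_c_inf ({0..<T} \<times> UNIV)" and R: "\<And>t x. t \<in> {0..<T} \<Longrightarrow> norm x \<ge> R \<Longrightarrow> \<phi> (t, x) = 0"
      and \<kappa>: "\<kappa> > 0"
    obtain d where d: "d > 0" and uc: "\<And>t s x y. t \<in> {0..<T} \<Longrightarrow> s \<in> {0..<T} \<Longrightarrow> \<bar>t - s\<bar> < d \<Longrightarrow> dist x y < d \<Longrightarrow>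
        \<bar>\<phi> (t, x)\<bar> \<le> \<bar>\<phi> (s, y)\<bar> + \<kappa> * indicator (cball 0 (R + 1)) y"
      using C_c_inf_uniform[OF \<phi> R \<kappa>] by metis
    have \<phi>_b[measurable]: "\<phi> \<in> borel_measurable borel" by (rule C_c_inf_measurable[OF \<phi>])
    have snd_b[measurable]: "snd \<in> (borel :: (real \<times> 'a) measure) \<rightarrow>\<^sub>M borel"
      by (intro borel_measurable_continuous_onI continuous_intros)
    have pair_b[measurable]: "(\<lambda>x. (t, x)) \<in> (borel :: 'a measure) \<rightarrow>\<^sub>M borel" for t :: real
      by (intro borel_measurable_continuous_onI continuous_intros)
    have Q: "{0..T} \<times> cball (0::'a) (R + 1) \<in> sets borel"
      by (intro borel_closed closed_Times) auto
    define h where "h p = ennreal (\<bar>\<phi> p\<bar> + \<kappa> * indicator ({0..T} \<times> cball 0 (R + 1)) p)" for p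
    have h_b: "h \<in> borel_measurable borel" unfolding h_def[abs_def] using Q by measurable
    have "\<forall>\<^sub>F n in sequentially. 2 / real (Suc n) < min d \<epsilon>"
      using d \<epsilon> by (intro eventually_inverse_Suc_less) auto
    then show "\<forall>\<^sub>F n in sequentially.
        (\<integral>\<^sup>+p. ennreal \<bar>\<phi> p\<bar> * indicator {x. \<exists>y\<in>frontier \<Omega>. dist x y < 1 / real (Suc n)} (snd p)
          \<partial>lebesgue_on ({0<..<T} \<times> \<Omega>))
        \<le> ennreal (2 * K0 / real (Suc n)) *
          (\<integral>\<^sup>+p. ennreal (\<bar>\<phi> p\<bar> + \<kappa> * indicator ({0..T} \<times> cball 0 (R + 1)) p) \<partial>lateral_measure T \<Omega>)"
    proof eventually_elim
      case (elim n)
      \<comment> \<open>Twice the layer width, because \<open>tube_bound\<close> with radius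
        \<open>\<rho>\<close> controls the layer of width \<open>\<rho> / 2\<close>. This is the
        factor in \<open>2 * K0\<close>.\<close>
      define \<rho> where "\<rho> = 2 / real (Suc n)"
      have \<rho>: "0 < \<rho>" "\<rho> \<le> \<epsilon>" "\<rho> < d" "\<rho> / 2 = 1 / real (Suc n)"
        using elim by (auto simp: \<rho>_def simp del: of_nat_Suc)
      define W where "W = {x. \<exists>y\<in>frontier \<Omega>. dist x y < \<rho> / 2}"
      have "W = (\<Union>y\<in>frontier \<Omega>. ball y (\<rho> / 2))" by (auto simp: W_def dist_commute)
      then have W[measurable]: "W \<in> sets borel" by (auto intro: borel_open)
      have "(\<integral>\<^sup>+p. ennreal \<bar>\<phi> p\<bar> * indicator W (snd p) \<partial>lebesgue_on ({0<..<T} \<times> \<Omega>))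
          = (\<integral>\<^sup>+t. (\<integral>\<^sup>+x. (ennreal \<bar>\<phi> (t, x)\<bar> * indicator W x) * indicator \<Omega> x \<partial>lborel) * indicator {0<..<T} t \<partial>lborel)"
        by (subst nn_integral_lebesgue_on_Times) (use assms(1) in simp_all)
      also have "\<dots> \<le> (\<integral>\<^sup>+t. ennreal (K0 * \<rho>) * ((\<integral>\<^sup>+y. h (t, y) \<partial>surface_measure \<Omega>) * indicator {0<..<T} t) \<partial>lborel)"
      proof (rule nn_integral_mono)
        fix t :: real
        show "(\<integral>\<^sup>+x. (ennreal \<bar>\<phi> (t, x)\<bar> * indicator W x) * indicator \<Omega> x \<partial>lborel) * indicator {0<..<T} t
            \<le> ennreal (K0 * \<rho>) * ((\<integral>\<^sup>+y. h (t, y) \<partial>surface_measure \<Omega>) * indicator {0<..<T} t)"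
        proof (cases "t \<in> {0<..<T}")
          case True
          have "(\<integral>\<^sup>+x. (ennreal \<bar>\<phi> (t, x)\<bar> * indicator W x) * indicator \<Omega> x \<partial>lborel)
              \<le> (\<integral>\<^sup>+x. ennreal \<bar>\<phi> (t, x)\<bar> * indicator W x \<partial>lborel)"
            by (intro nn_integral_mono) (simp add: indicator_def)
          also have "\<dots> \<le> ennreal (K0 * \<rho>) * (\<integral>\<^sup>+y. h (t, y) \<partial>surface_measure \<Omega>)"
            unfolding W_def
          proof (rule tube[OF \<rho>(1,2)])
            show "(\<lambda>y. h (t, y)) \<in> borel_measurable borel"
              using measurable_compose[OF pair_b h_b] .
            show "(\<lambda>x. ennreal \<bar>\<phi> (t, x)\<bar>) \<in> borel_measurable borel"
              using measurable_compose[OF pair_b \<phi>_b, of t] by measurable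
            fix x y :: 'a assume xy: "dist x y < \<rho>"
            have "\<bar>t - t\<bar> < d" "dist x y < d" "t \<in> {0..<T}" using d xy \<rho>(3) True by simp_all
            then have "\<bar>\<phi> (t, x)\<bar> \<le> \<bar>\<phi> (t, y)\<bar> + \<kappa> * indicator (cball 0 (R + 1)) y"
              by (intro uc)
            then show "ennreal \<bar>\<phi> (t, x)\<bar> \<le> h (t, y)"
              unfolding h_def using True by (intro ennreal_leI) (auto simp: indicator_def)
          qed
          finally show ?thesis using True by simp
        qed simp
      qed
      also have "\<dots> = ennreal (K0 * \<rho>) * (\<integral>\<^sup>+t. (\<integral>\<^sup>+y. h (t, y) \<partial>surface_measure \<Omega>) * indicator {0<..<T} t \<partial>lborel)"
      proof (rule nn_integral_cmult)
        interpret S: sigma_finite_measure "surface_measure \<Omega>" by (rule sigma_finite_surface_measure[OF assms])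
        have "(\<lambda>p. (fst p, snd p)) \<in> (lborel :: real measure) \<Otimes>\<^sub>M surface_measure \<Omega> \<rightarrow>\<^sub>M borel"
          using measurable_compose[OF measurable_snd measurable_ident_surface_measure]
            measurable_fst[of "lborel :: real measure" "surface_measure \<Omega>"] by (intro borel_measurable_Pair) auto
        then have "(\<lambda>p. h (fst p, snd p)) \<in> borel_measurable ((lborel :: real measure) \<Otimes>\<^sub>M surface_measure \<Omega>)"
          by (rule measurable_compose[OF _ h_b])
        then have "h \<in> borel_measurable ((lborel :: real measure) \<Otimes>\<^sub>M surface_measure \<Omega>)" by simp
        then have "(\<lambda>t. \<integral>\<^sup>+y. h (t, y) \<partial>surface_measure \<Omega>) \<in> borel_measurable lborel"
          by (rule S.borel_measurable_nn_integral_fst)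
        then show "(\<lambda>t. (\<integral>\<^sup>+y. h (t, y) \<partial>surface_measure \<Omega>) * indicator {0<..<T} t) \<in> borel_measurable lborel"
          by simp
      qed
      also have "\<dots> = ennreal (K0 * \<rho>) * (\<integral>\<^sup>+p. h p \<partial>lateral_measure T \<Omega>)"
        by (simp only: nn_integral_lateral_measure[OF assms h_b])
      also have "K0 * \<rho> = 2 * K0 / real (Suc n)" by (simp add: \<rho>_def)
      finally show ?case unfolding h_def W_def \<rho>(4) .
    qed
  qed (use K0 in simp)
  qed
qed

section \<open>Bounded space-time fields and the estimate of the boundary functional\<close>

locale bounded_field =
  fixes T :: real and \<Omega> :: "'a::euclidean_space set" and w :: "real \<times> 'a \<Rightarrow> real" and v :: "real \<times> 'a \<Rightarrow> 'a"
    and Cw Cv :: real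
  assumes T: "T > 0" and open_\<Omega>: "open \<Omega>" and lip: "uniformly_lipschitz_boundary \<Omega>"
    and w: "w \<in> borel_measurable (lebesgue_on ({0<..<T} \<times> \<Omega>))" "AE p in lebesgue_on ({0<..<T} \<times> \<Omega>). \<bar>w p\<bar> \<le> Cw"
    and v: "v \<in> borel_measurable (lebesgue_on ({0<..<T} \<times> \<Omega>))" "AE p in lebesgue_on ({0<..<T} \<times> \<Omega>). norm (v p) \<le> Cv"
    and Cw: "Cw \<ge> 0" and Cv: "Cv \<ge> 0"
begin

abbreviation S :: "(real \<times> 'a) set" where "S \<equiv> {0<..<T} \<times> \<Omega>"
abbreviation V :: "(real \<times> 'a \<Rightarrow> real) set" where "V \<equiv> C_c_inf ({0..<T} \<times> UNIV)"

definition action :: "(real \<times> 'a \<Rightarrow> real) \<Rightarrow> real \<times> 'a \<Rightarrow> real" where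
  "action \<phi> p = w p * time_deriv \<phi> p + v p \<bullet> space_grad \<phi> p"

lemma S_borel: "S \<in> sets borel"
  using open_\<Omega> by (intro borel_open open_Times) auto

lemma action_eq: "\<phi> differentiable (at p) \<Longrightarrow> action \<phi> p = frechet_derivative \<phi> (at p) (w p, v p)"
  by (simp add: action_def transport_eq_frechet_derivative)

lemma action_measurable:
  assumes \<phi>: "\<phi> \<in> C_c_inf A"
  shows "action \<phi> \<in> borel_measurable (lebesgue_on S)"
proof -
  have "continuous_on UNIV (time_deriv \<phi>)"
    unfolding time_deriv_def[abs_def] by (rule C_c_inf_derivative_continuous[OF \<phi>]) (simp add: Basis_prod_def)
  moreover have "continuous_on UNIV (space_grad \<phi>)"
    unfolding space_grad_def[abs_def]
    by (intro continuous_intros C_c_inf_derivative_continuous[OF \<phi>]) (simp add: Basis_prod_def)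
  ultimately have "time_deriv \<phi> \<in> borel_measurable (lebesgue_on S)" "space_grad \<phi> \<in> borel_measurable (lebesgue_on S)"
    by (auto intro: borel_measurable_lebesgue_on borel_measurable_continuous_onI)
  then show ?thesis
    unfolding action_def[abs_def] using w(1) v(1) by measurable
qed

lemma action_bound:
  assumes \<phi>: "\<phi> \<in> V"
  obtains K B where "compact K" "B \<ge> 0" "AE p in lebesgue_on S. \<bar>action \<phi> p\<bar> \<le> B * indicator K p"
proof -
  obtain K R B where K: "compact K" "B \<ge> 0"
    and zero: "\<And>p h. fst p \<in> {0<..<T} \<Longrightarrow> p \<notin> K \<Longrightarrow> frechet_derivative \<phi> (at p) h = 0"
    and B: "\<And>p h. p \<in> K \<Longrightarrow> \<bar>frechet_derivative \<phi> (at p) h\<bar> \<le> B * norm h"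
    using C_c_infE[OF \<phi>] by metis
  have "AE p in lebesgue_on S. \<bar>action \<phi> p\<bar> \<le> (B * (Cw + Cv)) * indicator K p"
    using w(2) v(2) AE_space
  proof eventually_elim
    case (elim p)
    then have p: "fst p \<in> {0<..<T}" by (auto simp: space_restrict_space)
    show ?case
    proof (cases "p \<in> K")
      case True
      have "\<bar>action \<phi> p\<bar> \<le> B * norm (w p, v p)"
        unfolding action_eq[OF C_c_inf_differentiable[OF \<phi>]] by (rule B[OF True])
      also have "\<dots> \<le> B * (Cw + Cv)"
        using norm_Pair_le[of "w p" "v p"] elim(1,2) K(2) by (intro mult_left_mono) auto
      finally show ?thesis using True by simp
    next
      case False
      then show ?thesis
        using zero[OF p False] by (simp add: action_eq[OF C_c_inf_differentiable[OF \<phi>]])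
    qed
  qed
  moreover have "B * (Cw + Cv) \<ge> 0" using K Cw Cv by simp
  ultimately show ?thesis using that K(1) by blast
qed

lemma action_integrable:
  assumes \<phi>: "\<phi> \<in> V"
  shows "integrable (lebesgue_on S) (action \<phi>)"
proof -
  obtain K B where K: "compact K" and B: "B \<ge> 0" and bd: "AE p in lebesgue_on S. \<bar>action \<phi> p\<bar> \<le> B * indicator K p"
    using action_bound[OF \<phi>] by blast
  show ?thesis
  proof (rule Bochner_Integration.integrable_bound)
    show "integrable (lebesgue_on S) (\<lambda>p. B * indicator K p)"
      using K S_borel
      by (intro integrable_mult_right integrable_lebesgue_on_indicator) (auto intro: compact_imp_bounded borel_compact)
    show "AE p in lebesgue_on S. norm (action \<phi> p) \<le> norm (B * indicator K p)"
      using bd by eventually_elim (use B in simp)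
  qed (rule action_measurable[OF \<phi>])
qed

end

text \<open>Here \<open>G\<close> stands for the source term: the integral against the signed
  measure in the first claim, against \<open>f\<close> in the second. \<open>G_conv\<close> is
  dominated convergence, phrased for functions obtained from \<open>\<phi>\<close> by a
  cutoff.\<close>

locale weak_balance = bounded_field +
  fixes G :: "(real \<times> 'a \<Rightarrow> real) \<Rightarrow> real"
  assumes G_conv: "\<phi> \<in> V \<Longrightarrow> (\<And>n. \<eta> n \<in> borel_measurable borel) \<Longrightarrow>
      (\<And>n p. p \<in> S \<Longrightarrow> \<bar>\<eta> n p\<bar> \<le> \<bar>\<phi> p\<bar>) \<Longrightarrow>
      (\<And>p. p \<in> S \<Longrightarrow> (\<lambda>n::nat. \<eta> n p) \<longlonglongrightarrow> \<phi> p) \<Longrightarrow> (\<lambda>n. G (\<eta> n)) \<longlonglongrightarrow> G \<phi>"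
    and weak: "\<psi> \<in> C_c_inf S \<Longrightarrow> (\<integral>p. action \<psi> p \<partial>lebesgue_on S) + G \<psi> = 0"
    and G_add: "\<phi> \<in> V \<Longrightarrow> \<phi>' \<in> V \<Longrightarrow> G (\<lambda>p. \<phi> p + \<phi>' p) = G \<phi> + G \<phi>'"
    and G_scale: "\<phi> \<in> V \<Longrightarrow> G (\<lambda>p. c * \<phi> p) = c * G \<phi>"

context weak_balance
begin

text \<open>For \<open>\<phi>\<close> times a cutoff the balance is zero, so the functional at
  \<open>\<phi>\<close> is, up to sign, the limit of the integrals of \<open>\<phi>\<close> times
  the derivative of the cutoff along the field. The time part of that derivative is multiplied by
  \<open>w\<close> and the space part by \<open>v\<close>, whence one constant for each part of the
  boundary.\<close>

theorem action_functional_bound: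
  obtains D K where "D \<ge> 0" "K \<ge> 0"
    "\<And>\<phi>. \<phi> \<in> V \<Longrightarrow> \<bar>(\<integral>p. action \<phi> p \<partial>lebesgue_on S) + G \<phi>\<bar>
      \<le> Cw * D * (\<integral>x. \<bar>\<phi> (0, x)\<bar> \<partial>lebesgue_on \<Omega>) + Cv * K * (\<integral>p. \<bar>\<phi> p\<bar> \<partial>lateral_measure T \<Omega>)"
proof -
  obtain D where D0: "D \<ge> 0" and D: "\<And>t. \<bar>step' t\<bar> \<le> D" using step'_bounded by blast
  show ?thesis
  proof (rule cutoff_exists[where 'a='a], rule boundary_layer_bound[OF open_\<Omega> lip])
    fix C K0 :: real
    assume C: "C > 0" and K0: "K0 > 0"
      and cut: "\<And>(\<Omega> :: 'a set) R \<delta>. \<delta> > 0 \<Longrightarrow>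
      \<exists>\<beta>. (\<forall>k. C_k k \<beta>) \<and> (\<forall>x. 0 \<le> \<beta> x \<and> \<beta> x \<le> 1) \<and>
        (\<exists>K. compact K \<and> K \<subseteq> \<Omega> \<and> (\<forall>x. x \<notin> K \<longrightarrow> \<beta> x = 0)) \<and>
        (\<forall>x. norm x < R \<longrightarrow> ball x \<delta> \<subseteq> \<Omega> \<longrightarrow> \<beta> x = 1) \<and>
        (\<forall>x y. \<bar>frechet_derivative \<beta> (at x) y\<bar> \<le> C / \<delta> * norm y) \<and>
        (\<forall>x y. x \<in> \<Omega> \<longrightarrow> norm x < R \<longrightarrow> frechet_derivative \<beta> (at x) y \<noteq> 0 \<longrightarrow>
          (\<exists>z\<in>frontier \<Omega>. dist x z < \<delta>))"
      and layer: "\<And>T \<phi> R \<kappa>. \<phi> \<in> C_c_inf ({0..<T} \<times> UNIV) \<Longrightarrow> (\<And>t x. t \<in> {0..<T} \<Longrightarrow> norm x \<ge> R \<Longrightarrow> \<phi> (t, x) = 0) \<Longrightarrow>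
      \<kappa> > 0 \<Longrightarrow> \<forall>\<^sub>F n in sequentially.
      (\<integral>\<^sup>+p. ennreal \<bar>\<phi> p\<bar> * indicator {x. \<exists>y\<in>frontier \<Omega>. dist x y < 1 / real (Suc n)} (snd p)
          \<partial>lebesgue_on ({0<..<T} \<times> \<Omega>))
      \<le> ennreal (K0 / real (Suc n)) *
        (\<integral>\<^sup>+p. ennreal (\<bar>\<phi> p\<bar> + \<kappa> * indicator ({0..T} \<times> cball 0 (R + 1)) p) \<partial>lateral_measure T \<Omega>)"
    show ?thesis
    proof (rule that[of D "C * K0"])
      fix \<phi> assume \<phi>: "\<phi> \<in> V"
      obtain K R B where K: "compact K" "K \<subseteq> {0..<T} \<times> UNIV" and R: "R > 0" and B: "B \<ge> 0"
        and zero: "\<And>p. fst p \<in> {0..<T} \<Longrightarrow> p \<notin> K \<Longrightarrow> \<phi> p = 0"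
        and KR: "\<And>p. p \<in> K \<Longrightarrow> norm (snd p) < R"
        and "\<And>p. fst p \<in> {0..<T} \<Longrightarrow> \<bar>\<phi> p\<bar> \<le> B"
        and zero': "\<And>p h. fst p \<in> {0<..<T} \<Longrightarrow> p \<notin> K \<Longrightarrow> frechet_derivative \<phi> (at p) h = 0"
        and "\<And>p h. p \<in> K \<Longrightarrow> \<bar>frechet_derivative \<phi> (at p) h\<bar> \<le> B * norm h"
        by (rule C_c_infE[OF \<phi>]) (rule that)
      have zeroR: "\<phi> (t, x) = 0" if "t \<in> {0..<T}" "norm x \<ge> R" for t x
        using zero[of "(t, x)"] KR[of "(t, x)"] that by force
      let ?L = "lebesgue_on S"
      define N where "N n = real (Suc n)" for n
      have N: "N n > 0" for n by (simp add: N_def)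
      \<comment> \<open>The cutoffs are tied to the radius \<open>R\<close> beyond which
        \<open>\<phi>\<close> vanishes, so their decay at infinity, needed for compact support, does
        not affect any integral.\<close>
      have "\<forall>n. \<exists>\<beta> :: 'a \<Rightarrow> real. (\<forall>k. C_k k \<beta>) \<and> (\<forall>x. 0 \<le> \<beta> x \<and> \<beta> x \<le> 1) \<and>
        (\<exists>K. compact K \<and> K \<subseteq> \<Omega> \<and> (\<forall>x. x \<notin> K \<longrightarrow> \<beta> x = 0)) \<and>
        (\<forall>x. norm x < R \<longrightarrow> ball x (1 / N n) \<subseteq> \<Omega> \<longrightarrow> \<beta> x = 1) \<and>
        (\<forall>x y. \<bar>frechet_derivative \<beta> (at x) y\<bar> \<le> C / (1 / N n) * norm y) \<and>
        (\<forall>x y. x \<in> \<Omega> \<longrightarrow> norm x < R \<longrightarrow> frechet_derivative \<beta> (at x) y \<noteq> 0 \<longrightarrow>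
          (\<exists>z\<in>frontier \<Omega>. dist x z < 1 / N n))"
        by (intro allI cut) (simp add: N)
      from choice[OF this] obtain \<beta> :: "nat \<Rightarrow> 'a \<Rightarrow> real" where
        \<beta>_C: "\<And>n k. C_k k (\<beta> n)" and \<beta>_01: "\<And>n x. 0 \<le> \<beta> n x" "\<And>n x. \<beta> n x \<le> 1"
        and \<beta>_supp: "\<And>n. \<exists>K. compact K \<and> K \<subseteq> \<Omega> \<and> (\<forall>x. x \<notin> K \<longrightarrow> \<beta> n x = 0)"
        and \<beta>_1: "\<And>n x. norm x < R \<Longrightarrow> ball x (1 / N n) \<subseteq> \<Omega> \<Longrightarrow> \<beta> n x = 1"
        and \<beta>_d: "\<And>n x y. \<bar>frechet_derivative (\<beta> n) (at x) y\<bar> \<le> C / (1 / N n) * norm y"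
        and \<beta>_near: "\<And>n x y. x \<in> \<Omega> \<Longrightarrow> norm x < R \<Longrightarrow> frechet_derivative (\<beta> n) (at x) y \<noteq> 0 \<Longrightarrow>
            \<exists>z\<in>frontier \<Omega>. dist x z < 1 / N n"
        by metis
      txt \<open>The cutoff \<open>\<xi> n\<close> vanishes for \<open>t \<le> 1/n\<close> and near \<open>\<partial>\<Omega>\<close>, so that \<open>\<phi> \<xi> n\<close> is admissible in the equation.\<close>
      define \<alpha> where "\<alpha> n t = step (N n * t - 1)" for n t
      define \<xi> where "\<xi> n p = \<alpha> n (fst p) * \<beta> n (snd p)" for n and p :: "real \<times> 'a"
      define \<xi>' where "\<xi>' n p h = (N n * step' (N n * fst p - 1) * fst h) * \<beta> n (snd p)
          + \<alpha> n (fst p) * frechet_derivative (\<beta> n) (at (snd p)) (snd h)" for n and p h :: "real \<times> 'a"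
      define \<eta> where "\<eta> n p = \<phi> p * \<xi> n p" for n p
      have \<alpha>_01: "0 \<le> \<alpha> n t" "\<alpha> n t \<le> 1" for n t by (simp_all add: \<alpha>_def step_bounds)
      have \<xi>_01: "0 \<le> \<xi> n p" "\<xi> n p \<le> 1" for n p
        using \<alpha>_01 \<beta>_01 by (auto simp: \<xi>_def intro!: mult_le_one)
      have \<xi>_C: "C_k k (\<xi> n)" for k n
      proof -
        have "C_k k (\<lambda>p :: real \<times> 'a. step ((N n, 0) \<bullet> p + (-1)))"
          by (rule C_k_inner_affine[OF C_k_step])
        then have "C_k k (\<lambda>p :: real \<times> 'a. \<alpha> n (fst p))"
          by (simp add: \<alpha>_def inner_prod_def)
        then show ?thesis
          unfolding \<xi>_def[abs_def] by (intro C_k_mult C_k_compose_snd \<beta>_C)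
      qed
      have \<xi>_d: "(\<xi> n has_derivative \<xi>' n p) (at p)" for n p
      proof -
        have "((\<lambda>p :: real \<times> 'a. N n * fst p - 1) has_derivative (\<lambda>h. N n * fst h)) (at p)"
          by (auto intro!: derivative_eq_intros)
        moreover have "(step has_derivative (\<lambda>h. step' (N n * fst p - 1) * h)) (at (N n * fst p - 1))"
          using step_has_real_derivative by (simp add: has_field_derivative_def)
        ultimately have 1: "((\<lambda>p :: real \<times> 'a. step (N n * fst p - 1)) has_derivative
            (\<lambda>h. step' (N n * fst p - 1) * (N n * fst h))) (at p)"
          by (rule has_derivative_compose)
        have 2: "((\<lambda>p :: real \<times> 'a. \<beta> n (snd p)) has_derivative
            (\<lambda>h. frechet_derivative (\<beta> n) (at (snd p)) (snd h))) (at p)"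
          using has_derivative_compose[OF bounded_linear_imp_has_derivative[OF bounded_linear_snd]
              C_k_has_derivative[OF \<beta>_C[of "Suc 0"]]] .
        have "(\<lambda>h. \<alpha> n (fst p) * frechet_derivative (\<beta> n) (at (snd p)) (snd h)
            + step' (N n * fst p - 1) * (N n * fst h) * \<beta> n (snd p)) = \<xi>' n p"
          by (auto simp: \<xi>'_def fun_eq_iff)
        then show ?thesis
          using has_derivative_mult[OF 1 2] unfolding \<xi>_def[abs_def] \<alpha>_def by simp
      qed
      have \<eta>_C: "C_k k (\<eta> n)" for k n
        unfolding \<eta>_def[abs_def] by (intro C_k_mult \<xi>_C C_c_inf_C_k[OF \<phi>])
      have \<eta>_V: "\<eta> n \<in> V" for n
        using \<eta>_C K zero unfolding C_c_inf_def by (auto simp: \<eta>_def intro!: exI[of _ K])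
      have \<eta>_S: "\<eta> n \<in> C_c_inf S" for n
      proof -
        obtain K\<beta> where K\<beta>: "compact K\<beta>" "K\<beta> \<subseteq> \<Omega>" "\<And>x. x \<notin> K\<beta> \<Longrightarrow> \<beta> n x = 0"
          using \<beta>_supp by blast
        \<comment> \<open>The interval is closed at \<open>T\<close> for compactness; the factor
          \<open>K\<close> already keeps the set strictly below \<open>T\<close>.\<close>
        let ?K = "K \<inter> ({1 / N n..T} \<times> K\<beta>)"
        have "compact ?K" using K(1) K\<beta>(1) by (intro compact_Int compact_Times) auto
        moreover have "?K \<subseteq> S"
        proof
          fix p assume p: "p \<in> ?K"
          then have "1 / N n \<le> fst p" "fst p < T" "snd p \<in> \<Omega>"
            using K(2) K\<beta>(2) by auto
          moreover have "0 < 1 / N n" using N[of n] by simp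
          ultimately have "0 < fst p" "fst p < T" "snd p \<in> \<Omega>" by linarith+
          then show "p \<in> S" by (simp add: mem_Times_iff)
        qed
        moreover have "\<eta> n p = 0" if "p \<in> S - ?K" for p
        proof -
          have p: "fst p \<in> {0..<T}" "0 < fst p" "fst p \<le> T" using that by auto
          have "p \<notin> K \<or> fst p < 1 / N n \<or> snd p \<notin> K\<beta>"
            using that p(3) by (auto simp: mem_Times_iff not_le)
          then consider "p \<notin> K" | "fst p < 1 / N n" | "snd p \<notin> K\<beta>" by blast
          then show ?thesis
          proof cases
            case 2
            then have "N n * fst p - 1 \<le> 0" using N[of n] by (simp add: pos_less_divide_eq mult.commute)
            then show ?thesis by (simp add: \<eta>_def \<xi>_def \<alpha>_def step_eq_0)
          qed (use zero p K\<beta>(3) in \<open>auto simp: \<eta>_def \<xi>_def\<close>)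
        qed
        ultimately show ?thesis using \<eta>_C unfolding C_c_inf_def by blast
      qed
      \<comment> \<open>The derivative of the cutoff along the field. In the product rule for
        \<open>\<eta> n\<close> it produces the only term that does not converge to an interior
        integral by dominated convergence.\<close>
      define Z where "Z n p = \<xi>' n p (w p, v p)" for n p
      have action_\<eta>: "action (\<eta> n) p = \<xi> n p * action \<phi> p + \<phi> p * Z n p" for n p
      proof -
        have "frechet_derivative (\<eta> n) (at p) = (\<lambda>h. \<phi> p * \<xi>' n p h + frechet_derivative \<phi> (at p) h * \<xi> n p)"
          unfolding \<eta>_def[abs_def]
          by (rule frechet_derivative_at[symmetric, OF has_derivative_mult[OF C_k_has_derivative[OF C_c_inf_C_k[OF \<phi>, of "Suc 0"]] \<xi>_d]])
        then show ?thesis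
          by (simp add: action_eq[OF C_c_inf_differentiable[OF \<phi>]] action_eq[OF C_c_inf_differentiable[OF \<eta>_V]] Z_def)
      qed
      have \<xi>_meas: "\<xi> n \<in> borel_measurable ?L" for n
        by (intro borel_measurable_lebesgue_on borel_measurable_continuous_onI C_k_continuous[OF \<xi>_C[of 0]])
      note act_int = action_integrable[OF \<phi>]
      have \<xi>act_int: "integrable ?L (\<lambda>p. \<xi> n p * action \<phi> p)" for n
        using \<xi>_01
        by (intro Bochner_Integration.integrable_bound[OF act_int] borel_measurable_times \<xi>_meas action_measurable[OF \<phi>])
          (auto simp: abs_mult intro!: AE_I2 mult_left_le_one_le)
      have Z_int: "integrable ?L (\<lambda>p. \<phi> p * Z n p)" for n
      proof -
        have "integrable ?L (\<lambda>p. action (\<eta> n) p - \<xi> n p * action \<phi> p)"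
          by (intro Bochner_Integration.integrable_diff action_integrable[OF \<eta>_V] \<xi>act_int)
        then show ?thesis by (simp add: action_\<eta>)
      qed
      define X where "X n = (\<integral>p. \<phi> p * Z n p \<partial>?L)" for n
      have X_eq: "X n = - G (\<eta> n) - (\<integral>p. \<xi> n p * action \<phi> p \<partial>?L)" for n
      proof -
        have "(\<integral>p. action (\<eta> n) p \<partial>?L) = (\<integral>p. \<xi> n p * action \<phi> p \<partial>?L) + X n"
          unfolding X_def action_\<eta> by (rule Bochner_Integration.integral_add[OF \<xi>act_int Z_int])
        then show ?thesis using weak[OF \<eta>_S[of n]] by simp
      qed
      have \<xi>_lim: "\<forall>\<^sub>F n in sequentially. \<xi> n p = 1" if p: "p \<in> S" "norm (snd p) < R" for p
      proof -
        have t: "fst p > 0" and x: "snd p \<in> \<Omega>" using p by auto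
        obtain r where r: "r > 0" "ball (snd p) r \<subseteq> \<Omega>" using open_\<Omega> x open_contains_ball by blast
        have "\<forall>\<^sub>F n in sequentially. 2 / N n < min (fst p) r"
          unfolding N_def using t r by (intro eventually_inverse_Suc_less) auto
        then show ?thesis
        proof eventually_elim
          case (elim n)
          have "2 < fst p * N n" using elim N[of n] by (simp add: pos_divide_less_eq)
          then have "N n * fst p - 1 \<ge> 1" by (simp add: mult.commute)
          then have "\<alpha> n (fst p) = 1" by (simp add: \<alpha>_def step_eq_1)
          moreover have "1 / N n \<le> 2 / N n" using N[of n] by (simp add: divide_right_mono)
          then have "1 / N n \<le> r" using elim by linarith
          then have "ball (snd p) (1 / N n) \<subseteq> \<Omega>" using r(2) subset_ball by blast
          then have "\<beta> n (snd p) = 1" by (rule \<beta>_1[OF p(2)])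
          ultimately show ?case by (simp add: \<xi>_def)
        qed
      qed
      have "(\<lambda>n. G (\<eta> n)) \<longlonglongrightarrow> G \<phi>"
      proof (rule G_conv[OF \<phi>])
        show "\<eta> n \<in> borel_measurable borel" for n by (rule C_c_inf_measurable[OF \<eta>_V])
        show "\<bar>\<eta> n p\<bar> \<le> \<bar>\<phi> p\<bar>" for n p
          using \<xi>_01[of n p] by (simp add: \<eta>_def abs_mult mult_left_le)
        fix p assume p: "p \<in> S"
        show "(\<lambda>n. \<eta> n p) \<longlonglongrightarrow> \<phi> p"
        proof (cases "norm (snd p) < R")
          case True
          show ?thesis
            by (rule tendsto_eventually, rule eventually_mono[OF \<xi>_lim[OF p True]]) (simp add: \<eta>_def)
        next
          case False
          then have "\<phi> p = 0" using zeroR[of "fst p" "snd p"] p by auto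
          then show ?thesis by (simp add: \<eta>_def)
        qed
      qed
      moreover have "(\<lambda>n. \<integral>p. \<xi> n p * action \<phi> p \<partial>?L) \<longlonglongrightarrow> (\<integral>p. action \<phi> p \<partial>?L)"
      proof (rule integral_dominated_convergence[where w="\<lambda>p. \<bar>action \<phi> p\<bar>"])
        show "AE p in ?L. (\<lambda>n. \<xi> n p * action \<phi> p) \<longlonglongrightarrow> action \<phi> p"
        proof (rule AE_I2)
          fix p assume "p \<in> space ?L"
          then have p: "p \<in> S" by (simp add: space_restrict_space)
          show "(\<lambda>n. \<xi> n p * action \<phi> p) \<longlonglongrightarrow> action \<phi> p"
          proof (cases "norm (snd p) < R")
            case True
            show ?thesis
              by (rule tendsto_eventually, rule eventually_mono[OF \<xi>_lim[OF p True]]) simp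
          next
            case False
            then have "p \<notin> K" using KR by blast
            moreover have "fst p \<in> {0<..<T}" using p by auto
            ultimately have "action \<phi> p = 0"
              unfolding action_eq[OF C_c_inf_differentiable[OF \<phi>]] by (intro zero')
            then show ?thesis by simp
          qed
        qed
        show "AE p in ?L. norm (\<xi> n p * action \<phi> p) \<le> \<bar>action \<phi> p\<bar>" for n
          using \<xi>_01 by (auto simp: abs_mult intro!: AE_I2 mult_left_le_one_le)
        show "(\<lambda>p. \<xi> n p * action \<phi> p) \<in> borel_measurable ?L" for n
          using \<xi>act_int by auto
      qed (use act_int in auto)
      ultimately have "(\<lambda>n. - G (\<eta> n) - (\<integral>p. \<xi> n p * action \<phi> p \<partial>?L)) \<longlonglongrightarrow> - G \<phi> - (\<integral>p. action \<phi> p \<partial>?L)"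
        by (intro tendsto_diff tendsto_minus)
      then have X_lim: "X \<longlonglongrightarrow> - G \<phi> - (\<integral>p. action \<phi> p \<partial>?L)"
        by (simp only: X_eq[symmetric])
      define a where "a = (\<integral>x. \<bar>\<phi> (0, x)\<bar> \<partial>lebesgue_on \<Omega>)"
      define a' :: real where "a' = (\<integral>x. indicator (cball 0 (R + 1)) x \<partial>lebesgue_on \<Omega>)"
      define b where "b = (\<integral>p. \<bar>\<phi> p\<bar> \<partial>lateral_measure T \<Omega>)"
      define b' :: real where "b' = (\<integral>p. indicator ({0..T} \<times> cball 0 (R + 1)) p \<partial>lateral_measure T \<Omega>)"
      have \<Omega>_b: "\<Omega> \<in> sets borel" using open_\<Omega> by auto
      have a_int: "integrable (lebesgue_on \<Omega>) (\<lambda>x. \<phi> (0, x))" "integrable (lebesgue_on \<Omega>) (indicator (cball 0 (R + 1)) :: 'a \<Rightarrow> real)"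
        using integrable_initial[OF open_\<Omega> lip T \<phi>] \<Omega>_b by (auto intro!: integrable_lebesgue_on_indicator)
      have b_int: "integrable (lateral_measure T \<Omega>) \<phi>"
        by (rule integrable_lateral_measure[OF open_\<Omega> lip T \<phi>])
      have b_int': "integrable (lateral_measure T \<Omega>) (indicator ({0..T} \<times> cball 0 (R + 1)) :: _ \<Rightarrow> real)"
      proof -
        let ?Q = "{0..T} \<times> cball (0 :: 'a) (R + 1)"
        have Q: "?Q \<in> sets borel" by (intro borel_closed closed_Times) auto
        have "integrable (lateral_borel T \<Omega>) (indicator ?Q :: _ \<Rightarrow> real)"
          using emeasure_lateral_borel_bounded[OF open_\<Omega> lip _ Q] Q
          by (intro integrable_real_indicator) (auto simp: bounded_Times)
        then show ?thesis
          unfolding lateral_borel_def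
          by (subst (asm) integrable_distr_eq[OF measurable_ident_lateral_measure]) (use Q in auto)
      qed
      have ab'_nonneg: "a' \<ge> 0" "b' \<ge> 0" by (auto simp: a'_def b'_def)
      \<comment> \<open>For each fixed \<open>\<kappa>\<close> both layer estimates hold eventually
        in \<open>n\<close>. The primed constants are the integrals of the bounded indicators that
        multiply \<open>\<kappa>\<close>.\<close>
      have bound: "\<forall>\<^sub>F n in sequentially. \<bar>X n\<bar> \<le> Cw * D * (a + \<kappa> * a') + Cv * (C * K0) * (b + \<kappa> * b')"
        if \<kappa>: "\<kappa> > 0" for \<kappa>
      proof -
        have nnA: "(\<integral>\<^sup>+x. ennreal (\<bar>\<phi> (0, x)\<bar> + \<kappa> * indicator (cball 0 (R + 1)) x) \<partial>lebesgue_on \<Omega>) = ennreal (a + \<kappa> * a')"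
          using a_int \<kappa> by (subst nn_integral_eq_integral) (auto simp: a_def a'_def)
        have nnB: "(\<integral>\<^sup>+p. ennreal (\<bar>\<phi> p\<bar> + \<kappa> * indicator ({0..T} \<times> cball 0 (R + 1)) p) \<partial>lateral_measure T \<Omega>) = ennreal (b + \<kappa> * b')"
          using b_int b_int' \<kappa> by (subst nn_integral_eq_integral) (auto simp: b_def b'_def)
        have evA: "\<forall>\<^sub>F n in sequentially.
            (\<integral>\<^sup>+p. ennreal (\<bar>\<phi> p\<bar> * (N n * \<bar>step' (N n * fst p - 1)\<bar>)) \<partial>?L) \<le> ennreal D * ennreal (a + \<kappa> * a')"
          unfolding N_def nnA[symmetric] by (rule time_layer_bound[OF T \<Omega>_b \<phi> zeroR D \<kappa>])
        have evB: "\<forall>\<^sub>F n in sequentially.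
            (\<integral>\<^sup>+p. ennreal \<bar>\<phi> p\<bar> * indicator {x. \<exists>y\<in>frontier \<Omega>. dist x y < 1 / N n} (snd p) \<partial>?L)
            \<le> ennreal (K0 / N n) * ennreal (b + \<kappa> * b')"
          unfolding N_def nnB[symmetric] by (rule layer[OF \<phi> zeroR \<kappa>])
        from evA evB show ?thesis
        proof eventually_elim
          case (elim n)
          let ?W = "{x. \<exists>y\<in>frontier \<Omega>. dist x y < 1 / N n}"
          let ?FA = "\<lambda>p. ennreal (\<bar>\<phi> p\<bar> * (N n * \<bar>step' (N n * fst p - 1)\<bar>))"
          let ?FB = "\<lambda>p. ennreal \<bar>\<phi> p\<bar> * indicator ?W (snd p)"
          have "?W = (\<Union>y\<in>frontier \<Omega>. ball y (1 / N n))" by (auto simp: dist_commute)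
          then have W: "?W \<in> sets borel" by (auto intro: borel_open)
          have FA_m: "?FA \<in> borel_measurable ?L"
          proof -
            have "continuous_on UNIV (\<lambda>p :: real \<times> 'a. \<bar>\<phi> p\<bar> * (N n * \<bar>step' (N n * fst p - 1)\<bar>))"
              by (intro continuous_intros C_c_inf_continuous[OF \<phi>] continuous_on_compose2[OF C_k_continuous[OF C_k_step'[of 0]]]) auto
            then have "(\<lambda>p :: real \<times> 'a. \<bar>\<phi> p\<bar> * (N n * \<bar>step' (N n * fst p - 1)\<bar>)) \<in> borel_measurable ?L"
              by (intro borel_measurable_lebesgue_on borel_measurable_continuous_onI)
            then show ?thesis by measurable
          qed
          have FB_m: "?FB \<in> borel_measurable ?L"
          proof -
            have "snd \<in> (borel :: (real \<times> 'a) measure) \<rightarrow>\<^sub>M borel"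
              by (intro borel_measurable_continuous_onI continuous_intros)
            then have "snd \<in> ?L \<rightarrow>\<^sub>M (borel :: 'a measure)"
              by (rule borel_measurable_lebesgue_on)
            then have 1: "(\<lambda>p. indicator ?W (snd p) :: ennreal) \<in> borel_measurable ?L"
              using measurable_compose[OF _ borel_measurable_indicator[OF W]] by blast
            have "\<phi> \<in> borel_measurable ?L"
              by (rule borel_measurable_lebesgue_on[OF C_c_inf_measurable[OF \<phi>]])
            then show ?thesis using 1 by measurable
          qed
          have "ennreal \<bar>X n\<bar> \<le> (\<integral>\<^sup>+p. ennreal (norm (\<phi> p * Z n p)) \<partial>?L)"
            unfolding X_def using integral_norm_bound_ennreal[OF Z_int[of n]] by simp
          also have "\<dots> \<le> (\<integral>\<^sup>+p. ennreal Cw * ?FA p + ennreal (Cv * (C * N n)) * ?FB p \<partial>?L)"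
          proof (rule nn_integral_mono_AE)
            show "AE p in ?L. ennreal (norm (\<phi> p * Z n p)) \<le> ennreal Cw * ?FA p + ennreal (Cv * (C * N n)) * ?FB p"
              using w(2) v(2) AE_space
            proof eventually_elim
              case (elim p)
              then have p: "p \<in> S" by (simp add: space_restrict_space)
              show ?case
              proof (cases "norm (snd p) < R")
                case False
                then have "\<phi> p = 0" using zeroR[of "fst p" "snd p"] p by auto
                then show ?thesis by simp
              next
                case True
                let ?i = "indicator ?W (snd p) :: real"
                have x: "snd p \<in> \<Omega>" using p by auto
                have 1: "\<bar>(N n * step' (N n * fst p - 1) * w p) * \<beta> n (snd p)\<bar> \<le> Cw * (N n * \<bar>step' (N n * fst p - 1)\<bar>)"
                proof -
                  have "\<bar>(N n * step' (N n * fst p - 1) * w p) * \<beta> n (snd p)\<bar>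
                      = (N n * \<bar>step' (N n * fst p - 1)\<bar>) * (\<bar>w p\<bar> * \<beta> n (snd p))"
                    using N[of n] \<beta>_01[of n "snd p"] by (simp add: abs_mult)
                  also have "\<dots> \<le> (N n * \<bar>step' (N n * fst p - 1)\<bar>) * (Cw * 1)"
                    using N[of n] \<beta>_01[of n "snd p"] elim(1) Cw by (intro mult_left_mono mult_mono) auto
                  finally show ?thesis by (simp add: mult.commute)
                qed
                have 2: "\<bar>\<alpha> n (fst p) * frechet_derivative (\<beta> n) (at (snd p)) (v p)\<bar> \<le> Cv * (C * N n) * ?i"
                proof (cases "frechet_derivative (\<beta> n) (at (snd p)) (v p) = 0")
                  case False
                  then have i: "?i = 1" using \<beta>_near[OF x True False] by (simp add: indicator_def)
                  have "\<bar>\<alpha> n (fst p) * frechet_derivative (\<beta> n) (at (snd p)) (v p)\<bar>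
                      \<le> 1 * \<bar>frechet_derivative (\<beta> n) (at (snd p)) (v p)\<bar>"
                    unfolding abs_mult using \<alpha>_01[of n "fst p"] by (intro mult_right_mono) auto
                  also have "\<dots> \<le> 1 * (C / (1 / N n) * norm (v p))"
                    using \<beta>_d by (intro mult_left_mono) auto
                  also have "\<dots> \<le> (C * N n) * Cv"
                    using elim(2) C N[of n] by (simp add: mult_left_mono)
                  finally show ?thesis using i by (simp add: mult.commute)
                next
                  case True
                  then show ?thesis using Cv C N[of n] by simp
                qed
                have "\<bar>Z n p\<bar> \<le> Cw * (N n * \<bar>step' (N n * fst p - 1)\<bar>) + Cv * (C * N n) * ?i"
                  unfolding Z_def \<xi>'_def fst_conv snd_conv
                  by (rule order_trans[OF abs_triangle_ineq add_mono[OF 1 2]])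
                then have "\<bar>\<phi> p\<bar> * \<bar>Z n p\<bar> \<le> \<bar>\<phi> p\<bar> * (Cw * (N n * \<bar>step' (N n * fst p - 1)\<bar>) + Cv * (C * N n) * ?i)"
                  by (rule mult_left_mono) simp
                then have "norm (\<phi> p * Z n p)
                    \<le> Cw * (\<bar>\<phi> p\<bar> * (N n * \<bar>step' (N n * fst p - 1)\<bar>)) + Cv * (C * N n) * (\<bar>\<phi> p\<bar> * ?i)"
                  by (simp add: abs_mult distrib_left mult_ac)
                then have "ennreal (norm (\<phi> p * Z n p))
                    \<le> ennreal (Cw * (\<bar>\<phi> p\<bar> * (N n * \<bar>step' (N n * fst p - 1)\<bar>)) + Cv * (C * N n) * (\<bar>\<phi> p\<bar> * ?i))"
                  by (rule ennreal_leI)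
                also have "\<dots> = ennreal (Cw * (\<bar>\<phi> p\<bar> * (N n * \<bar>step' (N n * fst p - 1)\<bar>)))
                    + ennreal (Cv * (C * N n) * (\<bar>\<phi> p\<bar> * ?i))"
                  using Cw Cv C N[of n] by (intro ennreal_plus) auto
                also have "ennreal (Cw * (\<bar>\<phi> p\<bar> * (N n * \<bar>step' (N n * fst p - 1)\<bar>))) = ennreal Cw * ?FA p"
                  using Cw N[of n] by (intro ennreal_mult) auto
                also have "ennreal (Cv * (C * N n) * (\<bar>\<phi> p\<bar> * ?i)) = ennreal (Cv * (C * N n)) * ennreal (\<bar>\<phi> p\<bar> * ?i)"
                  using Cv C N[of n] by (intro ennreal_mult) auto
                also have "ennreal (\<bar>\<phi> p\<bar> * ?i) = ?FB p" by (simp add: indicator_def)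
                finally show ?thesis .
              qed
            qed
          qed
          also have "\<dots> = (\<integral>\<^sup>+p. ennreal Cw * ?FA p \<partial>?L) + (\<integral>\<^sup>+p. ennreal (Cv * (C * N n)) * ?FB p \<partial>?L)"
            using FA_m FB_m by (intro nn_integral_add) auto
          also have "\<dots> = ennreal Cw * (\<integral>\<^sup>+p. ?FA p \<partial>?L) + ennreal (Cv * (C * N n)) * (\<integral>\<^sup>+p. ?FB p \<partial>?L)"
            by (simp only: nn_integral_cmult[OF FA_m] nn_integral_cmult[OF FB_m])
          also have "\<dots> \<le> ennreal Cw * (ennreal D * ennreal (a + \<kappa> * a'))
              + ennreal (Cv * (C * N n)) * (ennreal (K0 / N n) * ennreal (b + \<kappa> * b'))"
            using elim by (intro add_mono mult_left_mono) auto
          also have "\<dots> = ennreal (Cw * (D * (a + \<kappa> * a')) + Cv * (C * N n) * (K0 / N n * (b + \<kappa> * b')))"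
          proof -
            have "a + \<kappa> * a' \<ge> 0" "b + \<kappa> * b' \<ge> 0" using ab'_nonneg \<kappa> by (auto simp: a_def b_def)
            then show ?thesis
              using Cw D0 Cv C K0 N[of n] by (simp add: ennreal_mult[symmetric] ennreal_plus[symmetric] del: ennreal_plus)
          qed
          \<comment> \<open>The gradient factor \<open>N n\<close> cancels against the layer factor
            \<open>K0 / N n\<close>, which makes the bound independent of \<open>n\<close>.\<close>
          also have "Cw * (D * (a + \<kappa> * a')) + Cv * (C * N n) * (K0 / N n * (b + \<kappa> * b'))
              = Cw * D * (a + \<kappa> * a') + Cv * (C * K0) * (b + \<kappa> * b')"
            using N[of n] by (simp add: mult_ac)
          finally show ?case
            by (subst (asm) ennreal_le_iff) (use Cw D0 Cv C K0 ab'_nonneg \<kappa> in \<open>auto simp: a_def b_def\<close>)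
        qed
      qed
      define Q where "Q = Cw * D * a + Cv * (C * K0) * b"
      define M where "M = Cw * D * a' + Cv * (C * K0) * b'"
      have M: "M \<ge> 0" using Cw D0 Cv C K0 ab'_nonneg by (simp add: M_def)
      have "\<bar>- G \<phi> - (\<integral>p. action \<phi> p \<partial>?L)\<bar> \<le> Q"
      proof (rule field_le_epsilon)
        fix e :: real assume e: "e > 0"
        \<comment> \<open>The limit in \<open>n\<close> has been taken, so \<open>\<kappa>\<close>
          may now be chosen from \<open>e\<close>; the \<open>+ 1\<close> covers
          \<open>M = 0\<close>.\<close>
        define \<kappa> where "\<kappa> = e / (M + 1)"
        have \<kappa>: "\<kappa> > 0" "\<kappa> * M \<le> e" using e M by (auto simp: \<kappa>_def field_simps)
        have "\<bar>- G \<phi> - (\<integral>p. action \<phi> p \<partial>?L)\<bar> \<le> Cw * D * (a + \<kappa> * a') + Cv * (C * K0) * (b + \<kappa> * b')"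
          by (rule tendsto_upperbound[OF tendsto_rabs[OF X_lim] bound[OF \<kappa>(1)]]) simp
        also have "\<dots> = Q + \<kappa> * M" by (simp add: Q_def M_def algebra_simps)
        finally show "\<bar>- G \<phi> - (\<integral>p. action \<phi> p \<partial>?L)\<bar> \<le> Q + e" using \<kappa>(2) by linarith
      qed
      then show "\<bar>(\<integral>p. action \<phi> p \<partial>?L) + G \<phi>\<bar> \<le> Cw * D * (\<integral>x. \<bar>\<phi> (0, x)\<bar> \<partial>lebesgue_on \<Omega>)
          + Cv * (C * K0) * (\<integral>p. \<bar>\<phi> p\<bar> \<partial>lateral_measure T \<Omega>)"
        unfolding Q_def a_def b_def by linarith
    qed (use D0 C K0 in auto)
  qed
qed

end

section \<open>Existence and uniqueness of traces\<close>

lemma integrable_Linf_mult: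
  fixes g \<phi> :: "'a \<Rightarrow> real"
  assumes g: "g \<in> Linf M" and \<phi>: "integrable M \<phi>"
  shows "integrable M (\<lambda>x. g x * \<phi> x)"
proof -
  obtain C where C: "AE x in M. norm (g x) \<le> C" and [measurable]: "g \<in> borel_measurable M"
    using g by (auto simp: Linf_def)
  show ?thesis
  proof (rule Bochner_Integration.integrable_bound[of M "\<lambda>x. C * \<phi> x"])
    show "AE x in M. norm (g x * \<phi> x) \<le> norm (C * \<phi> x)"
      using C by eventually_elim (auto simp: abs_mult intro!: mult_right_mono)
  qed (use \<phi> in auto)
qed

lemma Linf_diff:
  fixes g h :: "'a \<Rightarrow> real"
  assumes "g \<in> Linf M" "h \<in> Linf M"
  shows "(\<lambda>x. g x - h x) \<in> Linf M"
proof -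
  obtain C D where C: "AE x in M. norm (g x) \<le> C" and D: "AE x in M. norm (h x) \<le> D"
    using assms by (auto simp: Linf_def)
  then have "AE x in M. norm (g x - h x) \<le> C + D"
    by eventually_elim (auto intro: order_trans[OF abs_triangle_ineq4 add_mono])
  then show ?thesis using assms by (auto simp: Linf_def)
qed

lemma LinfI: "g \<in> borel_measurable M \<Longrightarrow> (\<And>x. norm (g x) \<le> C) \<Longrightarrow> g \<in> Linf M"
  by (auto simp: Linf_def intro!: exI[of _ C])

lemma LinfE:
  assumes "g \<in> Linf M"
  obtains C where "C \<ge> 0" "AE x in M. norm (g x) \<le> C"
proof -
  obtain C where "AE x in M. norm (g x) \<le> C" using assms by (auto simp: Linf_def)
  then have "AE x in M. norm (g x) \<le> max C 0" by eventually_elim auto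
  then show ?thesis using that[of "max C 0"] by simp
qed

text \<open>The sets tested are those where \<open>g\<close> is positive or negative, cut down to
  \<open>E n\<close>. Passing to a subset \<open>A\<close> that differs from \<open>B\<close> by a
  null set allows a Lebesgue set to be replaced by a Borel one, on which the integral can be
  computed.\<close>

lemma AE_eq_0_of_integrals:
  fixes g :: "'a \<Rightarrow> real"
  assumes g[measurable]: "g \<in> borel_measurable M"
    and E: "\<And>n::nat. E n \<in> sets M" "space M \<subseteq> (\<Union>n. E n)"
    and A: "\<And>B n. B \<in> sets M \<Longrightarrow> B \<subseteq> E n \<Longrightarrow> \<exists>A\<subseteq>B. A \<in> sets M \<and> (AE x in M. x \<in> B \<longrightarrow> x \<in> A) \<and>
        integrable M (\<lambda>x. g x * indicator A x) \<and> (\<integral>x. g x * indicator A x \<partial>M) = 0"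
  shows "AE x in M. g x = 0"
proof -
  have "AE x in M. x \<in> E n \<longrightarrow> s * g x \<le> 0" for s :: real and n
  proof -
    define B where "B = {x\<in>space M. s * g x > 0} \<inter> E n"
    have B: "B \<in> sets M" "B \<subseteq> E n" unfolding B_def using E(1)[of n] by (auto intro: sets.Int)
    obtain A where A': "A \<subseteq> B" "A \<in> sets M" "AE x in M. x \<in> B \<longrightarrow> x \<in> A"
      "integrable M (\<lambda>x. g x * indicator A x)" "(\<integral>x. g x * indicator A x \<partial>M) = 0"
      using A[OF B] by blast
    have "(\<integral>x. s * (g x * indicator A x) \<partial>M) = 0" using A'(5) by simp
    moreover have "AE x in M. 0 \<le> s * (g x * indicator A x)"
      using A'(1) by (intro AE_I2) (auto simp: B_def indicator_def)
    moreover have "integrable M (\<lambda>x. s * (g x * indicator A x))" using A'(4) by simp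
    ultimately have "AE x in M. s * (g x * indicator A x) = 0"
      using integral_nonneg_eq_0_iff_AE by blast
    then show ?thesis
      using A'(3) AE_space
    proof eventually_elim
      case (elim x)
      show ?case
      proof (intro impI, rule ccontr)
        assume "x \<in> E n" "\<not> s * g x \<le> 0"
        then have "x \<in> B" using elim(3) by (simp add: B_def)
        then show False using elim(1,2) \<open>\<not> s * g x \<le> 0\<close> by auto
      qed
    qed
  qed
  note sign = this
  have "AE x in M. \<forall>n. x \<in> E n \<longrightarrow> g x \<le> 0"
    unfolding AE_all_countable using sign[of _ 1] by simp
  moreover have "AE x in M. \<forall>n. x \<in> E n \<longrightarrow> g x \<ge> 0"
    unfolding AE_all_countable using sign[of _ "-1"] by simp
  ultimately show ?thesis
    using AE_space
  proof eventually_elim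
    case (elim x)
    then obtain n where "x \<in> E n" using E(2) by blast
    then show ?case using elim(1,2) by (auto intro: antisym)
  qed
qed

text \<open>Generating rectangles are Borel because \<open>frontier \<Omega>\<close> is closed. This
  lets any lateral set be tested through its indicator as a Borel function on the whole
  space.\<close>

lemma sets_lateral_measure_borel:
  fixes \<Omega> :: "'a::euclidean_space set"
  assumes "B \<in> sets (lateral_measure T \<Omega>)"
  shows "B \<in> sets borel"
proof -
  let ?R = "restrict_space lborel {0<..<T}" and ?F = "surface_measure \<Omega>"
  have fr: "frontier \<Omega> \<in> sets borel" by (intro borel_closed) simp
  have sp: "space ?R \<times> space ?F \<in> sets (borel :: (real \<times> 'a) measure)"
    using fr by (simp add: space_restrict_space borel_prod[symmetric])
  have "B \<in> sigma_sets (space ?R \<times> space ?F) {a \<times> b |a b. a \<in> sets ?R \<and> b \<in> sets ?F}"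
    using assms by (simp add: lateral_measure_def sets_pair_measure)
  then show ?thesis
  proof (induction rule: sigma_sets.induct)
    case (Basic C)
    then obtain a b where C: "C = a \<times> b" "a \<in> sets ?R" "b \<in> sets ?F" by blast
    then have "a \<in> sets borel" "b \<in> sets borel"
      using fr by (auto simp: sets_restrict_space)
    then show ?case by (simp add: C(1) borel_prod[symmetric])
  next
    case (Compl C)
    then show ?case using sp by (intro sets.Diff)
  qed auto
qed

lemma sigma_finite_of_bounded:
  fixes M :: "'a::euclidean_space measure"
  assumes sets: "sets M = sets borel" and fin: "\<And>a b. emeasure M (box a b) < \<infinity>"
  shows "sigma_finite_measure M"
proof
  let ?A = "range (\<lambda>n::nat. box (- real n *\<^sub>R One) (real n *\<^sub>R One) :: 'a set)"
  have "\<Union>?A = space M"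
    using UN_box_eq_UNIV sets_eq_imp_space_eq[OF sets] by auto
  then show "\<exists>A. countable A \<and> A \<subseteq> sets M \<and> \<Union>A = space M \<and> (\<forall>a\<in>A. emeasure M a \<noteq> \<infinity>)"
    using fin by (intro exI[of _ ?A]) (auto simp: sets less_top[symmetric])
qed

lemma emeasure_sum_borel_box:
  fixes \<Omega> :: "'a::euclidean_space set"
  assumes "open \<Omega>" "uniformly_lipschitz_boundary \<Omega>"
  shows "emeasure (sum_measure (lateral_borel T \<Omega>) (initial_borel \<Omega>)) (box a b) < \<infinity>"
  using emeasure_lateral_borel_bounded[OF assms bounded_box, of a b T]
    emeasure_initial_borel_bounded[OF assms(1) bounded_box, of a b]
  by (subst emeasure_sum_measure) (auto simp: ennreal_add_less_top)

lemma AE_sum_borel: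
  fixes \<Omega> :: "'a::euclidean_space set"
  assumes "T > 0"
  shows "AE p in sum_measure (lateral_borel T \<Omega>) (initial_borel \<Omega>). fst p \<in> {0..<T}"
proof -
  let ?N = "{p :: real \<times> 'a. fst p \<notin> {0..<T}}"
  have "?N = (- {0..<T}) \<times> UNIV" by auto
  then have N: "?N \<in> sets borel" by (simp add: borel_prod[symmetric])
  have 1: "AE p in lateral_borel T \<Omega>. fst p \<in> {0..<T}"
    using AE_lateral_borel by eventually_elim auto
  have 2: "AE p in initial_borel \<Omega>. fst p \<in> {0..<T}"
    using AE_initial_borel by eventually_elim (use assms in auto)
  have "emeasure (lateral_borel T \<Omega>) ?N = 0"
    using 1 N by (subst (asm) AE_iff_measurable[OF _ refl]) (auto simp: lateral_borel_def)
  moreover have "emeasure (initial_borel \<Omega>) ?N = 0"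
    using 2 N by (subst (asm) AE_iff_measurable[OF _ refl]) (auto simp: initial_borel_def)
  ultimately have "?N \<in> null_sets (sum_measure (lateral_borel T \<Omega>) (initial_borel \<Omega>))"
    using N by (intro null_setsI) (auto simp: emeasure_sum_measure)
  then show ?thesis by (rule AE_I') auto
qed

section \<open>Representation of the boundary functional by bounded densities\<close>

context weak_balance
begin

definition balance :: "(real \<times> 'a \<Rightarrow> real) \<Rightarrow> real" where
  "balance \<phi> = (\<integral>p. action \<phi> p \<partial>lebesgue_on S) + G \<phi>"

lemma balance_add:
  assumes "\<phi> \<in> V" "\<psi> \<in> V"
  shows "balance (\<lambda>p. \<phi> p + \<psi> p) = balance \<phi> + balance \<psi>"
proof -
  have "action (\<lambda>p. \<phi> p + \<psi> p) = (\<lambda>p. action \<phi> p + action \<psi> p)"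
  proof
    fix p
    have d: "(\<phi> has_derivative frechet_derivative \<phi> (at p)) (at p)" "(\<psi> has_derivative frechet_derivative \<psi> (at p)) (at p)"
      using assms C_c_inf_C_k C_k_has_derivative by blast+
    have "frechet_derivative (\<lambda>p. \<phi> p + \<psi> p) (at p) = (\<lambda>h. frechet_derivative \<phi> (at p) h + frechet_derivative \<psi> (at p) h)"
      by (rule frechet_derivative_at[OF has_derivative_add[OF d], symmetric])
    then show "action (\<lambda>p. \<phi> p + \<psi> p) p = action \<phi> p + action \<psi> p"
      using assms by (simp add: action_eq C_c_inf_differentiable[OF C_c_inf_add] C_c_inf_differentiable)
  qed
  then show ?thesis
    using assms by (simp add: balance_def G_add action_integrable)
qed

lemma balance_scale:
  assumes "\<phi> \<in> V"
  shows "balance (\<lambda>p. c * \<phi> p) = c * balance \<phi>"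
proof -
  have "action (\<lambda>p. c * \<phi> p) = (\<lambda>p. c * action \<phi> p)"
  proof
    fix p
    have d: "(\<phi> has_derivative frechet_derivative \<phi> (at p)) (at p)"
      using assms C_c_inf_C_k C_k_has_derivative by blast
    have "frechet_derivative (\<lambda>p. c * \<phi> p) (at p) = (\<lambda>h. c * frechet_derivative \<phi> (at p) h)"
      by (rule frechet_derivative_at[OF has_derivative_mult_right[OF d], symmetric])
    then show "action (\<lambda>p. c * \<phi> p) p = c * action \<phi> p"
      using assms by (simp add: action_eq C_c_inf_differentiable[OF C_c_inf_scale] C_c_inf_differentiable)
  qed
  then show ?thesis
    using assms by (simp add: balance_def G_scale distrib_left)
qed

text \<open>The measure is left open because the two claims use different ones: the sum of lateral
  and initial measure for the transport equation, the lateral measure alone for the field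
  \<open>(0, b)\<close>.\<close>

lemma balance_representation:
  fixes M :: "(real \<times> 'a) measure"
  assumes sets: "sets M = sets borel" and fin: "\<And>a b. emeasure M (box a b) < \<infinity>"
    and conc: "AE p in M. fst p \<in> {0..<T}"
    and C: "C \<ge> 0" and bound: "\<And>\<phi>. \<phi> \<in> V \<Longrightarrow> \<bar>balance \<phi>\<bar> \<le> C * (\<integral>p. \<bar>\<phi> p\<bar> \<partial>M)"
  obtains \<sigma> where "\<sigma> \<in> borel_measurable borel" "\<And>p. \<bar>\<sigma> p\<bar> \<le> C"
    "\<And>\<phi>. \<phi> \<in> V \<Longrightarrow> balance \<phi> = (\<integral>p. \<sigma> p * \<phi> p \<partial>M)"
proof -
  have conc': "AE p in M. fst p < T" using conc by eventually_elim simp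
  interpret sigma_finite_measure M by (rule sigma_finite_of_bounded[OF sets fin])
  interpret L1_functional M V balance C
  proof
    show "integrable M \<phi>" if "\<phi> \<in> V" for \<phi> by (rule integrable_C_c_inf[OF sets fin conc that])
    show "L1_approx M V f" if "integrable M f" for f by (rule L1_approx_C_c_inf[OF sets fin conc' that])
  qed (simp_all add: C_c_inf_add C_c_inf_scale balance_add balance_scale bound C)
  obtain \<sigma> where \<sigma>: "\<sigma> \<in> borel_measurable M" "AE p in M. \<bar>\<sigma> p\<bar> \<le> C"
    and rep: "\<And>\<phi>. \<phi> \<in> V \<Longrightarrow> balance \<phi> = (\<integral>p. \<sigma> p * \<phi> p \<partial>M)"
    using representation by blast
  \<comment> \<open>Truncation changes the density only on a null set of \<open>M\<close> and makes
    the bound hold everywhere, so that membership in \<open>Linf\<close> of the lateral and initial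
    parts is immediate.\<close>
  define \<sigma>' where "\<sigma>' p = max (- C) (min C (\<sigma> p))" for p
  have [measurable]: "\<sigma> \<in> borel_measurable borel" using \<sigma>(1) sets by (simp cong: measurable_cong_sets)
  show ?thesis
  proof (rule that[of \<sigma>'])
    show "\<sigma>' \<in> borel_measurable borel" unfolding \<sigma>'_def[abs_def] by measurable
    then have \<sigma>'_M: "\<sigma>' \<in> borel_measurable M" using sets by (simp cong: measurable_cong_sets)
    show "\<bar>\<sigma>' p\<bar> \<le> C" for p using C by (auto simp: \<sigma>'_def)
    fix \<phi> assume \<phi>: "\<phi> \<in> V"
    have \<phi>_M: "\<phi> \<in> borel_measurable M" using C_c_inf_measurable[OF \<phi>] sets by (simp cong: measurable_cong_sets)
    have "AE p in M. \<sigma> p * \<phi> p = \<sigma>' p * \<phi> p"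
      using \<sigma>(2) by eventually_elim (auto simp: \<sigma>'_def)
    then show "balance \<phi> = (\<integral>p. \<sigma>' p * \<phi> p \<partial>M)"
      unfolding rep[OF \<phi>] using \<sigma>(1) \<sigma>'_M \<phi>_M by (intro integral_cong_AE) auto
  qed
qed

theorem trace_exists:
  "\<exists>\<tau>\<in>Linf (lateral_measure T \<Omega>). \<exists>w\<^sub>0\<in>Linf (lebesgue_on \<Omega>). \<forall>\<phi>\<in>V.
    (\<integral>p. \<tau> p * \<phi> p \<partial>lateral_measure T \<Omega>) - (\<integral>x. \<phi> (0, x) * w\<^sub>0 x \<partial>lebesgue_on \<Omega>) = balance \<phi>"
proof (rule action_functional_bound)
  fix D K assume D: "D \<ge> 0" and K: "K \<ge> 0" and bound: "\<And>\<phi>. \<phi> \<in> V \<Longrightarrow> \<bar>(\<integral>p. action \<phi> p \<partial>lebesgue_on S) + G \<phi>\<bar>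
      \<le> Cw * D * (\<integral>x. \<bar>\<phi> (0, x)\<bar> \<partial>lebesgue_on \<Omega>) + Cv * K * (\<integral>p. \<bar>\<phi> p\<bar> \<partial>lateral_measure T \<Omega>)"
  let ?M1 = "lateral_borel T \<Omega>" and ?M2 = "initial_borel \<Omega>"
  let ?M = "sum_measure ?M1 ?M2"
  \<comment> \<open>One constant exceeding both \<open>Cw * D\<close> and \<open>Cv * K\<close>
    gives a bound by the norm for the sum measure.\<close>
  define C where "C = Cw * D + Cv * K"
  have C: "C \<ge> 0" using D K Cw Cv by (simp add: C_def)
  note fin = emeasure_sum_borel_box[OF open_\<Omega> lip] and conc = AE_sum_borel[OF T]
  have int1: "integrable ?M1 \<phi>" and int2: "integrable ?M2 \<phi>" if "\<phi> \<in> V" for \<phi>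
    using integrable_lateral_borel[OF open_\<Omega> lip T that] integrable_initial_borel[OF open_\<Omega> lip T that] by auto
  have sM: "sets ?M = sets borel" by simp
  have bd: "\<bar>balance \<phi>\<bar> \<le> C * (\<integral>p. \<bar>\<phi> p\<bar> \<partial>?M)" if \<phi>: "\<phi> \<in> V" for \<phi>
  proof -
    have abs: "(\<lambda>p. \<bar>\<phi> p\<bar>) \<in> borel_measurable borel" using C_c_inf_measurable[OF \<phi>] by measurable
    have eq: "(\<integral>p. \<bar>\<phi> p\<bar> \<partial>?M) = (\<integral>p. \<bar>\<phi> p\<bar> \<partial>lateral_measure T \<Omega>) + (\<integral>x. \<bar>\<phi> (0, x)\<bar> \<partial>lebesgue_on \<Omega>)"
      using int1[OF \<phi>] int2[OF \<phi>] by (simp add: integral_sum_measure integral_lateral_borel[OF abs])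
    have "Cw * D * (\<integral>x. \<bar>\<phi> (0, x)\<bar> \<partial>lebesgue_on \<Omega>) \<le> C * (\<integral>x. \<bar>\<phi> (0, x)\<bar> \<partial>lebesgue_on \<Omega>)"
      and "Cv * K * (\<integral>p. \<bar>\<phi> p\<bar> \<partial>lateral_measure T \<Omega>) \<le> C * (\<integral>p. \<bar>\<phi> p\<bar> \<partial>lateral_measure T \<Omega>)"
      using D K Cw Cv by (auto simp: C_def intro!: mult_right_mono)
    then show ?thesis
      using bound[OF \<phi>] unfolding eq balance_def distrib_left by linarith
  qed
  obtain \<sigma> where \<sigma>: "\<sigma> \<in> borel_measurable borel" "\<And>p. \<bar>\<sigma> p\<bar> \<le> C"
    and rep: "\<And>\<phi>. \<phi> \<in> V \<Longrightarrow> balance \<phi> = (\<integral>p. \<sigma> p * \<phi> p \<partial>?M)"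
    by (rule balance_representation[OF sM fin conc C]) (erule bd, rule that)
  \<comment> \<open>The sign is reversed on \<open>t = 0\<close> because the initial integral enters
    the trace identity with a minus sign.\<close>
  have \<sigma>_Linf: "\<sigma> \<in> Linf (lateral_measure T \<Omega>)" "(\<lambda>x. - \<sigma> (0, x)) \<in> Linf (lebesgue_on \<Omega>)"
    using \<sigma>(2) measurable_compose[OF measurable_ident_lateral_measure \<sigma>(1)] measurable_compose[OF measurable_initial \<sigma>(1)]
    by (auto intro!: LinfI[where C=C])
  show ?thesis
  proof (intro bexI[OF _ \<sigma>_Linf(1)] bexI[OF _ \<sigma>_Linf(2)] ballI)
    fix \<phi> assume \<phi>: "\<phi> \<in> V"
    have "\<sigma> \<in> Linf ?M1" "\<sigma> \<in> Linf ?M2" using \<sigma> by (auto intro!: LinfI[where C=C])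
    then have i: "integrable ?M1 (\<lambda>p. \<sigma> p * \<phi> p)" "integrable ?M2 (\<lambda>p. \<sigma> p * \<phi> p)"
      using int1[OF \<phi>] int2[OF \<phi>] by (auto intro: integrable_Linf_mult)
    have m: "(\<lambda>p. \<sigma> p * \<phi> p) \<in> borel_measurable borel" using \<sigma>(1) C_c_inf_measurable[OF \<phi>] by measurable
    have "balance \<phi> = (\<integral>p. \<sigma> p * \<phi> p \<partial>lateral_measure T \<Omega>) + (\<integral>x. \<sigma> (0, x) * \<phi> (0, x) \<partial>lebesgue_on \<Omega>)"
      unfolding rep[OF \<phi>] using i by (simp add: integral_sum_measure integral_lateral_borel[OF m])
    then show "(\<integral>p. \<sigma> p * \<phi> p \<partial>lateral_measure T \<Omega>) - (\<integral>x. \<phi> (0, x) * - \<sigma> (0, x) \<partial>lebesgue_on \<Omega>) = balance \<phi>"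
      by (simp add: mult.commute)
  qed
qed

text \<open>Without a time component the estimate has no initial term, so the functional is already
  bounded on \<open>L1\<close> of the lateral measure and acquires no density at
  \<open>t = 0\<close>.\<close>

theorem lateral_trace_exists:
  assumes "Cw = 0"
  shows "\<exists>\<tau>\<in>Linf (lateral_measure T \<Omega>). \<forall>\<phi>\<in>V. (\<integral>p. \<tau> p * \<phi> p \<partial>lateral_measure T \<Omega>) = balance \<phi>"
proof (rule action_functional_bound)
  fix D K assume D: "D \<ge> 0" and K: "K \<ge> 0" and bound: "\<And>\<phi>. \<phi> \<in> V \<Longrightarrow> \<bar>(\<integral>p. action \<phi> p \<partial>lebesgue_on S) + G \<phi>\<bar>
      \<le> Cw * D * (\<integral>x. \<bar>\<phi> (0, x)\<bar> \<partial>lebesgue_on \<Omega>) + Cv * K * (\<integral>p. \<bar>\<phi> p\<bar> \<partial>lateral_measure T \<Omega>)"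
  let ?M = "lateral_borel T \<Omega>"
  have fin: "emeasure ?M (box a b) < \<infinity>" for a b
    using emeasure_lateral_borel_bounded[OF open_\<Omega> lip bounded_box, of a b T] by auto
  have conc: "AE p in ?M. fst p \<in> {0..<T}"
    using AE_lateral_borel by eventually_elim auto
  have sM: "sets ?M = sets borel" by simp
  have bd: "\<bar>balance \<phi>\<bar> \<le> (Cv * K) * (\<integral>p. \<bar>\<phi> p\<bar> \<partial>?M)" if \<phi>: "\<phi> \<in> V" for \<phi>
  proof -
    have "(\<lambda>p. \<bar>\<phi> p\<bar>) \<in> borel_measurable borel" using C_c_inf_measurable[OF \<phi>] by measurable
    then show ?thesis using bound[OF \<phi>] assms by (simp add: integral_lateral_borel balance_def)
  qed
  have C: "Cv * K \<ge> 0" using Cv K by simp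
  obtain \<sigma> where \<sigma>: "\<sigma> \<in> borel_measurable borel" "\<And>p. \<bar>\<sigma> p\<bar> \<le> Cv * K"
    and rep: "\<And>\<phi>. \<phi> \<in> V \<Longrightarrow> balance \<phi> = (\<integral>p. \<sigma> p * \<phi> p \<partial>?M)"
    by (rule balance_representation[OF sM fin conc C]) (erule bd, rule that)
  have \<sigma>_Linf: "\<sigma> \<in> Linf (lateral_measure T \<Omega>)"
    using \<sigma>(2) measurable_compose[OF measurable_ident_lateral_measure \<sigma>(1)] by (auto intro!: LinfI[where C="Cv * K"])
  show ?thesis
  proof (intro bexI[OF _ \<sigma>_Linf] ballI)
    fix \<phi> assume \<phi>: "\<phi> \<in> V"
    have m: "(\<lambda>p. \<sigma> p * \<phi> p) \<in> borel_measurable borel" using \<sigma>(1) C_c_inf_measurable[OF \<phi>] by measurable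
    show "(\<integral>p. \<sigma> p * \<phi> p \<partial>lateral_measure T \<Omega>) = balance \<phi>"
      unfolding rep[OF \<phi>] by (simp add: integral_lateral_borel[OF m])
  qed
qed

end

section \<open>Uniqueness of the trace and of the initial value\<close>

lemma abs_integral_Linf_mult_le:
  fixes g f :: "'a \<Rightarrow> real"
  assumes g: "g \<in> borel_measurable M" "AE x in M. norm (g x) \<le> C" and f: "integrable M f"
  shows "\<bar>\<integral>x. g x * f x \<partial>M\<bar> \<le> C * (\<integral>x. \<bar>f x\<bar> \<partial>M)"
proof -
  have "g \<in> Linf M" using g by (auto simp: Linf_def)
  then have int: "integrable M (\<lambda>x. g x * f x)" using f by (rule integrable_Linf_mult)
  have "\<bar>\<integral>x. g x * f x \<partial>M\<bar> \<le> (\<integral>x. \<bar>g x * f x\<bar> \<partial>M)" by simp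
  also have "\<dots> \<le> (\<integral>x. C * \<bar>f x\<bar> \<partial>M)"
  proof (rule integral_mono_AE)
    show "AE x in M. \<bar>g x * f x\<bar> \<le> C * \<bar>f x\<bar>"
      using g(2) by eventually_elim (auto simp: abs_mult intro!: mult_right_mono)
  qed (use int f in auto)
  finally show ?thesis by simp
qed

text \<open>Density for the sum measure provides one test function close to the indicator in both
  parts at once, and bounded weights make both integrals continuous in this distance.\<close>

lemma integral_indicator_eq_0_of_test_functions:
  fixes \<Omega> :: "'a::euclidean_space set"
  assumes "open \<Omega>" "uniformly_lipschitz_boundary \<Omega>" "T > 0"
    and g1: "g1 \<in> Linf (lateral_measure T \<Omega>)" and g2: "g2 \<in> Linf (lebesgue_on \<Omega>)"
    and zero: "\<And>\<phi>. \<phi> \<in> C_c_inf ({0..<T} \<times> UNIV) \<Longrightarrow>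
      (\<integral>p. g1 p * \<phi> p \<partial>lateral_measure T \<Omega>) + (\<integral>x. g2 x * \<phi> (0, x) \<partial>lebesgue_on \<Omega>) = 0"
    and A: "A \<in> sets borel" "bounded A"
  shows "(\<integral>p. g1 p * indicator A p \<partial>lateral_measure T \<Omega>) + (\<integral>x. g2 x * indicator A (0, x) \<partial>lebesgue_on \<Omega>) = 0"
    and "integrable (lateral_measure T \<Omega>) (\<lambda>p. g1 p * indicator A p)"
    and "integrable (lebesgue_on \<Omega>) (\<lambda>x. g2 x * indicator A (0, x))"
proof -
  let ?M1 = "lateral_borel T \<Omega>" and ?M2 = "initial_borel \<Omega>"
  let ?M = "sum_measure ?M1 ?M2"
  let ?L = "lateral_measure T \<Omega>" and ?I = "lebesgue_on \<Omega>"
  obtain C1 where C1: "C1 \<ge> 0" "AE p in ?L. norm (g1 p) \<le> C1" using g1 by (rule LinfE)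
  obtain C2 where C2: "C2 \<ge> 0" "AE p in ?I. norm (g2 p) \<le> C2" using g2 by (rule LinfE)
  have g12: "g1 \<in> borel_measurable ?L" "g2 \<in> borel_measurable ?I" using g1 g2 by (auto simp: Linf_def)
  have A1: "integrable ?M1 (indicator A :: _ \<Rightarrow> real)" and A2: "integrable ?M2 (indicator A :: _ \<Rightarrow> real)"
    using emeasure_lateral_borel_bounded[OF assms(1,2) A(2,1)] emeasure_initial_borel_bounded[OF assms(1) A(2,1)] A(1)
    by (auto intro!: integrable_real_indicator)
  have toL: "integrable ?L f" if "integrable ?M1 f" for f :: "_ \<Rightarrow> real"
    using that borel_measurable_integrable[OF that] unfolding lateral_borel_def
    by (subst (asm) integrable_distr_eq[OF measurable_ident_lateral_measure]) auto
  have toI: "integrable ?I (\<lambda>x. f (0, x))" if "integrable ?M2 f" for f :: "_ \<Rightarrow> real"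
    using that borel_measurable_integrable[OF that] unfolding initial_borel_def
    by (subst (asm) integrable_distr_eq[OF measurable_initial]) auto
  show i1: "integrable ?L (\<lambda>p. g1 p * indicator A p)" by (rule integrable_Linf_mult[OF g1 toL[OF A1]])
  show i2: "integrable ?I (\<lambda>x. g2 x * indicator A (0, x))" by (rule integrable_Linf_mult[OF g2 toI[OF A2]])
  let ?Z = "(\<integral>p. g1 p * indicator A p \<partial>?L) + (\<integral>x. g2 x * indicator A (0, x) \<partial>?I)"
  have "\<bar>?Z\<bar> \<le> 0 + e" if e: "e > 0" for e
  proof -
    \<comment> \<open>The two weighted errors together are at most \<open>(C1 + C2) * d\<close>; the
      \<open>+ 1\<close> covers the case where both bounds are \<open>0\<close>.\<close>
    define d where "d = e / (C1 + C2 + 1)"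
    have d: "d > 0" "(C1 + C2) * d \<le> e" using e C1(1) C2(1) by (auto simp: d_def field_simps)
    have fst_lt: "AE p in ?M. fst p < T" using AE_sum_borel[OF assms(3)] by eventually_elim auto
    have "L1_approx ?M (C_c_inf ({0..<T} \<times> UNIV)) (indicator A)"
      by (rule L1_approx_C_c_inf[OF _ emeasure_sum_borel_box[OF assms(1,2)] fst_lt])
        (use A1 A2 in \<open>auto intro: integrable_sum_measure\<close>)
    then obtain \<phi> where \<phi>: "\<phi> \<in> C_c_inf ({0..<T} \<times> UNIV)"
      and less: "(\<integral>\<^sup>+p. ennreal \<bar>indicator A p - \<phi> p\<bar> \<partial>?M) < ennreal d"
      using d(1) unfolding L1_approx_def by blast
    have \<phi>1: "integrable ?M1 \<phi>" and \<phi>2: "integrable ?M2 \<phi>"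
      using integrable_lateral_borel[OF assms(1-3) \<phi>] integrable_initial_borel[OF assms(1-3) \<phi>] by auto
    let ?f = "\<lambda>p. indicator A p - \<phi> p"
    have f1: "integrable ?M1 ?f" and f2: "integrable ?M2 ?f" using A1 A2 \<phi>1 \<phi>2 by auto
    have f_b: "(\<lambda>p. \<bar>?f p\<bar>) \<in> borel_measurable borel"
      using A(1) C_c_inf_measurable[OF \<phi>] by measurable
    have "(\<integral>\<^sup>+p. ennreal \<bar>?f p\<bar> \<partial>?M) = ennreal (\<integral>p. \<bar>?f p\<bar> \<partial>?M)"
      using f1 f2 by (intro nn_integral_eq_integral integrable_abs integrable_sum_measure) auto
    then have "(\<integral>p. \<bar>?f p\<bar> \<partial>?M) < d" using less d(1) by (simp add: ennreal_less_iff)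
    moreover have "(\<integral>p. \<bar>?f p\<bar> \<partial>?M) = (\<integral>p. \<bar>?f p\<bar> \<partial>?L) + (\<integral>x. \<bar>?f (0, x)\<bar> \<partial>?I)"
      using f1 f2 by (subst integral_sum_measure) (auto simp: integral_lateral_borel[OF f_b])
    ultimately have sum_less: "(\<integral>p. \<bar>?f p\<bar> \<partial>?L) + (\<integral>x. \<bar>?f (0, x)\<bar> \<partial>?I) < d" by simp
    have eq1: "(\<integral>p. g1 p * ?f p \<partial>?L) = (\<integral>p. g1 p * indicator A p \<partial>?L) - (\<integral>p. g1 p * \<phi> p \<partial>?L)"
      using i1 integrable_Linf_mult[OF g1 toL[OF \<phi>1]] by (simp add: right_diff_distrib)
    have eq2: "(\<integral>x. g2 x * ?f (0, x) \<partial>?I) = (\<integral>x. g2 x * indicator A (0, x) \<partial>?I) - (\<integral>x. g2 x * \<phi> (0, x) \<partial>?I)"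
      using i2 integrable_Linf_mult[OF g2 toI[OF \<phi>2]] by (simp add: right_diff_distrib)
    have "?Z = (\<integral>p. g1 p * ?f p \<partial>?L) + (\<integral>x. g2 x * ?f (0, x) \<partial>?I)"
      using zero[OF \<phi>] eq1 eq2 by linarith
    also have "\<bar>\<dots>\<bar> \<le> C1 * (\<integral>p. \<bar>?f p\<bar> \<partial>?L) + C2 * (\<integral>x. \<bar>?f (0, x)\<bar> \<partial>?I)"
      using abs_integral_Linf_mult_le[OF g12(1) C1(2) toL[OF f1]] abs_integral_Linf_mult_le[OF g12(2) C2(2) toI[OF f2]]
      by linarith
    also have "\<dots> \<le> C1 * d + C2 * d"
    proof (intro add_mono mult_left_mono C1 C2)
      have "0 \<le> (\<integral>p. \<bar>?f p\<bar> \<partial>?L)" "0 \<le> (\<integral>x. \<bar>?f (0, x)\<bar> \<partial>?I)" by auto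
      then show "(\<integral>p. \<bar>?f p\<bar> \<partial>?L) \<le> d" "(\<integral>x. \<bar>?f (0, x)\<bar> \<partial>?I) \<le> d" using sum_less by linarith+
    qed
    finally show ?thesis using d(2) by (simp add: distrib_right)
  qed
  then have "\<bar>?Z\<bar> \<le> 0" by (rule field_le_epsilon)
  then show "?Z = 0" by simp
qed

theorem trace_unique:
  fixes \<Omega> :: "'a::euclidean_space set"
  assumes "open \<Omega>" "uniformly_lipschitz_boundary \<Omega>" "T > 0"
    and g1: "g1 \<in> Linf (lateral_measure T \<Omega>)" and g2: "g2 \<in> Linf (lebesgue_on \<Omega>)"
    and zero: "\<And>\<phi>. \<phi> \<in> C_c_inf ({0..<T} \<times> UNIV) \<Longrightarrow>
      (\<integral>p. g1 p * \<phi> p \<partial>lateral_measure T \<Omega>) + (\<integral>x. g2 x * \<phi> (0, x) \<partial>lebesgue_on \<Omega>) = 0"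
  shows "AE p in lateral_measure T \<Omega>. g1 p = 0" and "AE x in lebesgue_on \<Omega>. g2 x = 0"
proof -
  let ?L = "lateral_measure T \<Omega>" and ?I = "lebesgue_on \<Omega>"
  note main = integral_indicator_eq_0_of_test_functions[OF assms(1-3) g1 g2 zero]
  show "AE p in ?L. g1 p = 0"
  proof (rule AE_eq_0_of_integrals[where E="\<lambda>n. cball 0 (real n) \<inter> space ?L"])
    show "g1 \<in> borel_measurable ?L" using g1 by (auto simp: Linf_def)
    show "cball 0 (real n) \<inter> space ?L \<in> sets ?L" for n
    proof -
      have "(\<lambda>p. p) -` cball 0 (real n) \<inter> space ?L \<in> sets ?L"
        by (rule measurable_sets[OF measurable_ident_lateral_measure]) simp
      then show ?thesis by simp
    qed
    show "space ?L \<subseteq> (\<Union>n. cball 0 (real n) \<inter> space ?L)"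
    proof
      fix p assume "p \<in> space ?L"
      moreover obtain n where "norm p \<le> real n" using real_arch_simple by blast
      ultimately show "p \<in> (\<Union>n. cball 0 (real n) \<inter> space ?L)" by auto
    qed
    fix B n assume B: "B \<in> sets ?L" "B \<subseteq> cball 0 (real n) \<inter> space ?L"
    have B': "B \<in> sets borel" by (rule sets_lateral_measure_borel[OF B(1)])
    have "bounded B" using B(2) bounded_subset[OF bounded_cball] by blast
    note * = main[OF _ B' this]
    \<comment> \<open>Lateral sets consist of points with positive time, so the initial integral
      drops out and \<open>g1\<close> is isolated.\<close>
    have "(0, x) \<notin> B" for x using B(2) by (auto simp: space_lateral_measure)
    then have "(\<integral>p. g1 p * indicator B p \<partial>?L) = 0" using *(1) by simp
    then show "\<exists>A\<subseteq>B. A \<in> sets ?L \<and> (AE p in ?L. p \<in> B \<longrightarrow> p \<in> A) \<and>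
        integrable ?L (\<lambda>p. g1 p * indicator A p) \<and> (\<integral>p. g1 p * indicator A p \<partial>?L) = 0"
      using B(1) *(2) by (intro exI[of _ B]) auto
  qed
  show "AE x in ?I. g2 x = 0"
  proof (rule AE_eq_0_of_integrals[where E="\<lambda>n. cball 0 (real n) \<inter> \<Omega>"])
    have \<Omega>: "\<Omega> \<in> sets lebesgue" using assms(1) by auto
    show "g2 \<in> borel_measurable ?I" using g2 by (auto simp: Linf_def)
    show "cball 0 (real n) \<inter> \<Omega> \<in> sets ?I" for n
      by (subst sets_restrict_space_iff) (use \<Omega> in auto)
    show "space ?I \<subseteq> (\<Union>n. cball 0 (real n) \<inter> \<Omega>)"
    proof
      fix x assume "x \<in> space ?I"
      moreover obtain n where "norm x \<le> real n" using real_arch_simple by blast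
      ultimately show "x \<in> (\<Union>n. cball 0 (real n) \<inter> \<Omega>)" by (auto simp: space_restrict_space)
    qed
    fix B n assume B: "B \<in> sets ?I" "B \<subseteq> cball 0 (real n) \<inter> \<Omega>"
    have BL: "B \<in> sets lebesgue" using B(1) \<Omega> by (subst (asm) sets_restrict_space_iff) auto
    \<comment> \<open>The set \<open>B\<close> is merely Lebesgue measurable, whereas the identity
      is known for Borel sets; its Borel part \<open>A\<close> differs from it by a null
      set.\<close>
    then obtain A N N' where AN: "B = A \<union> N" "N \<subseteq> N'" "N' \<in> null_sets lborel" "A \<in> sets lborel"
      by (rule sets_completionE)
    have AB: "A \<subseteq> B" using AN(1) by blast
    have A\<Omega>: "A \<subseteq> \<Omega>" using AB B(2) by blast
    \<comment> \<open>Placed at time \<open>0\<close>, the set misses the space of the lateral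
      measure, and only the integral of \<open>g2\<close> remains.\<close>
    let ?A = "{0::real} \<times> A"
    have A': "?A \<in> sets borel" using AN(4) by (simp add: borel_prod[symmetric])
    have "A \<subseteq> cball 0 (real n)" using AB B(2) by blast
    then have "bounded A" by (rule bounded_subset[OF bounded_cball])
    then have "bounded ?A" by (intro bounded_Times) simp_all
    note * = main[OF _ A' this]
    have "(\<integral>p. g1 p * indicator ?A p \<partial>?L) = (\<integral>p. 0 \<partial>?L)"
      by (intro Bochner_Integration.integral_cong) (auto simp: space_lateral_measure indicator_def)
    moreover have ind: "indicator ?A (0::real, x) = (indicator A x :: real)" for x by (simp add: indicator_def)
    ultimately have 0: "(\<integral>x. g2 x * indicator A x \<partial>?I) = 0" using *(1) by simp
    have "A \<in> sets ?I"
      using AN(4) A\<Omega> \<Omega> by (auto simp: sets_restrict_space_iff)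
    moreover have "AE x in ?I. x \<in> B \<longrightarrow> x \<in> A"
    proof -
      have "AE x in lebesgue. x \<notin> N'"
        using AN(3) by (intro AE_completion AE_not_in) auto
      then have "AE x in lebesgue. x \<in> \<Omega> \<longrightarrow> x \<in> B \<longrightarrow> x \<in> A"
        by eventually_elim (use AN(1,2) in auto)
      then show ?thesis using \<Omega> by (simp add: AE_restrict_space_iff)
    qed
    ultimately show "\<exists>A\<subseteq>B. A \<in> sets ?I \<and> (AE x in ?I. x \<in> B \<longrightarrow> x \<in> A) \<and>
        integrable ?I (\<lambda>x. g2 x * indicator A x) \<and> (\<integral>x. g2 x * indicator A x \<partial>?I) = 0"
      using AB 0 *(3) by (intro exI[of _ A]) (simp add: ind)
  qed
qed

text \<open>Time \<open>T\<close> is outside the region where \<open>\<phi>\<close> is controlled,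
  but the representative is continuous everywhere. The compact set \<open>K\<close> avoids a
  neighbourhood of \<open>(T, x)\<close>, so \<open>\<phi>\<close> vanishes at nearby earlier
  times.\<close>

lemma C_c_inf_terminal_eq_0:
  fixes \<phi> :: "real \<times> 'a::euclidean_space \<Rightarrow> real"
  assumes \<phi>: "\<phi> \<in> C_c_inf ({0..<T} \<times> UNIV)" and T: "T > 0"
  shows "\<phi> (T, x) = 0"
proof (rule ccontr)
  assume ne: "\<phi> (T, x) \<noteq> 0"
  obtain K where K: "compact K" "K \<subseteq> {0..<T} \<times> UNIV" and zero: "\<And>p. p \<in> {0..<T} \<times> UNIV - K \<Longrightarrow> \<phi> p = 0"
    using \<phi> by (auto simp: C_c_inf_def)
  let ?W = "{p. \<phi> p \<noteq> 0} \<inter> - K"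
  have "open ?W"
    using K(1) C_c_inf_continuous[OF \<phi>] by (intro open_Int open_Collect_neq open_Compl compact_imp_closed) auto
  moreover have "(T, x) \<in> ?W" using ne K(2) by auto
  ultimately obtain d where d: "d > 0" "ball (T, x) d \<subseteq> ?W" by (meson open_contains_ball)
  define t where "t = T - min (d / 2) T"
  have t: "0 \<le> t" "t < T" "T - t < d" using d T by (auto simp: t_def min_def)
  have "dist (T, x) (t, x) < d" using t by (simp add: dist_Pair_Pair dist_real_def)
  then have "(t, x) \<in> ?W" using d(2) by auto
  then show False using zero[of "(t, x)"] t by auto
qed

lemma integral_lebesgue_on:
  fixes f :: "'a::euclidean_space \<Rightarrow> real"
  assumes "f \<in> borel_measurable borel" "S \<in> sets borel"
  shows "(\<integral>x. f x \<partial>lebesgue_on S) = (\<integral>x. indicator S x * f x \<partial>lborel)"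
    and "integrable (lebesgue_on S) f \<Longrightarrow> integrable lborel (\<lambda>x. indicator S x * f x)"
proof -
  have m: "(\<lambda>x. indicator S x * f x) \<in> borel_measurable lborel" using assms by simp
  have "(\<integral>x. f x \<partial>lebesgue_on S) = (\<integral>x. indicator S x * f x \<partial>lebesgue)"
    using assms(2) by (subst integral_restrict_space) auto
  then show "(\<integral>x. f x \<partial>lebesgue_on S) = (\<integral>x. indicator S x * f x \<partial>lborel)"
    by (simp add: integral_completion[OF m])
  show "integrable lborel (\<lambda>x. indicator S x * f x)" if "integrable (lebesgue_on S) f"
    using that assms(2) by (subst (asm) integrable_restrict_space) (auto simp: integrable_completion[OF m])
qed

text \<open>The fundamental theorem of calculus on each line with fixed \<open>x\<close>, where the
  value at \<open>T\<close> vanishes. This is the source of the term with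
  \<open>\<phi> (0, x)\<close> in the first claim.\<close>

lemma (in bounded_field) integral_time_deriv:
  assumes \<phi>: "\<phi> \<in> V" and int: "integrable (lebesgue_on S) (time_deriv \<phi>)"
  shows "(\<integral>p. time_deriv \<phi> p \<partial>lebesgue_on S) = - (\<integral>x. \<phi> (0, x) \<partial>lebesgue_on \<Omega>)"
proof -
  have cont: "continuous_on UNIV (time_deriv \<phi>)"
    unfolding time_deriv_def[abs_def] by (rule C_c_inf_derivative_continuous[OF \<phi>]) (simp add: Basis_prod_def)
  then have b: "time_deriv \<phi> \<in> borel_measurable borel" by (rule borel_measurable_continuous_onI)
  have \<Omega>_b: "\<Omega> \<in> sets borel" using open_\<Omega> by auto
  let ?f = "\<lambda>t x. indicator S (t, x) * time_deriv \<phi> (t, x)"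
  have i: "integrable lborel (\<lambda>p. indicator S p * time_deriv \<phi> p)"
    by (rule integral_lebesgue_on(2)[OF b S_borel int])
  then have i': "integrable (lborel \<Otimes>\<^sub>M lborel) (case_prod ?f)"
    by (simp add: lborel_prod case_prod_beta')
  have inner: "(\<integral>t. ?f t x \<partial>lborel) = indicator \<Omega> x * (- \<phi> (0, x))" for x
  proof -
    have cont_x: "continuous_on A (\<lambda>t. time_deriv \<phi> (t, x))" for A
    proof (rule continuous_on_compose2[OF cont])
      show "continuous_on A (\<lambda>t. (t, x))" by (intro continuous_intros)
    qed simp
    have "((\<lambda>t. \<phi> (t, x)) has_vector_derivative time_deriv \<phi> (t, x)) (at t)" for t
    proof -
      have 1: "((\<lambda>t. (t, x)) has_derivative (\<lambda>h. (h, 0))) (at t)"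
        by (auto intro!: derivative_eq_intros)
      have 2: "(\<phi> has_derivative frechet_derivative \<phi> (at (t, x))) (at (t, x))"
        using C_c_inf_C_k[OF \<phi>] C_k_has_derivative by blast
      have lin: "linear (frechet_derivative \<phi> (at (t, x)))"
        using C_c_inf_differentiable[OF \<phi>] by (simp add: linear_frechet_derivative)
      have "frechet_derivative \<phi> (at (t, x)) (h, 0) = h * time_deriv \<phi> (t, x)" for h
        using linear_cmul[OF lin, of h "(1, 0)"] by (simp add: time_deriv_def)
      then show ?thesis
        using has_derivative_compose[OF 1 2] by (simp add: has_vector_derivative_def)
    qed
    note vd = this
    have "(\<integral>t. indicator {0..T} t *\<^sub>R time_deriv \<phi> (t, x) \<partial>lborel) = \<phi> (T, x) - \<phi> (0, x)"
      by (rule integral_FTC_Icc[where F="\<lambda>t. \<phi> (t, x)"])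
        (use T in simp, rule has_vector_derivative_at_within[OF vd], rule cont_x)
    then have "(\<integral>t. indicator {0..T} t * time_deriv \<phi> (t, x) \<partial>lborel) = - \<phi> (0, x)"
      using C_c_inf_terminal_eq_0[OF \<phi> T, of x] by simp
    moreover have "(\<integral>t. indicator {0..T} t * time_deriv \<phi> (t, x) \<partial>lborel) = (\<integral>t. indicator {0<..<T} t * time_deriv \<phi> (t, x) \<partial>lborel)"
    proof (rule integral_cong_AE)
      have "(\<lambda>t. time_deriv \<phi> (t, x)) \<in> borel_measurable borel"
        by (intro borel_measurable_continuous_onI cont_x)
      then show "(\<lambda>t. indicator {0..T} t * time_deriv \<phi> (t, x)) \<in> borel_measurable lborel"
        "(\<lambda>t. indicator {0<..<T} t * time_deriv \<phi> (t, x)) \<in> borel_measurable lborel" by auto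
      have "AE t in lborel. t \<noteq> 0" "AE t in lborel. t \<noteq> T" by (auto intro: AE_lborel_singleton)
      then show "AE t in lborel. indicator {0..T} t * time_deriv \<phi> (t, x) = indicator {0<..<T} t * time_deriv \<phi> (t, x)"
        by eventually_elim (auto simp: indicator_def)
    qed
    moreover have "(\<integral>t. ?f t x \<partial>lborel) = indicator \<Omega> x * (\<integral>t. indicator {0<..<T} t * time_deriv \<phi> (t, x) \<partial>lborel)"
      by (cases "x \<in> \<Omega>") (auto simp: indicator_def)
    ultimately show ?thesis by simp
  qed
  have "(\<integral>p. time_deriv \<phi> p \<partial>lebesgue_on S) = (\<integral>p. indicator S p * time_deriv \<phi> p \<partial>lborel)"
    by (rule integral_lebesgue_on(1)[OF b S_borel])
  also have "\<dots> = (\<integral>p. (case_prod ?f) p \<partial>(lborel \<Otimes>\<^sub>M lborel))"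
    by (simp add: lborel_prod case_prod_beta')
  also have "\<dots> = (\<integral>x. (\<integral>t. ?f t x \<partial>lborel) \<partial>lborel)"
    by (rule lborel_pair.integral_snd[OF i', symmetric])
  also have "\<dots> = (\<integral>x. indicator \<Omega> x * (- \<phi> (0, x)) \<partial>lborel)" by (simp only: inner)
  also have "\<dots> = (\<integral>x. - \<phi> (0, x) \<partial>lebesgue_on \<Omega>)"
  proof (rule integral_lebesgue_on(1)[symmetric, OF _ \<Omega>_b])
    show "(\<lambda>x. - \<phi> (0, x)) \<in> borel_measurable borel"
    proof (rule borel_measurable_continuous_onI, rule continuous_on_minus, rule continuous_on_compose2[OF C_c_inf_continuous[OF \<phi>, of UNIV]])
      show "continuous_on UNIV (\<lambda>x. (0::real, x :: 'a))" by (intro continuous_intros)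
    qed simp
  qed
  finally show ?thesis by simp
qed

section \<open>Traces of bounded fields\<close>

text \<open>Local finiteness up to \<open>t = 0\<close> and up to the lateral boundary enters here:
  the support \<open>K\<close> of a test function need not be contained in
  \<open>{0<..<T} \<times> \<Omega>\<close>, yet its intersection with that set has finite measure.
  This gives an integrable majorant for cut-off functions.\<close>

lemma
  fixes \<nu> :: "(real \<times> 'a::euclidean_space) measure"
  assumes sets: "sets \<nu> = sets (restrict_space borel ({0<..<T} \<times> \<Omega>))"
    and fin: "\<forall>K. compact K \<and> K \<subseteq> {0..<T} \<times> UNIV \<longrightarrow> emeasure \<nu> (K \<inter> ({0<..<T} \<times> \<Omega>)) < \<infinity>"
    and \<phi>: "\<phi> \<in> C_c_inf ({0..<T} \<times> UNIV)"
  shows integrable_radon: "integrable \<nu> \<phi>"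
    and integral_radon_tendsto: "(\<And>n. \<eta> n \<in> borel_measurable borel) \<Longrightarrow>
      (\<And>n p. p \<in> {0<..<T} \<times> \<Omega> \<Longrightarrow> \<bar>\<eta> n p\<bar> \<le> \<bar>\<phi> p\<bar>) \<Longrightarrow>
      (\<And>p. p \<in> {0<..<T} \<times> \<Omega> \<Longrightarrow> (\<lambda>n::nat. \<eta> n p) \<longlonglongrightarrow> \<phi> p) \<Longrightarrow>
      (\<lambda>n. \<integral>p. \<eta> n p \<partial>\<nu>) \<longlonglongrightarrow> (\<integral>p. \<phi> p \<partial>\<nu>)"
proof -
  let ?S = "{0<..<T} \<times> \<Omega>"
  have space: "space \<nu> = ?S" using sets_eq_imp_space_eq[OF sets] by (simp add: space_restrict_space)
  have meas: "f \<in> borel_measurable \<nu>" if "f \<in> borel_measurable borel" for f :: "real \<times> 'a \<Rightarrow> real"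
    using measurable_restrict_space1[OF that, of ?S] by (simp cong: measurable_cong_sets add: sets)
  obtain K R B where K: "compact K" "K \<subseteq> {0..<T} \<times> UNIV" and "R > 0" and B: "B \<ge> 0"
    and zero: "\<And>p. fst p \<in> {0..<T} \<Longrightarrow> p \<notin> K \<Longrightarrow> \<phi> p = 0"
    and "\<And>p. p \<in> K \<Longrightarrow> norm (snd p) < R"
    and bd: "\<And>p. fst p \<in> {0..<T} \<Longrightarrow> \<bar>\<phi> p\<bar> \<le> B"
    and "\<And>p h. fst p \<in> {0<..<T} \<Longrightarrow> p \<notin> K \<Longrightarrow> frechet_derivative \<phi> (at p) h = 0"
    and "\<And>p h. p \<in> K \<Longrightarrow> \<bar>frechet_derivative \<phi> (at p) h\<bar> \<le> B * norm h"
    by (rule C_c_infE[OF \<phi>]) (rule that)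
  have KS: "K \<inter> ?S \<in> sets \<nu>"
    unfolding sets sets_restrict_space using borel_compact[OF K(1)] by (intro image_eqI[of _ _ K]) auto
  show int: "integrable \<nu> \<phi>"
  proof (rule Bochner_Integration.integrable_bound[where f="\<lambda>p. B * indicator (K \<inter> ?S) p"])
    show "integrable \<nu> (\<lambda>p. B * indicator (K \<inter> ?S) p)"
      using KS fin K by (intro integrable_mult_right integrable_real_indicator) blast+
    show "AE p in \<nu>. norm (\<phi> p) \<le> norm (B * indicator (K \<inter> ?S) p)"
    proof (rule AE_I2)
      fix p assume "p \<in> space \<nu>"
      then have p: "p \<in> ?S" "fst p \<in> {0..<T}" by (auto simp: space)
      show "norm (\<phi> p) \<le> norm (B * indicator (K \<inter> ?S) p)"
        using bd[OF p(2)] zero[OF p(2)] p(1) B by (cases "p \<in> K") auto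
    qed
  qed (rule meas[OF C_c_inf_measurable[OF \<phi>]])
  show "(\<lambda>n. \<integral>p. \<eta> n p \<partial>\<nu>) \<longlonglongrightarrow> (\<integral>p. \<phi> p \<partial>\<nu>)"
    if \<eta>: "\<And>n. \<eta> n \<in> borel_measurable borel" "\<And>n p. p \<in> ?S \<Longrightarrow> \<bar>\<eta> n p\<bar> \<le> \<bar>\<phi> p\<bar>"
      "\<And>p. p \<in> ?S \<Longrightarrow> (\<lambda>n. \<eta> n p) \<longlonglongrightarrow> \<phi> p"
  proof (rule integral_dominated_convergence[where w="\<lambda>p. \<bar>\<phi> p\<bar>"])
    show "\<eta> n \<in> borel_measurable \<nu>" for n by (rule meas[OF \<eta>(1)])
    show "AE p in \<nu>. (\<lambda>n. \<eta> n p) \<longlonglongrightarrow> \<phi> p" using \<eta>(3) by (intro AE_I2) (simp add: space)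
    show "AE p in \<nu>. norm (\<eta> n p) \<le> \<bar>\<phi> p\<bar>" for n using \<eta>(2) by (intro AE_I2) (simp add: space)
  qed (use int in auto)
qed

lemma
  fixes \<Omega> :: "'a::euclidean_space set"
  assumes \<mu>: "locally_finite_signed_measure T \<Omega> \<mu>" and \<phi>: "\<phi> \<in> C_c_inf ({0..<T} \<times> UNIV)"
  shows signed_integral_add: "\<psi> \<in> C_c_inf ({0..<T} \<times> UNIV) \<Longrightarrow>
      signed_integral \<mu> (\<lambda>p. \<phi> p + \<psi> p) = signed_integral \<mu> \<phi> + signed_integral \<mu> \<psi>"
    and signed_integral_scale: "signed_integral \<mu> (\<lambda>p. c * \<phi> p) = c * signed_integral \<mu> \<phi>"
    and signed_integral_tendsto: "(\<And>n. \<eta> n \<in> borel_measurable borel) \<Longrightarrow>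
      (\<And>n p. p \<in> {0<..<T} \<times> \<Omega> \<Longrightarrow> \<bar>\<eta> n p\<bar> \<le> \<bar>\<phi> p\<bar>) \<Longrightarrow>
      (\<And>p. p \<in> {0<..<T} \<times> \<Omega> \<Longrightarrow> (\<lambda>n::nat. \<eta> n p) \<longlonglongrightarrow> \<phi> p) \<Longrightarrow>
      (\<lambda>n. signed_integral \<mu> (\<eta> n)) \<longlonglongrightarrow> signed_integral \<mu> \<phi>"
proof -
  have m1: "sets (fst \<mu>) = sets (restrict_space borel ({0<..<T} \<times> \<Omega>))"
    and f1: "\<forall>K. compact K \<and> K \<subseteq> {0..<T} \<times> UNIV \<longrightarrow> emeasure (fst \<mu>) (K \<inter> ({0<..<T} \<times> \<Omega>)) < \<infinity>"
    and m2: "sets (snd \<mu>) = sets (restrict_space borel ({0<..<T} \<times> \<Omega>))"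
    and f2: "\<forall>K. compact K \<and> K \<subseteq> {0..<T} \<times> UNIV \<longrightarrow> emeasure (snd \<mu>) (K \<inter> ({0<..<T} \<times> \<Omega>)) < \<infinity>"
    using \<mu> unfolding locally_finite_signed_measure_def by blast+
  note int = integrable_radon[OF m1 f1] integrable_radon[OF m2 f2]
  show "signed_integral \<mu> (\<lambda>p. \<phi> p + \<psi> p) = signed_integral \<mu> \<phi> + signed_integral \<mu> \<psi>"
    if "\<psi> \<in> C_c_inf ({0..<T} \<times> UNIV)"
    using int[OF \<phi>] int[OF that] by (simp add: signed_integral_def)
  show "signed_integral \<mu> (\<lambda>p. c * \<phi> p) = c * signed_integral \<mu> \<phi>"
    by (simp add: signed_integral_def right_diff_distrib)
  show "(\<lambda>n. signed_integral \<mu> (\<eta> n)) \<longlonglongrightarrow> signed_integral \<mu> \<phi>"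
    if "\<And>n. \<eta> n \<in> borel_measurable borel" "\<And>n p. p \<in> {0<..<T} \<times> \<Omega> \<Longrightarrow> \<bar>\<eta> n p\<bar> \<le> \<bar>\<phi> p\<bar>"
      "\<And>p. p \<in> {0<..<T} \<times> \<Omega> \<Longrightarrow> (\<lambda>n. \<eta> n p) \<longlonglongrightarrow> \<phi> p"
    unfolding signed_integral_def
    by (intro tendsto_diff integral_radon_tendsto[OF m1 f1 \<phi> that] integral_radon_tendsto[OF m2 f2 \<phi> that])
qed

lemma integrable_lebesgue_on_C_c_inf:
  fixes \<phi> :: "real \<times> 'a::euclidean_space \<Rightarrow> real"
  assumes \<phi>: "\<phi> \<in> C_c_inf ({0..<T} \<times> UNIV)" and S: "{0<..<T} \<times> \<Omega> \<in> sets borel"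
  shows "integrable (lebesgue_on ({0<..<T} \<times> \<Omega>)) \<phi>"
proof -
  let ?S = "{0<..<T} \<times> \<Omega>"
  obtain K R B where K: "compact K" "K \<subseteq> {0..<T} \<times> UNIV" and "R > 0" and B: "B \<ge> 0"
    and zero: "\<And>p. fst p \<in> {0..<T} \<Longrightarrow> p \<notin> K \<Longrightarrow> \<phi> p = 0"
    and "\<And>p. p \<in> K \<Longrightarrow> norm (snd p) < R"
    and bd: "\<And>p. fst p \<in> {0..<T} \<Longrightarrow> \<bar>\<phi> p\<bar> \<le> B"
    and "\<And>p h. fst p \<in> {0<..<T} \<Longrightarrow> p \<notin> K \<Longrightarrow> frechet_derivative \<phi> (at p) h = 0"
    and "\<And>p h. p \<in> K \<Longrightarrow> \<bar>frechet_derivative \<phi> (at p) h\<bar> \<le> B * norm h"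
    by (rule C_c_infE[OF \<phi>]) (rule that)
  show ?thesis
  proof (rule Bochner_Integration.integrable_bound[where f="\<lambda>p. B * indicator K p"])
    show "integrable (lebesgue_on ?S) (\<lambda>p. B * indicator K p)"
      using K(1) S
      by (intro integrable_mult_right integrable_lebesgue_on_indicator) (auto intro: compact_imp_bounded borel_compact)
    show "AE p in lebesgue_on ?S. norm (\<phi> p) \<le> norm (B * indicator K p)"
    proof (rule AE_I2)
      fix p assume "p \<in> space (lebesgue_on ?S)"
      then have p: "fst p \<in> {0..<T}" by (auto simp: space_restrict_space)
      show "norm (\<phi> p) \<le> norm (B * indicator K p)"
        using bd[OF p] zero[OF p] B by (cases "p \<in> K") auto
    qed
  qed (rule borel_measurable_lebesgue_on[OF C_c_inf_measurable[OF \<phi>]])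
qed

lemma integral_Linf_mult_tendsto:
  fixes \<phi> f :: "real \<times> 'a::euclidean_space \<Rightarrow> real"
  assumes f: "f \<in> Linf (lebesgue_on ({0<..<T} \<times> \<Omega>))"
    and \<phi>: "\<phi> \<in> C_c_inf ({0..<T} \<times> UNIV)" and S: "{0<..<T} \<times> \<Omega> \<in> sets borel"
    and \<eta>: "\<And>n. \<eta> n \<in> borel_measurable borel" "\<And>n p. p \<in> {0<..<T} \<times> \<Omega> \<Longrightarrow> \<bar>\<eta> n p\<bar> \<le> \<bar>\<phi> p\<bar>"
      "\<And>p. p \<in> {0<..<T} \<times> \<Omega> \<Longrightarrow> (\<lambda>n::nat. \<eta> n p) \<longlonglongrightarrow> \<phi> p"
  shows "(\<lambda>n. \<integral>p. f p * \<eta> n p \<partial>lebesgue_on ({0<..<T} \<times> \<Omega>)) \<longlonglongrightarrow> (\<integral>p. f p * \<phi> p \<partial>lebesgue_on ({0<..<T} \<times> \<Omega>))"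
proof -
  let ?L = "lebesgue_on ({0<..<T} \<times> \<Omega>)"
  have int: "integrable ?L (\<lambda>p. f p * \<phi> p)"
    by (rule integrable_Linf_mult[OF f integrable_lebesgue_on_C_c_inf[OF \<phi> S]])
  have f_m: "f \<in> borel_measurable ?L" using f by (simp add: Linf_def)
  show ?thesis
  proof (rule integral_dominated_convergence[where w="\<lambda>p. \<bar>f p * \<phi> p\<bar>"])
    show "(\<lambda>p. f p * \<eta> n p) \<in> borel_measurable ?L" for n
      by (intro borel_measurable_times f_m borel_measurable_lebesgue_on \<eta>(1))
    show "AE p in ?L. (\<lambda>n. f p * \<eta> n p) \<longlonglongrightarrow> f p * \<phi> p"
      using \<eta>(3) by (intro AE_I2 tendsto_mult tendsto_const) (simp add: space_restrict_space)
    show "AE p in ?L. norm (f p * \<eta> n p) \<le> \<bar>f p * \<phi> p\<bar>" for n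
      using \<eta>(2) by (intro AE_I2) (auto simp: space_restrict_space abs_mult intro!: mult_left_mono)
  qed (use int in auto)
qed

theorem lemma3p3:
  fixes \<Omega> :: "(real ^ 'n) set" and T :: real
    and b :: "real \<times> (real ^ 'n) \<Rightarrow> real ^ 'n"
    and \<mu> :: "(real \<times> (real ^ 'n)) measure \<times> (real \<times> (real ^ 'n)) measure"
  assumes "open \<Omega>" and "uniformly_lipschitz_boundary \<Omega>" and "T > 0"
    and "b \<in> Linf (lebesgue_on ({0<..<T} \<times> \<Omega>))"
    and "locally_finite_signed_measure T \<Omega> \<mu>" and "has_measure_divergence T \<Omega> b \<mu>"
  shows "(\<exists>\<tau>\<in>Linf (lateral_measure T \<Omega>). is_trace T \<Omega> b \<mu> \<tau> \<and>
            (\<forall>\<tau>'\<in>Linf (lateral_measure T \<Omega>). is_trace T \<Omega> b \<mu> \<tau>' \<longrightarrow>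
               (AE p in lateral_measure T \<Omega>. \<tau>' p = \<tau> p))) \<and>
         (\<forall>w\<in>Linf (lebesgue_on ({0<..<T} \<times> \<Omega>)). \<forall>f\<in>Linf (lebesgue_on ({0<..<T} \<times> \<Omega>)).
            weak_solution T \<Omega> b w f \<longrightarrow>
            (\<exists>\<tau>\<in>Linf (lateral_measure T \<Omega>). \<exists>w\<^sub>0\<in>Linf (lebesgue_on \<Omega>).
               is_transport_trace T \<Omega> b w f \<tau> w\<^sub>0 \<and>
               (\<forall>\<tau>'\<in>Linf (lateral_measure T \<Omega>). \<forall>w\<^sub>0'\<in>Linf (lebesgue_on \<Omega>).
                  is_transport_trace T \<Omega> b w f \<tau>' w\<^sub>0' \<longrightarrow>
                  (AE p in lateral_measure T \<Omega>. \<tau>' p = \<tau> p) \<and>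
                  (AE x in lebesgue_on \<Omega>. w\<^sub>0' x = w\<^sub>0 x))))"
proof -
  let ?S = "{0<..<T} \<times> \<Omega>" and ?V = "C_c_inf ({0..<T} \<times> (UNIV :: (real ^ 'n) set))"
  let ?L = "lebesgue_on ?S" and ?lat = "lateral_measure T \<Omega>" and ?I = "lebesgue_on \<Omega>"
  obtain Cb where Cb: "Cb \<ge> 0" "AE p in ?L. norm (b p) \<le> Cb" using assms(4) by (rule LinfE)
  have b_m: "b \<in> borel_measurable ?L" using assms(4) by (simp add: Linf_def)
  have int_lat: "integrable ?lat (\<lambda>p. \<tau> p * \<phi> p)" if "\<tau> \<in> Linf ?lat" "\<phi> \<in> ?V" for \<tau> \<phi>
    by (rule integrable_Linf_mult[OF that(1) integrable_lateral_measure[OF assms(1-3) that(2)]])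
  have int_I: "integrable ?I (\<lambda>x. \<phi> (0, x) * g x)" if "g \<in> Linf ?I" "\<phi> \<in> ?V" for g \<phi>
    using integrable_Linf_mult[OF that(1) integrable_initial[OF assms(1-3) that(2)]] by (simp add: mult.commute)
  have "\<exists>\<tau>\<in>Linf ?lat. is_trace T \<Omega> b \<mu> \<tau> \<and>
      (\<forall>\<tau>'\<in>Linf ?lat. is_trace T \<Omega> b \<mu> \<tau>' \<longrightarrow> (AE p in ?lat. \<tau>' p = \<tau> p))"
  proof -
    \<comment> \<open>The constant field \<open>(1, 0)\<close>, whose action is the time derivative;
      it supplies integrability and the integral of \<open>time_deriv \<phi>\<close>.\<close>
    interpret U: bounded_field T \<Omega> "\<lambda>_. 1" "\<lambda>_. 0" 1 0
      by standard (use assms(1-3) in auto)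
    have P: "bounded_field T \<Omega> (\<lambda>_. 0) b 0 Cb"
      by standard (use assms(1-3) b_m Cb in auto)
    interpret P: weak_balance T \<Omega> "\<lambda>_. 0" b 0 Cb "signed_integral \<mu>"
    proof (rule weak_balance.intro[OF P], unfold_locales)
      show "(\<integral>p. bounded_field.action (\<lambda>_. 0) b \<psi> p \<partial>?L) + signed_integral \<mu> \<psi> = 0"
        if "\<psi> \<in> C_c_inf ?S" for \<psi>
        using assms(6) that by (simp add: has_measure_divergence_def bounded_field.action_def[OF P])
    qed (use signed_integral_tendsto[OF assms(5)] signed_integral_add[OF assms(5)] signed_integral_scale[OF assms(5)] in auto)
    \<comment> \<open>Once the time derivative is integrated, the terms with
      \<open>\<phi> (0, x)\<close> cancel and the trace identity says that \<open>\<tau>\<close>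
      represents the functional of the field \<open>(0, b)\<close>.\<close>
    have iff: "is_trace T \<Omega> b \<mu> \<tau> \<longleftrightarrow> (\<forall>\<phi>\<in>?V. (\<integral>p. \<tau> p * \<phi> p \<partial>?lat) = P.balance \<phi>)" for \<tau>
    proof -
      have "(\<integral>p. time_deriv \<phi> p + b p \<bullet> space_grad \<phi> p \<partial>?L) + signed_integral \<mu> \<phi>
          = P.balance \<phi> - (\<integral>x. \<phi> (0, x) \<partial>?I)" if \<phi>: "\<phi> \<in> ?V" for \<phi>
      proof -
        have 1: "integrable ?L (time_deriv \<phi>)"
          using U.action_integrable[OF \<phi>] by (simp add: U.action_def[abs_def])
        have 2: "integrable ?L (\<lambda>p. b p \<bullet> space_grad \<phi> p)"
          using P.action_integrable[OF \<phi>] by (simp add: P.action_def[abs_def])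
        show ?thesis
          using U.integral_time_deriv[OF \<phi> 1] 1 2 by (simp add: P.balance_def P.action_def)
      qed
      then show ?thesis unfolding is_trace_def by (intro ball_cong refl) auto
    qed
    obtain \<tau> where \<tau>: "\<tau> \<in> Linf ?lat" "\<And>\<phi>. \<phi> \<in> ?V \<Longrightarrow> (\<integral>p. \<tau> p * \<phi> p \<partial>?lat) = P.balance \<phi>"
      using P.lateral_trace_exists by blast
    have "AE p in ?lat. \<tau>' p = \<tau> p" if \<tau>': "\<tau>' \<in> Linf ?lat" "is_trace T \<Omega> b \<mu> \<tau>'" for \<tau>'
    proof -
      have "AE p in ?lat. \<tau>' p - \<tau> p = 0"
      proof (rule trace_unique(1)[OF assms(1-3) Linf_diff[OF \<tau>'(1) \<tau>(1)]])
        \<comment> \<open>A single unknown function is the case of the joint uniqueness statement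
          with zero initial component.\<close>
        show "(\<lambda>_. 0) \<in> Linf ?I" by (auto intro!: LinfI[where C=0])
        fix \<phi> assume \<phi>: "\<phi> \<in> ?V"
        show "(\<integral>p. (\<tau>' p - \<tau> p) * \<phi> p \<partial>?lat) + (\<integral>x. 0 * \<phi> (0, x) \<partial>?I) = 0"
          using int_lat[OF \<tau>(1) \<phi>] int_lat[OF \<tau>'(1) \<phi>] \<tau>(2)[OF \<phi>] \<tau>'(2) \<phi>
          by (simp add: iff left_diff_distrib)
      qed
      then show ?thesis by simp
    qed
    then show ?thesis using \<tau> iff by (intro bexI[of _ \<tau>]) auto
  qed
  moreover have "\<exists>\<tau>\<in>Linf ?lat. \<exists>w\<^sub>0\<in>Linf ?I. is_transport_trace T \<Omega> b w f \<tau> w\<^sub>0 \<and>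
      (\<forall>\<tau>'\<in>Linf ?lat. \<forall>w\<^sub>0'\<in>Linf ?I. is_transport_trace T \<Omega> b w f \<tau>' w\<^sub>0' \<longrightarrow>
        (AE p in ?lat. \<tau>' p = \<tau> p) \<and> (AE x in ?I. w\<^sub>0' x = w\<^sub>0 x))"
    if w: "w \<in> Linf ?L" and f: "f \<in> Linf ?L" and sol: "weak_solution T \<Omega> b w f" for w f
  proof -
    obtain Cw where Cw: "Cw \<ge> 0" "AE p in ?L. norm (w p) \<le> Cw" using w by (rule LinfE)
    have w_m: "w \<in> borel_measurable ?L" using w by (simp add: Linf_def)
    have wb: "AE p in ?L. norm (w p *\<^sub>R b p) \<le> Cw * Cb"
      using Cw(2) Cb(2) by eventually_elim (auto intro!: mult_mono Cw(1))
    \<comment> \<open>The space-time field \<open>(w, w b)\<close>; its action is \<open>w\<close>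
      times the transport derivative, so \<open>sol\<close> is the required weak balance.\<close>
    have P: "bounded_field T \<Omega> w (\<lambda>p. w p *\<^sub>R b p) Cw (Cw * Cb)"
      by standard (use assms(1-3) b_m w_m Cb Cw wb in auto)
    interpret P: bounded_field T \<Omega> w "\<lambda>p. w p *\<^sub>R b p" Cw "Cw * Cb" by (rule P)
    have action: "P.action \<phi> p = w p * (time_deriv \<phi> p + b p \<bullet> space_grad \<phi> p)" for \<phi> p
      by (simp add: P.action_def distrib_left)
    have int_f: "integrable ?L (\<lambda>p. f p * \<phi> p)" if "\<phi> \<in> ?V" for \<phi>
      by (rule integrable_Linf_mult[OF f integrable_lebesgue_on_C_c_inf[OF that P.S_borel]])
    interpret P: weak_balance T \<Omega> w "\<lambda>p. w p *\<^sub>R b p" Cw "Cw * Cb" "\<lambda>\<phi>. \<integral>p. f p * \<phi> p \<partial>?L"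
    proof unfold_locales
      show "(\<integral>p. P.action \<psi> p \<partial>?L) + (\<integral>p. f p * \<psi> p \<partial>?L) = 0" if "\<psi> \<in> C_c_inf ?S" for \<psi>
        using sol that by (simp add: weak_solution_def action)
      show "(\<integral>p. f p * (\<phi> p + \<phi>' p) \<partial>?L) = (\<integral>p. f p * \<phi> p \<partial>?L) + (\<integral>p. f p * \<phi>' p \<partial>?L)"
        if "\<phi> \<in> ?V" "\<phi>' \<in> ?V" for \<phi> \<phi>'
        using int_f[OF that(1)] int_f[OF that(2)] by (simp add: distrib_left)
      show "(\<integral>p. f p * (c * \<phi> p) \<partial>?L) = c * (\<integral>p. f p * \<phi> p \<partial>?L)" for c \<phi>
        by (simp add: mult.left_commute)
    qed (rule integral_Linf_mult_tendsto[OF f _ P.S_borel])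
    have iff: "is_transport_trace T \<Omega> b w f \<tau> w\<^sub>0 \<longleftrightarrow>
        (\<forall>\<phi>\<in>?V. (\<integral>p. \<tau> p * \<phi> p \<partial>?lat) - (\<integral>x. \<phi> (0, x) * w\<^sub>0 x \<partial>?I) = P.balance \<phi>)" for \<tau> w\<^sub>0
      by (simp add: is_transport_trace_def P.balance_def action)
    obtain \<tau> w\<^sub>0 where \<tau>: "\<tau> \<in> Linf ?lat" and w\<^sub>0: "w\<^sub>0 \<in> Linf ?I"
      and tr: "\<And>\<phi>. \<phi> \<in> ?V \<Longrightarrow> (\<integral>p. \<tau> p * \<phi> p \<partial>?lat) - (\<integral>x. \<phi> (0, x) * w\<^sub>0 x \<partial>?I) = P.balance \<phi>"
      using P.trace_exists by blast
    have "(AE p in ?lat. \<tau>' p = \<tau> p) \<and> (AE x in ?I. w\<^sub>0' x = w\<^sub>0 x)"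
      if \<tau>': "\<tau>' \<in> Linf ?lat" and w\<^sub>0': "w\<^sub>0' \<in> Linf ?I" and tr': "is_transport_trace T \<Omega> b w f \<tau>' w\<^sub>0'" for \<tau>' w\<^sub>0'
    proof -
      \<comment> \<open>The difference of two solutions is a pair annihilating all test functions.
        The order of subtraction is swapped for the initial values because they enter the identity
        with a minus sign.\<close>
      have zero: "(\<integral>p. (\<tau>' p - \<tau> p) * \<phi> p \<partial>?lat) + (\<integral>x. (w\<^sub>0 x - w\<^sub>0' x) * \<phi> (0, x) \<partial>?I) = 0"
        if \<phi>: "\<phi> \<in> ?V" for \<phi>
      proof -
        have "(\<integral>p. (\<tau>' p - \<tau> p) * \<phi> p \<partial>?lat) = (\<integral>p. \<tau>' p * \<phi> p \<partial>?lat) - (\<integral>p. \<tau> p * \<phi> p \<partial>?lat)"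
          using int_lat[OF \<tau> \<phi>] int_lat[OF \<tau>' \<phi>] by (simp add: left_diff_distrib)
        moreover have "(\<integral>x. (w\<^sub>0 x - w\<^sub>0' x) * \<phi> (0, x) \<partial>?I)
            = (\<integral>x. \<phi> (0, x) * w\<^sub>0 x \<partial>?I) - (\<integral>x. \<phi> (0, x) * w\<^sub>0' x \<partial>?I)"
        proof -
          have "(\<integral>x. (w\<^sub>0 x - w\<^sub>0' x) * \<phi> (0, x) \<partial>?I) = (\<integral>x. \<phi> (0, x) * w\<^sub>0 x - \<phi> (0, x) * w\<^sub>0' x \<partial>?I)"
            by (simp add: algebra_simps)
          then show ?thesis
            using int_I[OF w\<^sub>0 \<phi>] int_I[OF w\<^sub>0' \<phi>] by simp
        qed
        moreover have "(\<integral>p. \<tau>' p * \<phi> p \<partial>?lat) - (\<integral>x. \<phi> (0, x) * w\<^sub>0' x \<partial>?I) = P.balance \<phi>"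
          using tr' \<phi> by (simp add: iff)
        ultimately show ?thesis using tr[OF \<phi>] by linarith
      qed
      note unique = trace_unique[OF assms(1-3) Linf_diff[OF \<tau>' \<tau>] Linf_diff[OF w\<^sub>0 w\<^sub>0']]
      have "AE p in ?lat. \<tau>' p - \<tau> p = 0" by (rule unique(1)) (rule zero)
      moreover have "AE x in ?I. w\<^sub>0 x - w\<^sub>0' x = 0" by (rule unique(2)) (rule zero)
      then have "AE x in ?I. w\<^sub>0' x = w\<^sub>0 x" by eventually_elim simp
      ultimately show ?thesis by simp
    qed
    then show ?thesis using \<tau> w\<^sub>0 tr iff by blast
  qed
  ultimately show ?thesis by blast
qed

end
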